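(* Let $f\in L^2(\Omega)$, $\iota\in(0,1)$, and let $w\in H^3_0(\Omega)$ be the solution of $\iota^2(\nabla^3w,\nabla^3v)+(\nabla^2w,\nabla^2v)=(f,v)$ for all $v\in H^3_0(\Omega)$. There is a constant $C>0$ independent of $h$ and $\iota$ such that for any $K\in\mathcal T_h$, any interior edge $e\in\mathcal E^i(\mathcal T_h)$ and any $v_h\in V_h$, $$\|f\|_{0,K}\le C\big(\|f-\Pi_K^0f\|_{0,K}+\iota^2h_K^{-3}|w-v_h|_{3,K}+h_K^{-2}|w-v_h|_{2,K}\big),$$ $$\iota^4\|[\![\partial_{\boldsymbol{nnn}}v_h]\!]\|_{0,e}^2\le C\Big(h_e^5\sum_{K\in\mathcal T_e}\|f-\Pi_K^0f\|_{0,K}^2+\iota^4h_e^{-1}\sum_{K\in\mathcal T_e}|w-v_h|_{3,K}^2+h_e\sum_{K\in\mathcal T_e}|w-v_h|_{2,K}^2\Big),$$ $$\|[\![\partial_{\boldsymbol{nn}}v_h]\!]\|_{0,e}^2\le C\Big(h_e^3\sum_{K\in\mathcal T_e}\|f-\Pi_K^0f\|_{0,K}^2+\iota^4h_e^{-3}\sum_{K\in\mathcal T_e}|w-v_h|_{3,K}^2+h_e^{-1}\sum_{K\in\mathcal T_e}|w-v_h|_{2,K}^2\Big).$$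
   Context: $\Omega\subset\mathbb R^2$ is a convex polygon, and $\mathcal T_h$ belongs to a family of triangulations of $\Omega$ into triangles $K$ that is shape regular: there is a fixed $\gamma_0\ge1$ with $h_K/\rho_K\le\gamma_0$ for all $K\in\mathcal T_h$, where $h_K=\mathrm{diam}(K)$ and $\rho_K$ is the diameter of the largest inscribed disc; $h=\max_Kh_K$. $\mathcal E^i(\mathcal T_h)$ is the set of interior edges, $h_e$ the length of $e$, and $\mathcal T_e$ the set of triangles sharing the edge $e$. $(\cdot,\cdot)$ is the $L^2(\Omega)$ inner product, $|\cdot|_{m,K}$ the $H^m(K)$ semi-norm, and $\Pi_K^0:L^2(K)\to\mathbb P_0(K)$ the $L^2$ projection onto constants. For an interior edge $e$ shared by $K^+$ and $K^-$, $\boldsymbol n_e$ is the unit outward normal of $K^+$ on $e$, and $[\![\partial v]\!]|_e=\partial v|_{K^+}-\partial v|_{K^-}$ for $\partial=\partial_{\boldsymbol{nn}},\partial_{\boldsymbol{nnn}}$, the second and third derivatives in direction $\boldsymbol n_e$. $V_h$ is the Hermite finite element space: all $v\in H^1(\Omega)$ with $v|_K\in\mathbb P_3(K)$ for all $K\in\mathcal T_h$, such that $v$ and $\nabla v$ are continuous at all vertices of $\mathcal T_h$, and $v$ and $\nabla v$ vanish at all vertices on $\partial\Omega$. *)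

theory Defs
  imports "HOL-Analysis.Analysis"
begin

type_synonym plane = "real^2"

section \<open>Classical derivatives and test functions\<close>

definition dir_deriv :: "plane \<Rightarrow> (plane \<Rightarrow> real) \<Rightarrow> plane \<Rightarrow> real" where
  "dir_deriv d g = (\<lambda>x. frechet_derivative g (at x) d)"

text \<open>Iterated partial derivatives are indexed by lists of coordinate directions.  Summing over
  all lists of length m gives the full tensor contraction of m-th order gradients.\<close>

definition partials :: "2 list \<Rightarrow> (plane \<Rightarrow> real) \<Rightarrow> plane \<Rightarrow> real" where
  "partials \<alpha> g = foldr (\<lambda>i. dir_deriv (axis i 1)) \<alpha> g"

text \<open>Differentiability of all iterated partial derivatives is the same as being of
  class C-infinity.\<close>

definition smooth :: "(plane \<Rightarrow> real) \<Rightarrow> bool" where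
  "smooth g \<longleftrightarrow> (\<forall>\<alpha> x. partials \<alpha> g differentiable (at x))"

definition test_functions :: "plane set \<Rightarrow> (plane \<Rightarrow> real) set" where
  "test_functions U = {\<phi>. smooth \<phi> \<and> compact (closure {x. \<phi> x \<noteq> 0}) \<and> closure {x. \<phi> x \<noteq> 0} \<subseteq> U}"

section \<open>Lebesgue and Sobolev spaces\<close>

text \<open>Elements of the function spaces on U are total functions of which only the values
  almost everywhere on U matter.  In the Sobolev notions U is meant to be open.\<close>

definition L2 :: "plane set \<Rightarrow> (plane \<Rightarrow> real) set" where
  "L2 U = {g. g \<in> borel_measurable (lebesgue_on U) \<and> integrable (lebesgue_on U) (\<lambda>x. (g x)\<^sup>2)}"

definition L2_inner :: "plane set \<Rightarrow> (plane \<Rightarrow> real) \<Rightarrow> (plane \<Rightarrow> real) \<Rightarrow> real" where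
  "L2_inner U f g = (LINT x|lebesgue_on U. f x * g x)"

definition L2_norm :: "plane set \<Rightarrow> (plane \<Rightarrow> real) \<Rightarrow> real" where
  "L2_norm U g = sqrt (L2_inner U g g)"

definition has_weak_deriv ::
    "plane set \<Rightarrow> 2 list \<Rightarrow> (plane \<Rightarrow> real) \<Rightarrow> (plane \<Rightarrow> real) \<Rightarrow> bool" where
  "has_weak_deriv U \<alpha> u g \<longleftrightarrow>
     (\<forall>\<phi>\<in>test_functions U. L2_inner U u (partials \<alpha> \<phi>) = (-1) ^ length \<alpha> * L2_inner U g \<phi>)"

definition sobolev :: "plane set \<Rightarrow> nat \<Rightarrow> (plane \<Rightarrow> real) set" where
  "sobolev U m = {u \<in> L2 U. \<forall>\<alpha>. length \<alpha> \<le> m \<longrightarrow> (\<exists>g\<in>L2 U. has_weak_deriv U \<alpha> u g)}"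

text \<open>The chosen weak derivative is determined up to null sets only; all uses below are integrals.\<close>

definition wderiv :: "plane set \<Rightarrow> 2 list \<Rightarrow> (plane \<Rightarrow> real) \<Rightarrow> plane \<Rightarrow> real" where
  "wderiv U \<alpha> u = (SOME g. g \<in> L2 U \<and> has_weak_deriv U \<alpha> u g)"

definition grad_inner ::
    "plane set \<Rightarrow> nat \<Rightarrow> (plane \<Rightarrow> real) \<Rightarrow> (plane \<Rightarrow> real) \<Rightarrow> real" where
  "grad_inner U m u v = (\<Sum>\<alpha> | length \<alpha> = m. L2_inner U (wderiv U \<alpha> u) (wderiv U \<alpha> v))"

definition sobolev_seminorm :: "plane set \<Rightarrow> nat \<Rightarrow> (plane \<Rightarrow> real) \<Rightarrow> real" where
  "sobolev_seminorm U m u = sqrt (grad_inner U m u u)"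

definition sobolev_norm :: "plane set \<Rightarrow> nat \<Rightarrow> (plane \<Rightarrow> real) \<Rightarrow> real" where
  "sobolev_norm U m u = sqrt (\<Sum>k\<le>m. (sobolev_seminorm U k u)\<^sup>2)"

definition sobolev0 :: "plane set \<Rightarrow> nat \<Rightarrow> (plane \<Rightarrow> real) set" where
  "sobolev0 U m = {u \<in> sobolev U m. \<exists>\<phi>. (\<forall>k. \<phi> k \<in> test_functions U) \<and>
     (\<lambda>k. sobolev_norm U m (\<lambda>x. u x - \<phi> k x)) \<longlonglongrightarrow> 0}"

definition weak_solution ::
    "plane set \<Rightarrow> real \<Rightarrow> (plane \<Rightarrow> real) \<Rightarrow> (plane \<Rightarrow> real) \<Rightarrow> bool" where
  "weak_solution \<Omega> \<iota> f w \<longleftrightarrow> w \<in> sobolev0 \<Omega> 3 \<and>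
     (\<forall>v\<in>sobolev0 \<Omega> 3. \<iota>\<^sup>2 * grad_inner \<Omega> 3 w v + grad_inner \<Omega> 2 w v = L2_inner \<Omega> f v)"

text \<open>The value of the L2-orthogonal projection onto the constants.\<close>

definition proj0 :: "plane set \<Rightarrow> (plane \<Rightarrow> real) \<Rightarrow> real" where
  "proj0 U f = (THE c. \<forall>q::real. L2_inner U (\<lambda>x. f x - c) (\<lambda>x. q) = 0)"

section \<open>Triangulations\<close>

text \<open>Domains are open, triangles and edges are closed.\<close>

definition convex_polygon :: "plane set \<Rightarrow> bool" where
  "convex_polygon \<Omega> \<longleftrightarrow> \<Omega> \<noteq> {} \<and> (\<exists>P. polytope P \<and> \<Omega> = interior P)"

text \<open>The predicate triangulation contains the conformity condition: two cells meet in a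
  common (possibly empty) face.\<close>

definition triangulation_of :: "plane set \<Rightarrow> plane set set \<Rightarrow> bool" where
  "triangulation_of \<Omega> T \<longleftrightarrow> triangulation T \<and> (\<forall>K\<in>T. 2 simplex K) \<and> \<Union>T = closure \<Omega>"

definition incircle_diameter :: "plane set \<Rightarrow> real" where
  "incircle_diameter K = Sup {2 * r | r. 0 \<le> r \<and> (\<exists>c. cball c r \<subseteq> K)}"

definition shape_regular :: "real \<Rightarrow> plane set set \<Rightarrow> bool" where
  "shape_regular \<gamma> T \<longleftrightarrow> (\<forall>K\<in>T. diameter K / incircle_diameter K \<le> \<gamma>)"

definition interior_edges :: "plane set \<Rightarrow> plane set set \<Rightarrow> plane set set" where
  "interior_edges \<Omega> T = {e. (\<exists>K\<in>T. e edge_of K) \<and> \<not> e \<subseteq> frontier \<Omega>}"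

definition edge_patch :: "plane set set \<Rightarrow> plane set \<Rightarrow> plane set set" where
  "edge_patch T e = {K \<in> T. e edge_of K}"

definition outward_unit_normal :: "plane set \<Rightarrow> plane set \<Rightarrow> plane \<Rightarrow> bool" where
  "outward_unit_normal K e n \<longleftrightarrow> norm n = 1 \<and>
     (\<forall>x\<in>e. \<forall>y\<in>e. n \<bullet> (y - x) = 0) \<and> (\<forall>x\<in>e. \<forall>y\<in>K. n \<bullet> (y - x) \<le> 0)"

text \<open>L2 norm with respect to arc length.  The choice is unique up to swapping the end points,
  which does not affect the value.\<close>

definition edge_L2_norm :: "plane set \<Rightarrow> (plane \<Rightarrow> real) \<Rightarrow> real" where
  "edge_L2_norm e g = (let (a, b) = (SOME (a, b). e = closed_segment a b) in
     sqrt (dist a b * integral {0..1} (\<lambda>t. (g (linepath a b t))\<^sup>2)))"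

section \<open>The Hermite finite element space\<close>

definition poly_space :: "nat \<Rightarrow> (plane \<Rightarrow> real) set" where
  "poly_space k = {p. \<exists>c. p = (\<lambda>x. \<Sum>i\<le>k. \<Sum>j\<le>k - i. c i j * (x $ 1) ^ i * (x $ 2) ^ j)}"

text \<open>The polynomial representing v on K, extended to the whole plane.  It supplies the point
  values and one-sided traces of v and of its derivatives on the boundary of K.\<close>

definition restr :: "(plane \<Rightarrow> real) \<Rightarrow> plane set \<Rightarrow> plane \<Rightarrow> real" where
  "restr v K = (SOME p. p \<in> poly_space 3 \<and> (AE x in lebesgue_on (interior K). v x = p x))"

definition hermite_space :: "plane set \<Rightarrow> plane set set \<Rightarrow> (plane \<Rightarrow> real) set" where
  "hermite_space \<Omega> T = {v \<in> sobolev \<Omega> 1.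
     (\<forall>K\<in>T. \<exists>p\<in>poly_space 3. AE x in lebesgue_on (interior K). v x = p x) \<and>
     (\<forall>K\<in>T. \<forall>K'\<in>T. \<forall>a. a extreme_point_of K \<and> a extreme_point_of K' \<longrightarrow>
        restr v K a = restr v K' a \<and>
        frechet_derivative (restr v K) (at a) = frechet_derivative (restr v K') (at a)) \<and>
     (\<forall>K\<in>T. \<forall>a. a extreme_point_of K \<and> a \<in> frontier \<Omega> \<longrightarrow>
        restr v K a = 0 \<and> frechet_derivative (restr v K) (at a) = (\<lambda>d. 0))}"

text \<open>The jump across an edge of the m-th derivative in direction n.\<close>

definition jump ::
    "nat \<Rightarrow> plane \<Rightarrow> (plane \<Rightarrow> real) \<Rightarrow> plane set \<Rightarrow> plane set \<Rightarrow> plane \<Rightarrow> real" where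
  "jump m n v Kp Km = (\<lambda>x. (dir_deriv n ^^ m) (restr v Kp) x - (dir_deriv n ^^ m) (restr v Km) x)"

end

theory Submission
  imports Defs
begin

text \<open>
  Test the equation with smooth bump functions.  A bump \<open>\<phi>\<close> supported in a disc inside the triangle \<open>K\<close>
  does not see the discrete function \<open>v\<close>, because integrating by parts as often as the order of the
  derivatives annihilates a cubic.  Hence \<open>(f, \<phi>)\<close> is controlled by derivatives of \<open>w - v\<close>, and
  replacing \<open>f\<close> by its mean bounds that mean.

  For an edge let \<open>s\<close> be the signed distance to its line and \<open>D\<close> the difference of the two cubics.
  With \<open>\<phi> = s \<psi>\<close> the boundary terms of \<open>D\<close> reduce to
  \<open>2 \<iota>\<^sup>2 D\<^sub>n\<^sub>n\<^sub>n \<integral>\<^sub>e \<psi>\<^sub>n + \<integral>\<^sub>e D\<^sub>n\<^sub>n \<psi>\<close>, since all other jumps meet \<open>\<phi> = 0\<close> or integrate to zero along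
  the edge.  On the edge \<open>D\<^sub>n\<^sub>n\<^sub>n\<close> is constant and \<open>D\<^sub>n\<^sub>n = a + b t\<close>, where \<open>t\<close> is the arc length from
  the midpoint.  For a radial bump \<open>\<beta>\<close> of radius comparable to the length of the edge, the choices
  \<open>\<psi> = s \<beta>\<close>, \<open>\<psi> = \<beta>\<close> and \<open>\<psi> = t \<beta>\<close> isolate \<open>D\<^sub>n\<^sub>n\<^sub>n\<close>, \<open>a\<close> and \<open>b\<close>.
\<close>

subsection \<open>Smooth functions\<close>

text \<open>Derivatives are always moved from the test function onto the cubics, so that on the edge
  \<open>D\<close> enters only through its second and third derivatives. The three tests decouple
  the two jumps. The choice \<open>\<psi> = s \<beta>\<close> vanishes on the edge, which removes
  the second derivative of \<open>D\<close>. For \<beta> and \<open>t \<beta>\<close> the normal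
  derivative vanishes on the edge because \<beta> is radial with its centre there, which removes the
  third. Hence neither jump bound passes through the other, and \<iota> occurs only as the
  coefficient of the equation. A disc around the midpoint is enough: a function that is affine on a
  line is determined by two moments taken near one point. The constants cannot depend on the
  direction of the edge, since all test functions are combinations, with controlled coefficients, of
  finitely many fixed functions after a dilation and a translation. The load term of an edge test is
  absorbed by the cell estimate. A separate obstacle is that \<open>wderiv\<close> is a choice of
  representative: every passage to a classical derivative rests on the uniqueness of weak
  derivatives almost everywhere, hence on the fundamental lemma.\<close>

abbreviation (input) pd :: "2 \<Rightarrow> (plane \<Rightarrow> real) \<Rightarrow> plane \<Rightarrow> real" where
  "pd i \<equiv> dir_deriv (axis i 1)"

abbreviation (input) dble :: "(plane \<Rightarrow> real) \<Rightarrow> bool" where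
  "dble g \<equiv> \<forall>x. g differentiable (at x)"

lemma dir_derivI: "(g has_derivative g') (at x) \<Longrightarrow> dir_deriv d g x = g' d"
  unfolding dir_deriv_def by (metis frechet_derivative_at)

lemma dble_has_derivative: "dble g \<Longrightarrow> (g has_derivative (\<lambda>d. dir_deriv d g x)) (at x)"
  unfolding dir_deriv_def by (metis frechet_derivative_works eta_contract_eq)

lemma dir_deriv_const [simp]: "dir_deriv d (\<lambda>x. c) = (\<lambda>x. 0)"
  by (rule ext, rule dir_derivI[OF has_derivative_const])

lemma dir_deriv_add:
  "dble f \<Longrightarrow> dble g \<Longrightarrow> dir_deriv d (\<lambda>x. f x + g x) = (\<lambda>x. dir_deriv d f x + dir_deriv d g x)"
  by (rule ext, rule dir_derivI[OF has_derivative_add[OF dble_has_derivative dble_has_derivative]])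

lemma dir_deriv_diff:
  "dble f \<Longrightarrow> dble g \<Longrightarrow> dir_deriv d (\<lambda>x. f x - g x) = (\<lambda>x. dir_deriv d f x - dir_deriv d g x)"
  by (rule ext, rule dir_derivI[OF has_derivative_diff[OF dble_has_derivative dble_has_derivative]])

lemma dir_deriv_mult:
  "dble f \<Longrightarrow> dble g \<Longrightarrow>
    dir_deriv d (\<lambda>x. f x * g x) = (\<lambda>x. dir_deriv d f x * g x + f x * dir_deriv d g x)"
  by (rule ext, subst dir_derivI[OF has_derivative_mult[OF dble_has_derivative dble_has_derivative]]) auto

lemma dir_deriv_nth: "dir_deriv d (\<lambda>x. x $ i) = (\<lambda>x. d $ i)"
  by (rule ext, rule dir_derivI) (rule bounded_linear.has_derivative[OF bounded_linear_vec_nth has_derivative_ident])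

lemma plane_eq_axis: "(d::plane) = (\<Sum>i\<in>UNIV. d $ i *\<^sub>R axis i 1)"
  by (simp add: vec_eq_iff axis_def sum_2) (metis exhaust_2)

lemma dir_deriv_expand:
  assumes "dble g" shows "dir_deriv d g x = (\<Sum>i\<in>UNIV. d $ i * pd i g x)"
proof -
  have l: "linear (\<lambda>d. dir_deriv d g x)"
    using dble_has_derivative[OF assms] has_derivative_linear by blast
  show ?thesis
    by (subst plane_eq_axis[of d]) (simp only: linear_sum[OF l] linear_cmul[OF l] real_scaleR_def)
qed

lemma partials_Nil [simp]: "partials [] g = g"
  by (simp add: partials_def)

lemma partials_Cons [simp]: "partials (i # \<alpha>) g = pd i (partials \<alpha> g)"
  by (simp add: partials_def)

lemma partials_append: "partials (\<alpha> @ \<beta>) g = partials \<alpha> (partials \<beta> g)"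
  by (simp add: partials_def)

lemma partials_snoc: "partials (\<alpha> @ [i]) g = partials \<alpha> (pd i g)"
  by (simp add: partials_append)

text \<open>The innermost derivative is split off. The product and chain rules then lower
  \<open>k\<close> by one, so closure properties follow by induction on \<open>k\<close> over
  arbitrary functions, without expanding iterated derivatives of products.\<close>

primrec cdiff :: "nat \<Rightarrow> (plane \<Rightarrow> real) \<Rightarrow> bool" where
  "cdiff 0 g = dble g"
| "cdiff (Suc k) g = (dble g \<and> (\<forall>i. cdiff k (pd i g)))"

lemma cdiff_dble: "cdiff k g \<Longrightarrow> dble g"
  by (cases k) auto

lemma cdiff_iff: "cdiff k g \<longleftrightarrow> (\<forall>\<alpha>. length \<alpha> \<le> k \<longrightarrow> dble (partials \<alpha> g))"
proof (induction k arbitrary: g)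
  case 0 then show ?case by simp
next
  case (Suc k)
  have "(\<forall>\<alpha>. length \<alpha> \<le> Suc k \<longrightarrow> dble (partials \<alpha> g))
     \<longleftrightarrow> dble g \<and> (\<forall>i \<alpha>. length \<alpha> \<le> k \<longrightarrow> dble (partials (\<alpha> @ [i]) g))" (is "?L = ?R")
  proof
    assume L: ?L
    show ?R using L[rule_format, of "[]"] L[rule_format, of "_ @ [_]"] by auto
  next
    assume R: ?R
    show ?L
    proof (intro allI impI)
      fix \<alpha> :: "2 list" and x assume l: "length \<alpha> \<le> Suc k"
      show "partials \<alpha> g differentiable at x"
        using R l by (cases \<alpha> rule: rev_cases) auto
    qed
  qed
  then show ?case using Suc by (simp add: partials_snoc)
qed

lemma smooth_iff: "smooth g \<longleftrightarrow> (\<forall>k. cdiff k g)"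
  unfolding smooth_def cdiff_iff by blast

lemma smooth_dble: "smooth g \<Longrightarrow> dble g"
  using cdiff_dble smooth_iff by blast

lemma smooth_pd: "smooth g \<Longrightarrow> smooth (pd i g)"
  unfolding smooth_iff by (meson cdiff.simps(2))

lemma smooth_partials: "smooth g \<Longrightarrow> smooth (partials \<alpha> g)"
  by (induction \<alpha>) (auto intro: smooth_pd)

section \<open>Closure properties of smooth functions\<close>

lemma cdiff_const: "cdiff k (\<lambda>x. c)"
  by (induction k arbitrary: c) auto

lemma cdiff_add: "cdiff k f \<Longrightarrow> cdiff k g \<Longrightarrow> cdiff k (\<lambda>x. f x + g x)"
  by (induction k arbitrary: f g) (auto simp: dir_deriv_add)

lemma cdiff_mono: "cdiff (Suc k) f \<Longrightarrow> cdiff k f"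
  by (induction k arbitrary: f) auto

lemma cdiff_mult: "cdiff k f \<Longrightarrow> cdiff k g \<Longrightarrow> cdiff k (\<lambda>x. f x * g x)"
proof (induction k arbitrary: f g)
  case (Suc k)
  then have "cdiff k f" "cdiff k g" using cdiff_mono by blast+
  then show ?case using Suc by (auto simp: dir_deriv_mult intro!: cdiff_add)
qed auto

lemma dble_nth: "dble (\<lambda>x. x $ i)"
  using bounded_linear.has_derivative[OF bounded_linear_vec_nth has_derivative_ident] differentiableI by blast

lemma cdiff_nth: "cdiff k (\<lambda>x. x $ i)"
proof (cases k)
  case (Suc l)
  then show ?thesis by (auto simp: dir_deriv_nth cdiff_const dble_nth)
qed (auto simp: dble_nth)

lemma smooth_const [intro!]: "smooth (\<lambda>x. c)"
  and smooth_add [intro!]: "smooth f \<Longrightarrow> smooth g \<Longrightarrow> smooth (\<lambda>x. f x + g x)"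
  and smooth_mult [intro!]: "smooth f \<Longrightarrow> smooth g \<Longrightarrow> smooth (\<lambda>x. f x * g x)"
  and smooth_nth [intro!]: "smooth (\<lambda>x. x $ i)"
  by (simp_all add: smooth_iff cdiff_const cdiff_add cdiff_mult cdiff_nth)

lemma smooth_minus [intro!]: "smooth f \<Longrightarrow> smooth (\<lambda>x. - f x)"
  using smooth_mult[OF smooth_const[of "-1"]] by simp

lemma smooth_diff [intro!]: "smooth f \<Longrightarrow> smooth g \<Longrightarrow> smooth (\<lambda>x. f x - g x)"
  using smooth_add[OF _ smooth_minus] by simp

lemma smooth_sum [intro!]: "(\<And>i. i \<in> I \<Longrightarrow> smooth (f i)) \<Longrightarrow> smooth (\<lambda>x. \<Sum>i\<in>I. f i x)"
  by (induction I rule: infinite_finite_induct) auto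

lemma smooth_power [intro!]: "smooth f \<Longrightarrow> smooth (\<lambda>x. f x ^ k)"
  by (induction k) auto

lemma smooth_inner [intro!]: "smooth (\<lambda>x. n \<bullet> (x - m))"
  by (auto simp: inner_vec_def)

lemma smooth_dir_deriv: assumes "smooth g" shows "smooth (dir_deriv d g)"
proof -
  have "dir_deriv d g = (\<lambda>x. \<Sum>i\<in>UNIV. d $ i * pd i g x)"
    using dir_deriv_expand[OF smooth_dble[OF assms]] by blast
  then show ?thesis using smooth_pd[OF assms] by auto
qed

lemma smooth_continuous: "smooth g \<Longrightarrow> continuous_on S g"
  by (meson continuous_at_imp_continuous_on differentiable_imp_continuous_within smooth_dble)

subsection \<open>A smooth cutoff\<close>

text \<open>The power in the denominator makes the family closed under differentiation up to linear
  combinations. The constant \<open>c\<close> has a second use: as it tends to 0, the functions with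
  \<open>k = 0\<close> tend to the indicator of the positive half line.\<close>

definition cutoff :: "real \<Rightarrow> nat \<Rightarrow> real \<Rightarrow> real" where
  "cutoff c k u = (if u > 0 then exp (- c / u) / u ^ k else 0)"

text \<open>From the right, the substitution \<open>y = c / u\<close> reduces the claim to
  \<open>y ^ k / exp y\<close> tending to 0 at infinity, up to the factor
  \<open>c ^ k\<close>.\<close>

lemma cutoff_tendsto_0:
  assumes "c > 0" shows "(cutoff c k \<longlongrightarrow> 0) (at 0)"
proof -
  have 1: "((\<lambda>x::real. x ^ k / exp x) \<longlongrightarrow> 0) at_top" by (rule tendsto_power_div_exp_0)
  have 2: "filterlim (\<lambda>u::real. c / u) at_top (at_right 0)"
    using filterlim_tendsto_pos_mult_at_top[OF tendsto_const[of c] assms filterlim_inverse_at_top_right]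
    by (simp add: divide_inverse)
  have "((\<lambda>u. (c/u) ^ k / exp (c/u) / c ^ k) \<longlongrightarrow> 0 / c^k) (at_right 0)"
    by (intro tendsto_divide[OF filterlim_compose[OF 1 2]] tendsto_const) (use assms in auto)
  moreover have "\<forall>\<^sub>F u in at_right (0::real). (c/u) ^ k / exp (c/u) / c ^ k = cutoff c k u"
    by (auto simp: eventually_at_filter cutoff_def exp_minus field_simps power_divide assms less_imp_neq)
      (use assms in simp)
  ultimately have R: "(cutoff c k \<longlongrightarrow> 0) (at_right 0)"
    using tendsto_cong by fastforce
  have "\<forall>\<^sub>F u in at_left (0::real). 0 = cutoff c k u"
    by (auto simp: eventually_at_filter cutoff_def)
  then have L: "(cutoff c k \<longlongrightarrow> 0) (at_left 0)"
    using tendsto_cong tendsto_const by fastforce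
  from L R show ?thesis by (simp add: filterlim_split_at)
qed

text \<open>The delicate point is \<open>u = 0\<close>: there the difference quotient of
  \<open>cutoff c k\<close> is exactly \<open>cutoff c (k + 1)\<close>, which tends to 0.\<close>

lemma cutoff_deriv:
  assumes "c > 0"
  shows "(cutoff c k has_field_derivative c * cutoff c (k + 2) u - k * cutoff c (k + 1) u) (at u)"
proof -
  consider "u > 0" | "u < 0" | "u = 0" by linarith
  then show ?thesis
  proof cases
    case 1
    have "((\<lambda>u. exp (- c / u) / u ^ k) has_field_derivative
        c * cutoff c (k + 2) u - k * cutoff c (k + 1) u) (at u)"
      using 1 by (auto intro!: derivative_eq_intros simp: cutoff_def field_simps power2_eq_square)
       (cases k; simp add: field_simps)
    then show ?thesis
      by (rule has_field_derivative_transform_within_open[where S="{0<..}"])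
        (use 1 in \<open>auto simp: cutoff_def\<close>)
  next
    case 2
    have "((\<lambda>u. 0) has_field_derivative c * cutoff c (k + 2) u - k * cutoff c (k + 1) u) (at u)"
      using 2 by (auto simp: cutoff_def)
    then show ?thesis
      by (rule has_field_derivative_transform_within_open[where S="{..<0}"])
        (use 2 in \<open>auto simp: cutoff_def\<close>)
  next
    case 3
    have "\<And>h. (cutoff c k (0 + h) - cutoff c k 0) / h = cutoff c (k + 1) h"
      by (auto simp: cutoff_def field_simps)
    then show ?thesis
      using cutoff_tendsto_0[OF assms, of "k+1"] 3
      by (simp only: DERIV_def, simp add: cutoff_def[of _ _ 0])
  qed
qed

text \<open>By the chain rule a derivative is a combination of \<open>cutoff c (k + 1)\<close> and
  \<open>cutoff c (k + 2)\<close> times a derivative of \<open>N\<close>. The induction on the order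
  therefore treats all \<open>k\<close> at once.\<close>

lemma cdiff_cutoff:
  assumes "c > 0" "smooth N" shows "cdiff l (\<lambda>x. cutoff c k (N x))"
proof -
  have hd: "((\<lambda>x. cutoff c k (N x)) has_derivative
     (\<lambda>d. (c * cutoff c (k + 2) (N x) - k * cutoff c (k + 1) (N x)) * dir_deriv d N x)) (at x)" for x k
    using has_derivative_compose[OF dble_has_derivative[OF smooth_dble[OF assms(2)]]
        cutoff_deriv[OF assms(1), unfolded has_field_derivative_def]]
    by (simp add: mult.commute)
  have dd: "dir_deriv d (\<lambda>x. cutoff c k (N x)) = (\<lambda>x. (c * cutoff c (k + 2) (N x) - k * cutoff c (k + 1) (N x)) * dir_deriv d N x)" for k d
    by (rule ext, rule dir_derivI[OF hd])
  have db: "dble (\<lambda>x. cutoff c k (N x))" for k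
    using hd differentiableI by blast
  show ?thesis
  proof (induction l arbitrary: k)
    case 0 then show ?case using db by simp
  next
    case (Suc l)
    have "cdiff l (\<lambda>x. (c * cutoff c (k + 2) (N x) + (- real k) * cutoff c (k + 1) (N x)) * dir_deriv d N x)" for d
      by (intro cdiff_mult cdiff_add cdiff_const Suc)
        (use smooth_dir_deriv[OF assms(2)] smooth_iff in blast)
    then show ?case using db dd by simp
  qed
qed

lemma smooth_cutoff [intro!]: "c > 0 \<Longrightarrow> smooth N \<Longrightarrow> smooth (\<lambda>x. cutoff c k (N x))"
  using cdiff_cutoff smooth_iff by blast

subsection \<open>Test functions\<close>

text \<open>The closure of the set where \<phi> is non-zero is awkward to compute; any compact set
  outside of which \<phi> vanishes can take its place.\<close>

lemma test_functions_iff: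
  "\<phi> \<in> test_functions U \<longleftrightarrow> smooth \<phi> \<and> (\<exists>C. compact C \<and> C \<subseteq> U \<and> (\<forall>x. x \<notin> C \<longrightarrow> \<phi> x = 0))"
proof
  assume "\<phi> \<in> test_functions U"
  then show "smooth \<phi> \<and> (\<exists>C. compact C \<and> C \<subseteq> U \<and> (\<forall>x. x \<notin> C \<longrightarrow> \<phi> x = 0))"
    unfolding test_functions_def using closure_subset[of "{x. \<phi> x \<noteq> 0}"] by blast
next
  assume R: "smooth \<phi> \<and> (\<exists>C. compact C \<and> C \<subseteq> U \<and> (\<forall>x. x \<notin> C \<longrightarrow> \<phi> x = 0))"
  then obtain C where C: "compact C" "C \<subseteq> U" "\<And>x. x \<notin> C \<Longrightarrow> \<phi> x = 0" by blast
  then have "closure {x. \<phi> x \<noteq> 0} \<subseteq> C" by (intro closure_minimal compact_imp_closed) auto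
  moreover from this have "compact (closure {x. \<phi> x \<noteq> 0})"
    using C(1) compact_closure bounded_subset compact_imp_bounded closure_subset by meson
  ultimately show "\<phi> \<in> test_functions U" unfolding test_functions_def using R C by blast
qed

lemma test_functions_mono: "\<phi> \<in> test_functions U \<Longrightarrow> U \<subseteq> V \<Longrightarrow> \<phi> \<in> test_functions V"
  unfolding test_functions_def by auto

lemma test_functions_smooth: "\<phi> \<in> test_functions U \<Longrightarrow> smooth \<phi>"
  unfolding test_functions_def by auto

lemma test_functions_outside: "\<phi> \<in> test_functions U \<Longrightarrow> x \<notin> U \<Longrightarrow> \<phi> x = 0"
  unfolding test_functions_iff by blast

lemma dir_deriv_outside:
  assumes "closed C" "\<And>x. x \<notin> C \<Longrightarrow> \<phi> x = 0" "x \<notin> C"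
  shows "dir_deriv d \<phi> x = 0"
proof -
  have "(\<phi> has_derivative (\<lambda>_. 0)) (at x)"
    by (rule has_derivative_transform_within_open[of "\<lambda>_. 0" _ _ _ "- C"]) (use assms in auto)
  then show ?thesis by (rule dir_derivI)
qed

lemma partials_outside:
  assumes "closed C" "\<And>x. x \<notin> C \<Longrightarrow> \<phi> x = 0" shows "x \<notin> C \<Longrightarrow> partials \<beta> \<phi> x = 0"
proof (induction \<beta> arbitrary: x)
  case Nil then show ?case using assms by simp
next
  case (Cons i \<beta>)
  show ?case unfolding partials_Cons by (rule dir_deriv_outside[OF assms(1) Cons.IH Cons.prems])
qed

lemma test_functions_dir_deriv: "\<phi> \<in> test_functions U \<Longrightarrow> dir_deriv d \<phi> \<in> test_functions U"
  unfolding test_functions_iff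
  by (metis smooth_dir_deriv dir_deriv_outside compact_imp_closed)

lemma test_functions_partials: "\<phi> \<in> test_functions U \<Longrightarrow> partials \<alpha> \<phi> \<in> test_functions U"
  by (induction \<alpha>) (auto intro: test_functions_dir_deriv)

lemma test_functions_mult: "smooth p \<Longrightarrow> \<phi> \<in> test_functions U \<Longrightarrow> (\<lambda>x. p x * \<phi> x) \<in> test_functions U"
  unfolding test_functions_iff by (metis smooth_mult mult_zero_right)

lemma test_functions_bounded:
  assumes "\<phi> \<in> test_functions U" obtains M where "M > 0" "\<And>x. \<bar>\<phi> x\<bar> \<le> M"
proof -
  obtain C where C: "compact C" "\<And>x. x \<notin> C \<Longrightarrow> \<phi> x = 0" using assms unfolding test_functions_iff by blast
  have "bounded (\<phi> ` C)"
    using smooth_continuous[OF test_functions_smooth[OF assms]] C(1)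
    by (intro compact_imp_bounded compact_continuous_image)
  then obtain M where M: "M > 0" "\<And>x. x \<in> C \<Longrightarrow> \<bar>\<phi> x\<bar> \<le> M"
    unfolding bounded_pos by auto
  have "\<bar>\<phi> x\<bar> \<le> M" for x using M C(2)[of x] by (cases "x \<in> C") auto
  then show ?thesis using M(1) that by blast
qed

lemma smooth_borel [measurable_dest]: "smooth g \<Longrightarrow> g \<in> borel_measurable borel"
  by (rule borel_measurable_continuous_onI) (rule smooth_continuous)

lemma test_functions_integrable:
  assumes "\<phi> \<in> test_functions U" shows "integrable lborel \<phi>"
proof -
  obtain C where C: "compact C" "\<And>x. x \<notin> C \<Longrightarrow> \<phi> x = 0" using assms unfolding test_functions_iff by blast
  have "integrable lborel (\<lambda>x. indicator C x *\<^sub>R \<phi> x)"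
    using C(1) smooth_continuous[OF test_functions_smooth[OF assms]] by (rule borel_integrable_compact)
  also have "(\<lambda>x. indicator C x *\<^sub>R \<phi> x) = \<phi>" using C(2) by (intro ext) (auto simp: indicator_def)
  finally show ?thesis .
qed

subsection \<open>Rotated coordinates\<close>

text \<open>Lebesgue measure is determined by its values on boxes. The preimage of a box under
  \<open>Q\<close> is its image under the inverse, which is again orthogonal and preserves measure.
  The detour through \<open>lebesgue\<close> arises because measures of images are compared in the
  completion.\<close>

lemma distr_lborel_orthogonal:
  fixes Q :: "plane \<Rightarrow> plane"
  assumes Q: "orthogonal_transformation Q" shows "distr lborel borel Q = lborel"
proof (rule lborel_eqI[symmetric])
  fix l u :: plane assume lu: "\<And>b. b \<in> Basis \<Longrightarrow> l \<bullet> b \<le> u \<bullet> b"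
  have m: "Q \<in> borel_measurable borel"
    using orthogonal_transformation_linear[OF Q] by (intro borel_measurable_continuous_onI linear_continuous_on linear_conv_bounded_linear[THEN iffD1])
  have "Q -` box l u = inv Q ` box l u"
    using orthogonal_transformation_bij[OF Q] by (simp add: bij_vimage_eq_inv_image)
  moreover have "inv Q ` box l u \<in> lmeasurable" "measure lebesgue (inv Q ` box l u) = measure lebesgue (box l u)"
    by (rule measurable_orthogonal_image[OF orthogonal_transformation_inv[OF Q] lmeasurable_box]
        measure_orthogonal_image[OF orthogonal_transformation_inv[OF Q] lmeasurable_box])+
  ultimately have e: "emeasure lebesgue (Q -` box l u) = emeasure lebesgue (box l u)"
    using emeasure_eq_measure2[of "inv Q ` box l u" lebesgue] emeasure_eq_measure2[OF lmeasurable_box, of l u]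
    by (simp del: emeasure_completion)
  have b: "Q -` box l u \<in> sets borel" using measurable_sets[OF m, of "box l u"] by simp
  have "emeasure (distr lborel borel Q) (box l u) = emeasure lborel (Q -` box l u)"
    using m by (subst emeasure_distr) auto
  also have "\<dots> = emeasure lborel (box l u)" using e b by (simp add: emeasure_completion)
  finally show "emeasure (distr lborel borel Q) (box l u) = (\<Prod>b\<in>Basis. (u - l) \<bullet> b)"
    using lu by (simp add: emeasure_lborel_box)
qed simp

definition perp :: "plane \<Rightarrow> plane" where "perp n = vector [- (n $ 2), n $ 1]"

text \<open>For a unit vector \<open>n\<close> these are coordinates adapted to the line through
  \<open>m\<close> with normal \<open>n\<close>: \<open>s\<close> is the signed distance from the
  line and \<open>t\<close> the arc length along it, measured from \<open>m\<close>.\<close>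

definition frame :: "plane \<Rightarrow> plane \<Rightarrow> real \<times> real \<Rightarrow> plane" where
  "frame m n p = m + (fst p *\<^sub>R n + snd p *\<^sub>R perp n)"

lemma perp_nth [simp]: "perp n $ 1 = - (n $ 2)" "perp n $ 2 = n $ 1"
  by (simp_all add: perp_def)

lemma norm_perp [simp]: "norm (perp n) = norm n"
  by (simp add: norm_eq_sqrt_inner inner_vec_def sum_2)

lemma inner_perp [simp]: "n \<bullet> perp n = 0" "perp n \<bullet> n = 0"
  by (simp_all add: inner_vec_def sum_2)

lemma norm_1_nth: "norm (n::plane) = 1 \<Longrightarrow> n $ 1 * n $ 1 + n $ 2 * n $ 2 = 1"
  by (simp add: norm_eq_1 inner_vec_def sum_2)

lemma plane_decomp:
  assumes "norm n = 1" shows "(d::plane) = (n \<bullet> d) *\<^sub>R n + (perp n \<bullet> d) *\<^sub>R perp n"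
proof -
  have "d$1 = (n$1*d$1+n$2*d$2)*n$1 + (-(n$2)*d$1+n$1*d$2)*(-(n$2))"
    "d$2 = (n$1*d$1+n$2*d$2)*n$2 + (-(n$2)*d$1+n$1*d$2)*(n$1)"
    using norm_1_nth[OF assms] by algebra+
  then show ?thesis by (simp add: vec_eq_iff forall_2 inner_vec_def sum_2)
qed

lemma Basis_plane: "(Basis :: plane set) = {axis 1 1, axis 2 1}"
  by (simp add: Basis_vec_def UNIV_2 insert_commute)

text \<open>The map is a translation after an orthogonal map \<open>Q\<close> after the
  identification \<open>E\<close> of pairs with vectors, and each of the three preserves Lebesgue
  measure.\<close>

lemma distr_frame:
  assumes "norm n = 1" shows "distr lborel borel (frame m n) = lborel"
proof -
  define E :: "real \<times> real \<Rightarrow> plane" where "E p = fst p *\<^sub>R axis 1 1 + snd p *\<^sub>R axis 2 1" for p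
  define Q :: "plane \<Rightarrow> plane" where "Q x = x $ 1 *\<^sub>R n + x $ 2 *\<^sub>R perp n" for x
  have E1: "E p $ 1 = fst p" "E p $ 2 = snd p" for p by (simp_all add: E_def axis_def)
  have Ec: "continuous_on UNIV E" unfolding E_def by (intro continuous_intros)
  then have Em [measurable]: "E \<in> borel_measurable borel" by (rule borel_measurable_continuous_onI)
  have "distr lborel borel E = lborel"
  proof (rule lborel_eqI[symmetric])
    fix l u :: plane assume lu: "\<And>b. b \<in> Basis \<Longrightarrow> l \<bullet> b \<le> u \<bullet> b"
    have lu': "l $ i \<le> u $ i" for i using lu[of "axis i 1"] by (simp add: inner_axis axis_in_Basis_iff)
    have "E -` box l u = box (l $ 1, l $ 2) (u $ 1, u $ 2)"
      by (auto simp: mem_box_cart forall_2 E1 mem_box Basis_prod_def)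
    then have "emeasure (distr lborel borel E) (box l u) = emeasure lborel (box (l $ 1, l $ 2) (u $ 1, u $ 2))"
      using Em by (subst emeasure_distr) auto
    also have "\<dots> = ennreal ((u$1 - l$1) * (u$2 - l$2))"
      using lu'[of 1] lu'[of 2] by (subst emeasure_lborel_box)
       (auto simp: Basis_prod_def prod.union_disjoint)
    also have "(u$1 - l$1) * (u$2 - l$2) = (\<Prod>b\<in>Basis. (u - l) \<bullet> b)"
      by (simp add: Basis_plane inner_axis axis_eq_axis)
    finally show "emeasure (distr lborel borel E) (box l u) = (\<Prod>b\<in>Basis. (u - l) \<bullet> b)" .
  qed simp
  moreover have oQ: "orthogonal_transformation Q"
    unfolding orthogonal_transformation
  proof
    show "linear Q" by (auto simp: Q_def linear_iff algebra_simps)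
    have "norm (Q x) ^ 2 = norm x ^ 2" for x
    proof -
      have "norm (Q x) ^ 2 = (x$1 * n$1 - x$2 * n$2)^2 + (x$1 * n$2 + x$2 * n$1)^2"
        unfolding power2_norm_eq_inner Q_def by (simp add: inner_vec_def sum_2 power2_eq_square)
      also have "\<dots> = (x$1)^2 + (x$2)^2" using norm_1_nth[OF assms] by algebra
      also have "\<dots> = norm x ^ 2" unfolding power2_norm_eq_inner by (simp add: inner_vec_def sum_2 power2_eq_square)
      finally show ?thesis .
    qed
    then show "\<forall>v. norm (Q v) = norm v" by (metis norm_ge_zero power2_eq_iff_nonneg)
  qed
  moreover have Qm [measurable]: "Q \<in> borel_measurable borel"
    using orthogonal_transformation_linear[OF oQ]
    by (intro borel_measurable_continuous_onI linear_continuous_on linear_conv_bounded_linear[THEN iffD1])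
  moreover have "frame m n = (+) m \<circ> (Q \<circ> E)"
    by (auto simp: frame_def Q_def E1)
  moreover have "distr lborel borel (Q \<circ> E) = distr (distr lborel borel E) borel Q"
    by (subst distr_distr) auto
  moreover have "distr lborel borel ((+) m \<circ> (Q \<circ> E)) = distr (distr lborel borel (Q \<circ> E)) borel ((+) m)"
    by (subst distr_distr) auto
  ultimately show ?thesis by (simp add: distr_lborel_orthogonal lborel_distr_plus)
qed

subsection \<open>The divergence theorem on a half plane\<close>

lemma integral_halfline_deriv:
  fixes F F' :: "real \<Rightarrow> real"
  assumes d: "\<And>x. (F has_field_derivative F' x) (at x)" and c: "\<And>x. isCont F' x"
    and L: "\<And>x. x \<le> - L \<Longrightarrow> F x = 0" "\<And>x. x \<le> - L \<Longrightarrow> F' x = 0" "L > 0"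
  shows "(\<integral>x. F' x * indicator {..<0} x \<partial>lborel) = F 0"
proof -
  have "(\<integral>x. F' x * indicator {..<0} x \<partial>lborel) = (\<integral>x. F' x * indicator {-L..0} x \<partial>lborel)"
  proof (rule integral_cong_AE)
    have "F' \<in> borel_measurable borel"
      using c by (intro borel_measurable_continuous_onI continuous_at_imp_continuous_on) auto
    then show "(\<lambda>x. F' x * indicator {..<0} x) \<in> borel_measurable lborel"
      "(\<lambda>x. F' x * indicator {- L..0} x) \<in> borel_measurable lborel" by measurable
    have "AE x in lborel. x \<noteq> (0::real)" by (rule AE_lborel_singleton)
    then show "AE x in lborel. F' x * indicator {..<0} x = F' x * indicator {- L..0} x"
      by eventually_elim (auto simp: indicator_def L(2))
  qed
  also have "\<dots> = F 0 - F (- L)" using L(3) d c by (intro integral_FTC_Icc_real) auto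
  finally show ?thesis using L by simp
qed

lemma integral_line_deriv:
  fixes F F' :: "real \<Rightarrow> real"
  assumes d: "\<And>x. (F has_field_derivative F' x) (at x)" and c: "\<And>x. isCont F' x"
    and L: "\<And>x. \<bar>x\<bar> \<ge> L \<Longrightarrow> F x = 0" "\<And>x. \<bar>x\<bar> \<ge> L \<Longrightarrow> F' x = 0" "L > 0"
  shows "(\<integral>x. F' x \<partial>lborel) = 0"
proof -
  have "(\<integral>x. F' x \<partial>lborel) = (\<integral>x. F' x * indicator {-L..L} x \<partial>lborel)"
  proof (rule Bochner_Integration.integral_cong[OF refl])
    fix x show "F' x = F' x * indicator {-L..L} x"
      by (cases "L \<le> \<bar>x\<bar>") (auto simp: indicator_def L(2))
  qed
  also have "\<dots> = F L - F (- L)" using L(3) d c by (intro integral_FTC_Icc_real) auto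
  finally show ?thesis using L by simp
qed

lemma frame_continuous [continuous_intros]:
  "continuous_on S f \<Longrightarrow> continuous_on S (\<lambda>x. frame m n (f x))"
  unfolding frame_def by (intro continuous_intros)

text \<open>Both orders of integration are kept: normal derivatives are integrated in
  \<open>s\<close> first, tangential ones in \<open>t\<close> first.\<close>

lemma integral_frame:
  fixes g :: "plane \<Rightarrow> real"
  assumes n: "norm n = 1" and g: "integrable lborel g"
  shows "integral\<^sup>L lborel g = (\<integral>s. (\<integral>t. g (frame m n (s, t)) \<partial>lborel) \<partial>lborel)"
    and "integral\<^sup>L lborel g = (\<integral>t. (\<integral>s. g (frame m n (s, t)) \<partial>lborel) \<partial>lborel)"
proof -
  have fm: "frame m n \<in> borel_measurable borel"
    by (rule borel_measurable_continuous_onI) (rule frame_continuous[OF continuous_on_id])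
  have gm: "g \<in> borel_measurable borel" using g by simp
  have i: "integrable lborel (\<lambda>p. g (frame m n p))"
    using g gm fm distr_frame[OF n, of m] by (subst integrable_distr_eq[symmetric, where N=borel]) auto
  have e: "integral\<^sup>L lborel g = (\<integral>p. g (frame m n p) \<partial>lborel)"
    using gm fm by (subst distr_frame[OF n, of m, symmetric], subst integral_distr) auto
  have i2: "integrable (lborel \<Otimes>\<^sub>M lborel) (\<lambda>(s, t). g (frame m n (s, t)))"
    using i by (simp add: lborel_prod case_prod_beta')
  show "integral\<^sup>L lborel g = (\<integral>s. (\<integral>t. g (frame m n (s, t)) \<partial>lborel) \<partial>lborel)"
    using lborel_pair.integral_fst[OF i2] e by (simp add: lborel_prod case_prod_beta')
  show "integral\<^sup>L lborel g = (\<integral>t. (\<integral>s. g (frame m n (s, t)) \<partial>lborel) \<partial>lborel)"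
    using lborel_pair.integral_snd[OF i2] e by (simp add: lborel_prod case_prod_beta')
qed

lemma frame_has_derivative:
  assumes g: "smooth g"
  shows "((\<lambda>s. g (frame m n (s, t))) has_field_derivative dir_deriv n g (frame m n (s, t))) (at s)"
    and "((\<lambda>t. g (frame m n (s, t))) has_field_derivative dir_deriv (perp n) g (frame m n (s, t))) (at t)"
proof -
  note D = dble_has_derivative[OF smooth_dble[OF g]]
  have l: "dir_deriv (c *\<^sub>R d) g x = dir_deriv d g x * c" for c d x
    using linear_cmul[OF has_derivative_linear[OF D]] by (simp add: mult.commute)
  have 1: "((\<lambda>s. frame m n (s, t)) has_derivative (\<lambda>h. h *\<^sub>R n)) (at s)"
    unfolding frame_def by (auto intro!: derivative_eq_intros)
  have 2: "((\<lambda>t. frame m n (s, t)) has_derivative (\<lambda>h. h *\<^sub>R perp n)) (at t)"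
    unfolding frame_def by (auto intro!: derivative_eq_intros)
  show "((\<lambda>s. g (frame m n (s, t))) has_field_derivative dir_deriv n g (frame m n (s, t))) (at s)"
    unfolding has_field_derivative_def l[symmetric] by (rule has_derivative_compose[OF 1 D])
  show "((\<lambda>t. g (frame m n (s, t))) has_field_derivative dir_deriv (perp n) g (frame m n (s, t))) (at t)"
    unfolding has_field_derivative_def l[symmetric] by (rule has_derivative_compose[OF 2 D])
qed

lemma frame_isCont:
  assumes "smooth g"
  shows "isCont (\<lambda>s. g (frame m n (s, t))) s" "isCont (\<lambda>t. g (frame m n (s, t))) t"
  using frame_has_derivative[OF assms] DERIV_isCont by blast+

lemma frame_coord:
  assumes "norm n = 1" shows "n \<bullet> (frame m n (s, t) - m) = s" "perp n \<bullet> (frame m n (s, t) - m) = t"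
  using assms by (simp_all add: frame_def inner_add_right norm_eq_1) (simp add: norm_eq_1[symmetric])

lemma dir_deriv_decomp:
  assumes n: "norm n = 1" and g: "dble g"
  shows "dir_deriv d g x = (n \<bullet> d) * dir_deriv n g x + (perp n \<bullet> d) * dir_deriv (perp n) g x"
proof -
  have l: "linear (\<lambda>d. dir_deriv d g x)"
    using dble_has_derivative[OF g] has_derivative_linear by blast
  show ?thesis
    by (subst plane_decomp[OF n, of d]) (simp add: linear_add[OF l] linear_cmul[OF l])
qed

lemma frame_bound:
  assumes "\<phi> \<in> test_functions UNIV" "norm n = 1"
  shows "\<exists>L>0. \<forall>s t. L \<le> \<bar>s\<bar> \<or> L \<le> \<bar>t\<bar> \<longrightarrow> \<phi> (frame m n (s, t)) = 0"
proof -
  obtain C where C: "compact C" "\<And>x. x \<notin> C \<Longrightarrow> \<phi> x = 0" using assms unfolding test_functions_iff by blast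
  obtain B where B: "B > 0" "\<And>x. x \<in> C \<Longrightarrow> norm x \<le> B" using compact_imp_bounded[OF C(1)] bounded_pos by blast
  have *: "\<phi> (frame m n (s, t)) = 0" if "B + norm m + 1 \<le> \<bar>s\<bar> \<or> B + norm m + 1 \<le> \<bar>t\<bar>" for s t
  proof (rule C(2), rule notI)
    assume "frame m n (s, t) \<in> C"
    then have "norm (frame m n (s, t) - m) \<le> B + norm m"
      using B(2) norm_triangle_ineq4[of "frame m n (s, t)" m] by fastforce
    then show False
      using that Cauchy_Schwarz_ineq2[of n "frame m n (s, t) - m"]
        Cauchy_Schwarz_ineq2[of "perp n" "frame m n (s, t) - m"] assms(2)
      by (auto simp: frame_coord)
  qed
  have "B + norm m + 1 > 0" using B(1) norm_ge_zero[of m] by linarith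
  then show ?thesis using * by blast
qed

abbreviation (input) half :: "plane \<Rightarrow> plane \<Rightarrow> plane set" where
  "half m n \<equiv> {x. n \<bullet> (x - m) < 0}"

text \<open>Splitting \<open>d\<close> along \<open>n\<close> and \<open>perp n\<close> leaves
  one-dimensional integrals. On each normal line the fundamental theorem of calculus yields the
  value at \<open>s = 0\<close>; on each tangential line it yields 0 by compact support.\<close>

theorem halfplane_divergence:
  assumes \<phi>: "\<phi> \<in> test_functions UNIV" and n: "norm n = 1"
  shows "(\<integral>x. indicator (half m n) x * dir_deriv d \<phi> x \<partial>lborel)
    = (n \<bullet> d) * (\<integral>t. \<phi> (m + t *\<^sub>R perp n) \<partial>lborel)"
proof -
  let ?H = "half m n"
  have Hm: "?H \<in> sets borel" by (intro borel_open open_Collect_less continuous_intros)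
  have int: "integrable lborel (\<lambda>x. indicator ?H x * dir_deriv d \<phi> x)" for d
    using integrable_mult_indicator[of ?H lborel "dir_deriv d \<phi>"] Hm
      test_functions_integrable[OF test_functions_dir_deriv[OF \<phi>]] by simp
  have sm: "smooth \<phi>" using \<phi> test_functions_smooth by blast
  have ind: "indicator ?H (frame m n (s, t)) = (indicator {..<0} s :: real)" for s t
    by (simp add: indicator_def frame_coord[OF n])
  obtain L where L: "L > 0" "\<forall>s t. L \<le> \<bar>s\<bar> \<or> L \<le> \<bar>t\<bar> \<longrightarrow> \<phi> (frame m n (s, t)) = 0"
    using frame_bound[OF \<phi> n, of m] by blast
  obtain L1 where L1: "L1 > 0" "\<forall>s t. L1 \<le> \<bar>s\<bar> \<or> L1 \<le> \<bar>t\<bar> \<longrightarrow> dir_deriv n \<phi> (frame m n (s, t)) = 0"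
    using frame_bound[OF test_functions_dir_deriv[OF \<phi>] n, of n m] by blast
  obtain L2 where L2: "L2 > 0" "\<forall>s t. L2 \<le> \<bar>s\<bar> \<or> L2 \<le> \<bar>t\<bar> \<longrightarrow> \<phi> (frame m n (s, t)) = 0"
    using frame_bound[OF \<phi> n, of m] by blast
  obtain L3 where L3: "L3 > 0" "\<forall>s t. L3 \<le> \<bar>s\<bar> \<or> L3 \<le> \<bar>t\<bar> \<longrightarrow> dir_deriv (perp n) \<phi> (frame m n (s, t)) = 0"
    using frame_bound[OF test_functions_dir_deriv[OF \<phi>] n, of "perp n" m] by blast
  have N: "(\<integral>x. indicator ?H x * dir_deriv n \<phi> x \<partial>lborel) = (\<integral>t. \<phi> (m + t *\<^sub>R perp n) \<partial>lborel)"
  proof -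
    have "(\<integral>s. indicator ?H (frame m n (s, t)) * dir_deriv n \<phi> (frame m n (s, t)) \<partial>lborel) = \<phi> (m + t *\<^sub>R perp n)" for t
    proof -
      have "(\<integral>s. dir_deriv n \<phi> (frame m n (s, t)) * indicator {..<0} s \<partial>lborel) = \<phi> (frame m n (0, t))"
        by (rule integral_halfline_deriv[of _ _ "max L L1"])
          (use frame_has_derivative[OF sm] frame_isCont[OF smooth_dir_deriv[OF sm]] L L1 in \<open>auto\<close>)
      then show ?thesis by (simp add: ind mult.commute) (simp add: frame_def)
    qed
    then show ?thesis using integral_frame(2)[OF n int[of n], of m] by simp
  qed
  have T: "(\<integral>x. indicator ?H x * dir_deriv (perp n) \<phi> x \<partial>lborel) = 0"
  proof -
    have "(\<integral>t. indicator ?H (frame m n (s, t)) * dir_deriv (perp n) \<phi> (frame m n (s, t)) \<partial>lborel) = 0" for s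
    proof -
      have "(\<integral>t. dir_deriv (perp n) \<phi> (frame m n (s, t)) \<partial>lborel) = 0"
        by (rule integral_line_deriv[of "\<lambda>t. \<phi> (frame m n (s, t))" _ "max L2 L3"])
          (use frame_has_derivative[OF sm] frame_isCont[OF smooth_dir_deriv[OF sm]] L2 L3 in \<open>auto\<close>)
      then show ?thesis by (simp add: ind)
    qed
    then show ?thesis using integral_frame(1)[OF n int[of "perp n"], of m] by simp
  qed
  have "(\<lambda>x. indicator ?H x * dir_deriv d \<phi> x) = (\<lambda>x. (n \<bullet> d) * (indicator ?H x * dir_deriv n \<phi> x)
      + (perp n \<bullet> d) * (indicator ?H x * dir_deriv (perp n) \<phi> x))"
    using dir_deriv_decomp[OF n smooth_dble[OF sm], of d] by (intro ext) (simp add: algebra_simps)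
  then show ?thesis using int N T by simp
qed

lemma integral_line_tangential:
  assumes \<phi>: "\<phi> \<in> test_functions UNIV" and n: "norm n = 1"
  shows "(\<integral>t. dir_deriv (perp n) \<phi> (m + t *\<^sub>R perp n) \<partial>lborel) = 0"
proof -
  have sm: "smooth \<phi>" using \<phi> test_functions_smooth by blast
  obtain L2 where L2: "L2 > 0" "\<forall>s t. L2 \<le> \<bar>s\<bar> \<or> L2 \<le> \<bar>t\<bar> \<longrightarrow> \<phi> (frame m n (s, t)) = 0"
    using frame_bound[OF \<phi> n, of m] by blast
  obtain L3 where L3: "L3 > 0" "\<forall>s t. L3 \<le> \<bar>s\<bar> \<or> L3 \<le> \<bar>t\<bar> \<longrightarrow> dir_deriv (perp n) \<phi> (frame m n (s, t)) = 0"
    using frame_bound[OF test_functions_dir_deriv[OF \<phi>] n, of "perp n" m] by blast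
  have "(\<integral>t. dir_deriv (perp n) \<phi> (frame m n (0, t)) \<partial>lborel) = 0"
    by (rule integral_line_deriv[of "\<lambda>t. \<phi> (frame m n (0, t))" _ "max L2 L3"])
      (use frame_has_derivative[OF sm] frame_isCont[OF smooth_dir_deriv[OF sm]] L2 L3 in \<open>auto\<close>)
  then show ?thesis by (simp add: frame_def)
qed

text \<open>A half plane whose boundary line lies beyond the support gives the integral over the
  whole plane and no boundary term.\<close>

lemma integral_dir_deriv_zero:
  assumes \<phi>: "\<phi> \<in> test_functions UNIV"
  shows "(\<integral>x. dir_deriv d \<phi> x \<partial>lborel) = 0"
proof -
  let ?n = "axis 1 1 :: plane"
  have n: "norm ?n = 1" by simp
  obtain L where L: "L > 0" "\<forall>s t. L \<le> \<bar>s\<bar> \<or> L \<le> \<bar>t\<bar> \<longrightarrow> \<phi> (frame 0 ?n (s, t)) = 0"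
    using frame_bound[OF \<phi> n, of 0] by blast
  obtain L1 where L1: "L1 > 0" "\<forall>s t. L1 \<le> \<bar>s\<bar> \<or> L1 \<le> \<bar>t\<bar> \<longrightarrow> dir_deriv d \<phi> (frame 0 ?n (s, t)) = 0"
    using frame_bound[OF test_functions_dir_deriv[OF \<phi>] n, of d 0] by blast
  define M where "M = max L L1"
  have M: "M > 0" "\<And>s t. \<bar>s\<bar> \<ge> M \<Longrightarrow> \<phi> (frame 0 ?n (s, t)) = 0"
    "\<And>s t. \<bar>s\<bar> \<ge> M \<Longrightarrow> dir_deriv d \<phi> (frame 0 ?n (s, t)) = 0"
    using L L1 by (auto simp: M_def)
  have eq: "x = frame 0 ?n (?n \<bullet> x, perp ?n \<bullet> x)" for x
    using plane_decomp[OF n, of x] by (simp add: frame_def)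
  have A: "indicator {x. ?n \<bullet> (x - M *\<^sub>R ?n) < 0} x * dir_deriv d \<phi> x = dir_deriv d \<phi> x" for x
    using M(3)[of "?n \<bullet> x" "perp ?n \<bullet> x"] eq[of x]
    by (auto simp: indicator_def inner_diff_right)
  have B: "\<phi> (M *\<^sub>R ?n + t *\<^sub>R perp ?n) = 0" for t
    using M(2)[of M t] M(1) by (simp add: frame_def)
  show ?thesis using halfplane_divergence[OF \<phi> n, of "M *\<^sub>R ?n" d] unfolding A B by simp
qed

subsection \<open>Integration by parts\<close>

lemma integral_by_parts:
  assumes P: "smooth P" and \<phi>: "\<phi> \<in> test_functions UNIV"
  shows "(\<integral>x. P x * dir_deriv d \<phi> x \<partial>lborel) = - (\<integral>x. dir_deriv d P x * \<phi> x \<partial>lborel)"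
proof -
  have "(\<integral>x. dir_deriv d (\<lambda>x. P x * \<phi> x) x \<partial>lborel) = 0"
    by (rule integral_dir_deriv_zero[OF test_functions_mult[OF P \<phi>]])
  also have "dir_deriv d (\<lambda>x. P x * \<phi> x) = (\<lambda>x. dir_deriv d P x * \<phi> x + P x * dir_deriv d \<phi> x)"
    by (rule dir_deriv_mult[OF smooth_dble[OF P] smooth_dble[OF test_functions_smooth[OF \<phi>]]])
  also have "(\<integral>x. dir_deriv d P x * \<phi> x + P x * dir_deriv d \<phi> x \<partial>lborel)
     = (\<integral>x. dir_deriv d P x * \<phi> x \<partial>lborel) + (\<integral>x. P x * dir_deriv d \<phi> x \<partial>lborel)"
    by (intro Bochner_Integration.integral_add test_functions_integrable[of _ UNIV] test_functions_mult
        smooth_dir_deriv P \<phi> test_functions_dir_deriv)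
  finally show ?thesis by simp
qed

lemma integral_partials:
  assumes "smooth P" and \<phi>: "\<phi> \<in> test_functions UNIV"
  shows "(\<integral>x. P x * partials \<alpha> \<phi> x \<partial>lborel) =
    (-1) ^ length \<alpha> * (\<integral>x. partials (rev \<alpha>) P x * \<phi> x \<partial>lborel)"
  using assms(1)
proof (induction \<alpha> arbitrary: P)
  case (Cons i \<alpha>)
  show ?case
    using Cons.IH[OF smooth_pd[OF Cons.prems]] integral_by_parts[OF Cons.prems test_functions_partials[OF \<phi>]]
    by (simp add: partials_snoc)
qed simp

subsection \<open>Square integrable functions\<close>

lemma open_lebesgue [simp]: "open U \<Longrightarrow> U \<in> sets lebesgue"
  by (simp add: borel_open)

lemma indicator_lebesgue: "open U \<Longrightarrow> (indicator U :: plane \<Rightarrow> real) \<in> borel_measurable lebesgue"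
  by (intro borel_measurable_indicator open_lebesgue)

lemma borel_lebesgue: "g \<in> borel_measurable borel \<Longrightarrow> g \<in> borel_measurable lebesgue"
  by (simp add: measurable_completion)

lemma integrable_indicator_open:
  assumes "open U" "bounded U" shows "integrable lebesgue (indicator U :: plane \<Rightarrow> real)"
proof -
  have fm: "U \<in> fmeasurable lebesgue" using assms lmeasurable_open by blast
  show ?thesis using fmeasurableD2[OF fm] fmeasurableD[OF fm] by (simp add: integrable_indicator_iff less_top)
qed

lemma L2_inner_eq:
  "U \<in> sets lebesgue \<Longrightarrow> L2_inner U f g = (\<integral>x. indicator U x * (f x * g x) \<partial>lebesgue)"
  unfolding L2_inner_def by (subst integral_restrict_space) auto

lemma L2_inner_test:
  assumes "open U" "\<phi> \<in> test_functions U"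
  shows "L2_inner U g \<phi> = (\<integral>x. g x * \<phi> x \<partial>lebesgue)"
  using assms test_functions_outside[OF assms(2)]
  by (subst L2_inner_eq) (auto simp: indicator_def intro!: Bochner_Integration.integral_cong)

lemma L2_inner_test_borel:
  assumes "open U" "\<phi> \<in> test_functions U" "g \<in> borel_measurable borel"
  shows "L2_inner U g \<phi> = (\<integral>x. g x * \<phi> x \<partial>lborel)"
  using assms smooth_borel[OF test_functions_smooth[OF assms(2)]]
  by (simp add: L2_inner_test integral_completion)

lemma L2_iff:
  assumes "open U"
  shows "g \<in> L2 U \<longleftrightarrow> (\<lambda>x. indicator U x * g x) \<in> borel_measurable lebesgue \<and>
    integrable lebesgue (\<lambda>x. indicator U x * (g x)\<^sup>2)"
  using assms by (simp add: L2_def borel_measurable_restrict_space_iff integrable_restrict_space)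

lemma L2_measurable: "g \<in> L2 U \<Longrightarrow> g \<in> borel_measurable (lebesgue_on U)"
  by (simp add: L2_def)

lemma L2_mult_integrable:
  assumes "f \<in> L2 U" "g \<in> L2 U" shows "integrable (lebesgue_on U) (\<lambda>x. f x * g x)"
proof (rule Bochner_Integration.integrable_bound)
  show "integrable (lebesgue_on U) (\<lambda>x. (f x)\<^sup>2 + (g x)\<^sup>2)" using assms by (simp add: L2_def)
  show "(\<lambda>x. f x * g x) \<in> borel_measurable (lebesgue_on U)"
    using assms by (intro borel_measurable_times L2_measurable)
  have "\<bar>a * b\<bar> \<le> \<bar>a\<^sup>2 + b\<^sup>2\<bar>" for a b :: real
  proof -
    have "2 * (\<bar>a\<bar> * \<bar>b\<bar>) \<le> a\<^sup>2 + b\<^sup>2" using zero_le_power2[of "\<bar>a\<bar> - \<bar>b\<bar>"] by (simp add: power2_diff)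
    moreover have "0 \<le> \<bar>a\<bar> * \<bar>b\<bar>" by simp
    ultimately have "\<bar>a\<bar> * \<bar>b\<bar> \<le> a\<^sup>2 + b\<^sup>2" by linarith
    then show ?thesis by (simp add: abs_mult)
  qed
  then show "AE x in lebesgue_on U. norm (f x * g x) \<le> norm ((f x)\<^sup>2 + (g x)\<^sup>2)" by simp
qed

lemma L2_add: assumes "f \<in> L2 U" "g \<in> L2 U" shows "(\<lambda>x. f x + g x) \<in> L2 U"
proof -
  have "integrable (lebesgue_on U) (\<lambda>x. (f x)\<^sup>2 + (g x)\<^sup>2 + 2 * (f x * g x))"
    using assms L2_mult_integrable[OF assms] by (simp add: L2_def)
  also have "(\<lambda>x. (f x)\<^sup>2 + (g x)\<^sup>2 + 2 * (f x * g x)) = (\<lambda>x. (f x + g x)\<^sup>2)"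
    by (simp add: fun_eq_iff power2_sum algebra_simps)
  finally show ?thesis using assms by (auto simp: L2_def intro!: borel_measurable_add)
qed

lemma L2_cmult: "f \<in> L2 U \<Longrightarrow> (\<lambda>x. c * f x) \<in> L2 U"
  by (auto simp: L2_def power_mult_distrib intro!: borel_measurable_times)

lemma L2_diff: "f \<in> L2 U \<Longrightarrow> g \<in> L2 U \<Longrightarrow> (\<lambda>x. f x - g x) \<in> L2 U"
  using L2_add[OF _ L2_cmult[of g U "-1"]] by simp

lemma L2_subset:
  assumes "g \<in> L2 U" "open U" "open V" "V \<subseteq> U" shows "g \<in> L2 V"
proof -
  have e: "indicator V x * (indicator U x * h x) = (indicator V x * h x :: real)" for x h
    using assms(4) by (auto simp: indicator_def)
  have "(\<lambda>x. indicator V x * (indicator U x * g x)) \<in> borel_measurable lebesgue"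
    using assms by (intro borel_measurable_times[OF indicator_lebesgue[OF assms(3)]]) (simp add: L2_iff)
  moreover have "integrable lebesgue (\<lambda>x. indicator V x *\<^sub>R (indicator U x * (g x)\<^sup>2))"
    using assms by (intro integrable_mult_indicator) (auto simp: L2_iff)
  ultimately show ?thesis using assms e[of _ g] e[of _ "\<lambda>x. (g x)\<^sup>2"] by (simp add: L2_iff)
qed

lemma L2_bounded:
  assumes U: "open U" "bounded U" and g: "g \<in> borel_measurable borel" "\<And>x. x \<in> U \<Longrightarrow> \<bar>g x\<bar> \<le> M"
  shows "g \<in> L2 U"
proof -
  have "integrable lebesgue (\<lambda>x. M\<^sup>2 * indicator U x)"
    by (intro integrable_mult_right integrable_indicator_open U)
  then have "integrable lebesgue (\<lambda>x. indicator U x * (g x)\<^sup>2)"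
  proof (rule Bochner_Integration.integrable_bound)
    show "(\<lambda>x. indicator U x * (g x)\<^sup>2) \<in> borel_measurable lebesgue"
      by (intro borel_measurable_times borel_measurable_power borel_lebesgue[OF g(1)] indicator_lebesgue[OF U(1)])
    have "(g x)\<^sup>2 \<le> M\<^sup>2" if "x \<in> U" for x using g(2)[OF that] by (simp add: abs_le_square_iff[symmetric])
    then show "AE x in lebesgue. norm (indicator U x * (g x)\<^sup>2) \<le> norm (M\<^sup>2 * indicator U x)"
      by (auto simp: indicator_def)
  qed
  then show ?thesis
    using borel_measurable_times[OF indicator_lebesgue[OF U(1)] borel_lebesgue[OF g(1)]] U(1) by (simp add: L2_iff)
qed

lemma L2_smooth: assumes "open U" "bounded U" "smooth g" shows "g \<in> L2 U"
proof -
  have "compact (closure U)" using assms(2) by simp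
  then have "bounded (g ` closure U)"
    using smooth_continuous[OF assms(3)] by (intro compact_imp_bounded compact_continuous_image)
  then obtain M where "\<And>x. x \<in> closure U \<Longrightarrow> \<bar>g x\<bar> \<le> M" unfolding bounded_iff by auto
  then show ?thesis
    using L2_bounded[OF assms(1,2) smooth_borel[OF assms(3)], of M] closure_subset[of U] by blast
qed

lemma L2_norm_nonneg [simp]: "0 \<le> L2_norm U g"
  by (simp add: L2_norm_def L2_inner_def)

lemma L2_norm_sq: "(L2_norm U g)\<^sup>2 = L2_inner U g g"
  by (simp add: L2_norm_def L2_inner_def)

lemma L2_inner_add_left:
  "f \<in> L2 U \<Longrightarrow> g \<in> L2 U \<Longrightarrow> h \<in> L2 U \<Longrightarrow> L2_inner U (\<lambda>x. f x + g x) h = L2_inner U f h + L2_inner U g h"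
  using L2_mult_integrable[of f U h] L2_mult_integrable[of g U h] by (simp add: L2_inner_def distrib_right)

lemma L2_inner_diff_left:
  "f \<in> L2 U \<Longrightarrow> g \<in> L2 U \<Longrightarrow> h \<in> L2 U \<Longrightarrow> L2_inner U (\<lambda>x. f x - g x) h = L2_inner U f h - L2_inner U g h"
  using L2_mult_integrable[of f U h] L2_mult_integrable[of g U h] by (simp add: L2_inner_def left_diff_distrib)

text \<open>The integral of the square of \<open>f + l * g\<close> is a quadratic in
  \<open>l\<close> that is never negative.\<close>

lemma L2_Cauchy_Schwarz:
  assumes "f \<in> L2 U" "g \<in> L2 U" shows "\<bar>L2_inner U f g\<bar> \<le> L2_norm U f * L2_norm U g"
proof -
  define A where "A = L2_inner U f f"
  define B where "B = L2_inner U f g"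
  define D where "D = L2_inner U g g"
  have AD: "A \<ge> 0" "D \<ge> 0" by (simp_all add: A_def D_def L2_inner_def)
  have q: "0 \<le> A + 2 * l * B + l\<^sup>2 * D" for l
  proof -
    have "0 \<le> (LINT x|lebesgue_on U. (f x + l * g x)\<^sup>2)" by simp
    also have "(\<lambda>x. (f x + l * g x)\<^sup>2) = (\<lambda>x. f x * f x + 2 * l * (f x * g x) + l\<^sup>2 * (g x * g x))"
      by (simp add: fun_eq_iff power2_eq_square algebra_simps)
    also have "(LINT x|lebesgue_on U. f x * f x + 2 * l * (f x * g x) + l\<^sup>2 * (g x * g x)) = A + 2 * l * B + l\<^sup>2 * D"
      using L2_mult_integrable[OF assms(1,1)] L2_mult_integrable[OF assms] L2_mult_integrable[OF assms(2,2)]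
      by (simp add: A_def B_def D_def L2_inner_def)
    finally show ?thesis .
  qed
  have "B\<^sup>2 \<le> A * D"
  proof (cases "D = 0")
    case True
    have "B = 0"
    proof (rule ccontr)
      assume "B \<noteq> 0"
      \<comment> \<open>For this \<open>l\<close> the affine function \<open>A + 2 * l * B\<close>
        equals -1.\<close>
      then show False using q[of "- (A + 1) / (2 * B)"] True by (simp add: field_simps)
    qed
    then show ?thesis using AD by simp
  next
    case False
    \<comment> \<open>The quadratic is evaluated at its minimum \<open>l = - B / D\<close>.\<close>
    then have "0 \<le> (A - B\<^sup>2 / D)" using q[of "- B / D"] by (simp add: power2_eq_square field_simps)
    then show ?thesis using False AD by (simp add: field_simps)
  qed
  then have "\<bar>B\<bar> \<le> sqrt (A * D)" using real_le_rsqrt[of "\<bar>B\<bar>"] by simp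
  then show ?thesis by (simp add: A_def B_def D_def L2_norm_def real_sqrt_mult)
qed

subsection \<open>The fundamental lemma of the calculus of variations\<close>

text \<open>The indicator of an open box is a pointwise limit of test functions that it dominates,
  so dominated convergence carries the hypothesis over to the box.\<close>

lemma integral_box_zero:
  assumes U: "open U" and g: "g \<in> L2 U" and z: "\<And>\<phi>. \<phi> \<in> test_functions U \<Longrightarrow> L2_inner U g \<phi> = 0"
    and ab: "cbox a b \<subseteq> U" "\<And>i. a $ i < b $ i"
  shows "L2_inner U g (indicator (box a b)) = 0"
proof -
  \<comment> \<open>Each quadratic is positive on the box and their joint positivity describes it;
    the constant \<open>1 / Suc k\<close> tends to 0, which drives the exponentials to 1
    there.\<close>
  define \<psi> where "\<psi> k x = cutoff (1 / real (Suc k)) 0 ((x$1 - a$1) * (b$1 - x$1))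
    * cutoff (1 / real (Suc k)) 0 ((x$2 - a$2) * (b$2 - x$2))" for k and x :: plane
  have c: "(x - l) * (u - x) > 0 \<longleftrightarrow> l < x \<and> x < u" if "l < u" for x l u :: real
    using that by (auto simp: zero_less_mult_iff)
  have cut: "cutoff d 0 u = (if u > 0 then exp (- d / u) else 0)" for d u by (simp add: cutoff_def)
  have outside: "\<psi> k x = 0" if "x \<notin> box a b" for k x
    using that c[OF ab(2)] by (auto simp: \<psi>_def cut mem_box_cart forall_2)
  have le1: "\<bar>\<psi> k x\<bar> \<le> indicator (box a b) x" for k x
  proof (cases "x \<in> box a b")
    case True
    have "0 \<le> cutoff (1 / real (Suc k)) 0 u" "cutoff (1 / real (Suc k)) 0 u \<le> 1" for u by (auto simp: cut)
    then show ?thesis using True by (auto simp: \<psi>_def intro!: mult_le_one)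
  qed (simp add: outside)
  have lim: "(\<lambda>k. \<psi> k x) \<longlonglongrightarrow> indicator (box a b) x" for x
  proof (cases "x \<in> box a b")
    case True
    have *: "(\<lambda>k. cutoff (1 / real (Suc k)) 0 u) \<longlonglongrightarrow> 1" if "u > 0" for u :: real
    proof -
      have "(\<lambda>k. 1 / real (Suc k)) \<longlonglongrightarrow> 0" by (rule lim_1_over_n[THEN LIMSEQ_Suc])
      then have "(\<lambda>k. exp (- (1 / real (Suc k)) / u)) \<longlonglongrightarrow> exp (- 0 / u)"
        using that by (intro tendsto_intros) auto
      then show ?thesis using that by (simp add: cut)
    qed
    have "(\<lambda>k. \<psi> k x) \<longlonglongrightarrow> 1 * 1"
      unfolding \<psi>_def using True c[OF ab(2)] by (intro tendsto_mult *) (auto simp: mem_box_cart)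
    then show ?thesis using True by simp
  qed (simp add: outside)
  have t: "\<psi> k \<in> test_functions U" for k
  proof -
    have "smooth (\<psi> k)" unfolding \<psi>_def by (intro smooth_mult smooth_cutoff smooth_diff smooth_nth smooth_const) auto
    then show ?thesis unfolding test_functions_iff using ab(1) outside box_subset_cbox[of a b] compact_cbox[of a b] by blast
  qed
  have bL: "indicator (box a b) \<in> L2 U"
  proof -
    have "(\<lambda>x. indicator U x * indicator (box a b) x) = (indicator (box a b) :: _ \<Rightarrow> real)"
      "(\<lambda>x. indicator U x * (indicator (box a b) x)\<^sup>2) = (indicator (box a b) :: _ \<Rightarrow> real)"
      using ab(1) box_subset_cbox[of a b] by (auto simp: fun_eq_iff indicator_def)
    then show ?thesis
      using integrable_indicator_open[OF open_box bounded_box, of a b] indicator_lebesgue[OF open_box, of a b] U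
      by (simp only: L2_iff)
  qed
  have "(\<lambda>k. L2_inner U g (\<psi> k)) \<longlonglongrightarrow> L2_inner U g (indicator (box a b))"
    unfolding L2_inner_def
  proof (rule integral_dominated_convergence[where w = "\<lambda>x. \<bar>g x * indicator (box a b) x\<bar>"])
    show "integrable (lebesgue_on U) (\<lambda>x. \<bar>g x * indicator (box a b) x\<bar>)"
      using L2_mult_integrable[OF g bL] by simp
    have "\<psi> k \<in> borel_measurable (lebesgue_on U)" for k
      using smooth_borel[OF test_functions_smooth[OF t]]
      by (intro measurable_restrict_space1) (auto simp: measurable_completion)
    then show "(\<lambda>x. g x * \<psi> k x) \<in> borel_measurable (lebesgue_on U)" for k
      using L2_measurable[OF g] by measurable
    show "(\<lambda>x. g x * indicator (box a b) x) \<in> borel_measurable (lebesgue_on U)"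
      using L2_mult_integrable[OF g bL] by simp
    show "AE x in lebesgue_on U. (\<lambda>k. g x * \<psi> k x) \<longlonglongrightarrow> g x * indicator (box a b) x"
      using lim by (auto intro!: tendsto_mult)
    show "AE x in lebesgue_on U. norm (g x * \<psi> k x) \<le> \<bar>g x * indicator (box a b) x\<bar>" for k
      using le1[of k] by (auto simp: abs_mult intro!: mult_left_mono)
  qed
  then show ?thesis using z[OF t] LIMSEQ_unique by (auto intro: LIMSEQ_unique tendsto_const)
qed

text \<open>All integrals of \<open>g\<close> over small boxes vanish. Lebesgue differentiation
  identifies \<open>g\<close> almost everywhere with limits of its averages over small cubes, and
  these are all 0.\<close>

lemma fundamental_lemma:
  assumes U: "open U" and g: "g \<in> L2 U" and z: "\<And>\<phi>. \<phi> \<in> test_functions U \<Longrightarrow> L2_inner U g \<phi> = 0"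
  shows "AE x in lebesgue. x \<in> U \<longrightarrow> g x = 0"
proof -
  have box0: "AE x in lebesgue. x \<in> cbox a b \<longrightarrow> g x = 0" if ab: "cbox a b \<subseteq> U" for a b :: plane
  proof -
    define f where "f x = indicator (box a b) x * g x" for x
    have b: "bounded (box a b)" by simp
    have V: "box a b \<subseteq> U" using ab box_subset_cbox by blast
    have gV: "g \<in> L2 (box a b)" using L2_subset[OF g U open_box V] .
    have 1: "(\<lambda>x. 1) \<in> L2 (box a b)" by (rule L2_smooth) auto
    have fi: "integrable lebesgue f"
      using L2_mult_integrable[OF 1 gV] by (subst (asm) integrable_restrict_space) (auto simp: f_def[abs_def])
    have fS: "set_integrable lebesgue S f" if "S \<in> sets lebesgue" for S
      unfolding set_integrable_def using that fi by (intro integrable_mult_indicator)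
    have "f integrable_on cbox c d" for c d
      using set_lebesgue_integral_eq_integral(1)[OF fS] by simp
    \<comment> \<open>\<open>N\<close> is the exceptional null set of the differentiation theorem,
      stated for cubes that have \<open>x\<close> as their lower corner.\<close>
    then obtain N where N: "negligible N" "\<And>x e. x \<notin> N \<Longrightarrow> 0 < e \<Longrightarrow> \<exists>d>0. \<forall>h. 0 < h \<and> h < d \<longrightarrow>
        norm (integral (cbox x (x + h *\<^sub>R One)) f /\<^sub>R h ^ DIM(plane) - f x) < e"
      using integrable_ccontinuous_explicit[of f] by metis
    have "g x = 0" if x: "x \<in> box a b" "x \<notin> N" for x
    proof -
      obtain r where r: "r > 0" "ball x r \<subseteq> box a b" using x(1) open_box openE by blast
      \<comment> \<open>By the bound of the norm by the sum of the coordinates, points of the cube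
        are within \<open>2 * h\<close> of \<open>x\<close>; the margin 3 keeps the closed cube
        inside the ball of radius \<open>r\<close>.\<close>
      have zero: "integral (cbox x (x + h *\<^sub>R One)) f = 0" if h: "0 < h" "h < r / 3" for h
      proof -
        define y where "y = x + h *\<^sub>R (One :: plane)"
        have yi: "y $ i = x $ i + h" for i
        proof -
          have "(One :: plane) $ i = 1"
            using exhaust_2[of i] by (auto simp: Basis_plane axis_eq_axis) (auto simp: axis_def)
          then show ?thesis by (simp add: y_def)
        qed
        have sub: "cbox x y \<subseteq> box a b"
        proof
          fix p assume "p \<in> cbox x y"
          then have "x $ i \<le> p $ i \<and> p $ i \<le> x $ i + h" for i by (simp add: mem_box_cart yi)
          then have pi: "\<bar>p $ i - x $ i\<bar> \<le> h" for i by (simp add: abs_le_iff algebra_simps)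
          have "norm (p - x) \<le> \<bar>p$1 - x$1\<bar> + \<bar>p$2 - x$2\<bar>"
            using norm_le_l1_cart[of "p - x"] by (simp add: sum_2)
          also have "\<dots> < r" using pi[of 1] pi[of 2] h r by linarith
          finally show "p \<in> box a b" using r(2) by (auto simp: dist_norm norm_minus_commute)
        qed
        have "integral (cbox x y) f = (\<integral>p. indicator (cbox x y) p * f p \<partial>lebesgue)"
          using set_lebesgue_integral_eq_integral(2)[OF fS, of "cbox x y"] by (simp add: set_lebesgue_integral_def)
        also have "\<dots> = (\<integral>p. indicator U p * (g p * indicator (box x y) p) \<partial>lebesgue)"
        proof (rule integral_cong_AE)
          show "(\<lambda>p. indicator (cbox x y) p * f p) \<in> borel_measurable lebesgue"
            using fi by (intro borel_measurable_times borel_measurable_indicator) auto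
          have "(\<lambda>p. indicator (box x y) p * f p) \<in> borel_measurable lebesgue"
            using fi by (intro borel_measurable_times indicator_lebesgue open_box) auto
          also have "(\<lambda>p. indicator (box x y) p * f p) = (\<lambda>p. indicator U p * (g p * indicator (box x y) p))"
            using sub V box_subset_cbox[of x y] by (intro ext) (auto simp: f_def indicator_def)
          finally show "(\<lambda>p. indicator U p * (g p * indicator (box x y) p)) \<in> borel_measurable lebesgue" .
          have "AE p in lebesgue. p \<notin> cbox x y - box x y"
            by (rule AE_not_in[OF negligible_frontier_interval[unfolded negligible_iff_null_sets]])
          then show "AE p in lebesgue. indicator (cbox x y) p * f p = indicator U p * (g p * indicator (box x y) p)"
            by eventually_elim (use sub V box_subset_cbox[of x y] in \<open>auto simp: f_def indicator_def\<close>)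
        qed
        also have "\<dots> = L2_inner U g (indicator (box x y))" using U by (simp add: L2_inner_eq)
        also have "\<dots> = 0"
          by (rule integral_box_zero[OF U g z]) (use sub V yi h in auto)
        finally show ?thesis by (simp add: y_def)
      qed
      have "\<bar>f x\<bar> < e" if e: "e > 0" for e
      proof -
        obtain d where d: "d > 0" "\<forall>h. 0 < h \<and> h < d \<longrightarrow>
          norm (integral (cbox x (x + h *\<^sub>R One)) f /\<^sub>R h ^ DIM(plane) - f x) < e"
          using N(2)[OF x(2) e] by blast
        define h where "h = min (d / 2) (r / 6)"
        have h: "0 < h" "h < d" "h < r / 3" using d(1) r(1) by (auto simp: h_def)
        show ?thesis using d(2)[rule_format, of h] zero[OF h(1,3)] h by simp
      qed
      then have "f x = 0" by (metis abs_of_nonneg abs_ge_zero less_irrefl abs_0_eq abs_le_zero_iff linorder_not_le)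
      then show ?thesis using x by (simp add: f_def)
    qed
    moreover have "AE x in lebesgue. x \<notin> N"
      by (rule AE_not_in[OF N(1)[unfolded negligible_iff_null_sets]])
    moreover have "AE x in lebesgue. x \<notin> cbox a b - box a b"
      by (rule AE_not_in[OF negligible_frontier_interval[unfolded negligible_iff_null_sets]])
    ultimately show ?thesis by (auto elim!: eventually_elim2)
  qed
  \<comment> \<open>Countably many boxes fill \<open>U\<close>, so the null sets obtained on single
    boxes can be united.\<close>
  obtain D where D: "countable D" "\<And>X. X \<in> D \<Longrightarrow> X \<subseteq> U \<and> (\<exists>a b. X = cbox a b)" "\<Union>D = U"
    using open_countable_Union_open_cbox[OF U] by (metis PowD subsetD)
  have "AE x in lebesgue. x \<in> X \<longrightarrow> g x = 0" if X: "X \<in> D" for X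
  proof -
    obtain a b where ab: "X = cbox a b" using D(2)[OF X] by blast
    then show ?thesis using D(2)[OF X] box0[of a b] by simp
  qed
  then have "AE x in lebesgue. \<forall>X\<in>D. x \<in> X \<longrightarrow> g x = 0"
    by (subst AE_ball_countable[OF D(1)]) blast
  then show ?thesis by eventually_elim (use D(3) in blast)
qed

subsection \<open>Weak derivatives\<close>

lemma has_weak_deriv_restrict:
  assumes "open U" "open V" "V \<subseteq> U" "has_weak_deriv U \<alpha> u g"
  shows "has_weak_deriv V \<alpha> u g"
  unfolding has_weak_deriv_def
proof
  fix \<phi> assume V: "\<phi> \<in> test_functions V"
  then have U: "\<phi> \<in> test_functions U" using assms(3) test_functions_mono by blast
  show "L2_inner V u (partials \<alpha> \<phi>) = (- 1) ^ length \<alpha> * L2_inner V g \<phi>"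
    using assms(4)[unfolded has_weak_deriv_def, THEN bspec, OF U] U
      test_functions_partials[OF U, of \<alpha>] test_functions_partials[OF V, of \<alpha>] V
    by (simp add: L2_inner_test[OF assms(1)] L2_inner_test[OF assms(2)])
qed

lemma test_functions_L2:
  assumes "open V" "\<phi> \<in> test_functions U" shows "\<phi> \<in> L2 V"
proof -
  obtain C where C: "compact C" "\<And>x. x \<notin> C \<Longrightarrow> \<phi> x = 0" using assms(2) unfolding test_functions_iff by blast
  obtain B where B: "\<And>x. x \<in> C \<Longrightarrow> norm x < B" using compact_imp_bounded[OF C(1)] bounded_pos_less by blast
  have sm: "smooth \<phi>" using assms(2) test_functions_smooth by blast
  have "\<phi> \<in> L2 (ball 0 B)" by (rule L2_smooth[OF _ _ sm]) auto
  moreover have z: "x \<notin> ball 0 B \<Longrightarrow> \<phi> x = 0" for x using B[of x] C(2)[of x] by (auto simp: dist_norm)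
  ultimately have "\<phi> \<in> L2 UNIV"
  proof -
    assume "\<phi> \<in> L2 (ball 0 B)"
    moreover have "(\<lambda>x. indicator (ball 0 B) x * \<phi> x) = \<phi>" "(\<lambda>x. indicator (ball 0 B) x * (\<phi> x)\<^sup>2) = (\<lambda>x. (\<phi> x)\<^sup>2)"
      using z by (auto simp: fun_eq_iff indicator_def)
    ultimately show ?thesis by (simp add: L2_iff)
  qed
  then show ?thesis using L2_subset[OF _ open_UNIV assms(1)] by blast
qed

lemma has_weak_deriv_diff:
  assumes U: "open U" and "u \<in> L2 U" "v \<in> L2 U" "g \<in> L2 U" "h \<in> L2 U"
    "has_weak_deriv U \<alpha> u g" "has_weak_deriv U \<alpha> v h"
  shows "has_weak_deriv U \<alpha> (\<lambda>x. u x - v x) (\<lambda>x. g x - h x)"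
  unfolding has_weak_deriv_def
proof
  fix \<phi> assume \<phi>: "\<phi> \<in> test_functions U"
  then show "L2_inner U (\<lambda>x. u x - v x) (partials \<alpha> \<phi>) = (- 1) ^ length \<alpha> * L2_inner U (\<lambda>x. g x - h x) \<phi>"
    using assms test_functions_L2[OF U \<phi>] test_functions_L2[OF U test_functions_partials[OF \<phi>, of \<alpha>]]
    by (simp add: L2_inner_diff_left has_weak_deriv_def right_diff_distrib)
qed

lemma has_weak_deriv_unique:
  assumes U: "open U" and g: "g \<in> L2 U" "h \<in> L2 U" and "has_weak_deriv U \<alpha> u g" "has_weak_deriv U \<alpha> u h"
  shows "AE x in lebesgue. x \<in> U \<longrightarrow> g x = h x"
proof -
  have "AE x in lebesgue. x \<in> U \<longrightarrow> g x - h x = 0"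
  proof (rule fundamental_lemma[OF U L2_diff[OF g]])
    fix \<phi> assume \<phi>: "\<phi> \<in> test_functions U"
    have "(-1) ^ length \<alpha> * L2_inner U g \<phi> = (-1) ^ length \<alpha> * L2_inner U h \<phi>"
      using assms(4,5) \<phi> unfolding has_weak_deriv_def by metis
    then have "L2_inner U g \<phi> = L2_inner U h \<phi>" by simp
    then show "L2_inner U (\<lambda>x. g x - h x) \<phi> = 0"
      using g test_functions_L2[OF U \<phi>] by (simp add: L2_inner_diff_left)
  qed
  then show ?thesis by simp
qed

text \<open>Without symmetry of second derivatives, integrating by parts one derivative at a time
  reverses the order of differentiation.\<close>

lemma has_weak_deriv_smooth:
  assumes U: "open U" and P: "smooth P"
  shows "has_weak_deriv U \<alpha> P (partials (rev \<alpha>) P)"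
  unfolding has_weak_deriv_def
proof
  fix \<phi> assume \<phi>: "\<phi> \<in> test_functions U"
  have "\<phi> \<in> test_functions UNIV" using \<phi> test_functions_mono by blast
  then show "L2_inner U P (partials \<alpha> \<phi>) = (- 1) ^ length \<alpha> * L2_inner U (partials (rev \<alpha>) P) \<phi>"
    using integral_partials[OF P, of \<phi> \<alpha>] smooth_borel[OF P] smooth_borel[OF smooth_partials[OF P]]
    by (simp add: L2_inner_test_borel[OF U] test_functions_partials[OF \<phi>] \<phi>)
qed

lemma wderiv_props:
  assumes "g \<in> L2 U" "has_weak_deriv U \<alpha> u g"
  shows "wderiv U \<alpha> u \<in> L2 U" "has_weak_deriv U \<alpha> u (wderiv U \<alpha> u)"
  using someI[of "\<lambda>g. g \<in> L2 U \<and> has_weak_deriv U \<alpha> u g" g] assms unfolding wderiv_def by auto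

text \<open>This frees the integrals from the choice in \<open>wderiv\<close>: any explicit square
  integrable weak derivative may be substituted.\<close>

lemma wderiv_AE:
  assumes "open U" "g \<in> L2 U" "has_weak_deriv U \<alpha> u g"
  shows "AE x in lebesgue. x \<in> U \<longrightarrow> wderiv U \<alpha> u x = g x"
  using has_weak_deriv_unique[OF assms(1) _ assms(2) _ assms(3)] wderiv_props[OF assms(2,3)] by blast

lemma L2_inner_cong_AE:
  assumes U: "open U" and "AE x in lebesgue. x \<in> U \<longrightarrow> f x = f' x" "AE x in lebesgue. x \<in> U \<longrightarrow> g x = g' x"
    and "f \<in> L2 U" "f' \<in> L2 U" "g \<in> L2 U" "g' \<in> L2 U"
  shows "L2_inner U f g = L2_inner U f' g'"
  unfolding L2_inner_def
proof (rule integral_cong_AE)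
  have "AE x in lebesgue. x \<in> U \<longrightarrow> f x * g x = f' x * g' x"
    using assms(2,3) by eventually_elim auto
  then show "AE x in lebesgue_on U. f x * g x = f' x * g' x"
    using U by (simp add: AE_restrict_space_iff)
qed (use L2_mult_integrable assms(4-) in auto)

section \<open>Test functions in the weak formulation\<close>

lemma L2_zero: "(\<lambda>x. 0) \<in> L2 U" by (simp add: L2_def)

text \<open>Even for the zero function \<open>wderiv\<close> is only some function that vanishes
  almost everywhere on \<open>U\<close>. The fact is needed to see that a test function is
  approximated by the constant sequence with value itself.\<close>

lemma sobolev_seminorm_zero:
  assumes U: "open U" shows "sobolev_seminorm U k (\<lambda>x. 0) = 0"
proof -
  have hz: "has_weak_deriv U \<alpha> (\<lambda>x. 0) (\<lambda>x. 0)" for \<alpha>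
    by (simp add: has_weak_deriv_def L2_inner_def)
  have "L2_inner U (wderiv U \<alpha> (\<lambda>x. 0)) (wderiv U \<alpha> (\<lambda>x. 0)) = L2_inner U (\<lambda>x. 0) (\<lambda>x. 0)" for \<alpha>
    by (intro L2_inner_cong_AE U wderiv_AE L2_zero hz wderiv_props(1)[OF L2_zero])
  then show ?thesis by (simp add: sobolev_seminorm_def grad_inner_def) (simp add: L2_inner_def)
qed

lemma test_functions_sobolev0:
  assumes U: "open U" and \<phi>: "\<phi> \<in> test_functions U" shows "\<phi> \<in> sobolev0 U m"
proof -
  have s: "partials (rev \<alpha>) \<phi> \<in> L2 U \<and> has_weak_deriv U \<alpha> \<phi> (partials (rev \<alpha>) \<phi>)" for \<alpha>
    using has_weak_deriv_smooth[OF U test_functions_smooth[OF \<phi>]]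
      test_functions_L2[OF U test_functions_partials[OF \<phi>]] by blast
  have "\<phi> \<in> sobolev U m" using s test_functions_L2[OF U \<phi>] unfolding sobolev_def by blast
  moreover have "sobolev_norm U m (\<lambda>x. \<phi> x - \<phi> x) = 0"
    by (simp add: sobolev_norm_def sobolev_seminorm_zero[OF U])
  ultimately show ?thesis unfolding sobolev0_def using \<phi>
    by (auto intro!: exI[of _ "\<lambda>_. \<phi>"])
qed

lemma sobolev_wderiv:
  assumes "u \<in> sobolev U m" "length \<alpha> \<le> m"
  shows "wderiv U \<alpha> u \<in> L2 U" "has_weak_deriv U \<alpha> u (wderiv U \<alpha> u)"
  using assms wderiv_props unfolding sobolev_def by blast+

text \<open>A test function is admissible in the equation, and its chosen weak derivatives may be
  replaced by classical ones; the reversal of the index comes from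
  \<open>has_weak_deriv_smooth\<close>.\<close>

lemma weak_solution_test:
  assumes U: "open U" and w: "weak_solution U \<iota> f w" and \<phi>: "\<phi> \<in> test_functions U"
  shows "\<iota>\<^sup>2 * (\<Sum>\<alpha> | length \<alpha> = 3. L2_inner U (wderiv U \<alpha> w) (partials (rev \<alpha>) \<phi>))
    + (\<Sum>\<alpha> | length \<alpha> = 2. L2_inner U (wderiv U \<alpha> w) (partials (rev \<alpha>) \<phi>)) = L2_inner U f \<phi>"
proof -
  have ws: "w \<in> sobolev U 3" using w by (simp add: weak_solution_def sobolev0_def)
  have s: "partials (rev \<alpha>) \<phi> \<in> L2 U" "has_weak_deriv U \<alpha> \<phi> (partials (rev \<alpha>) \<phi>)" for \<alpha>
    using has_weak_deriv_smooth[OF U test_functions_smooth[OF \<phi>]]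
      test_functions_L2[OF U test_functions_partials[OF \<phi>]] by blast+
  have "grad_inner U m w \<phi> = (\<Sum>\<alpha> | length \<alpha> = m. L2_inner U (wderiv U \<alpha> w) (partials (rev \<alpha>) \<phi>))"
    if "m \<le> 3" for m
    unfolding grad_inner_def
    by (intro sum.cong refl L2_inner_cong_AE U wderiv_AE s wderiv_props(1)[OF s] AE_I2)
      (use that sobolev_wderiv[OF ws] in auto)
  from this[of 3] this[of 2] show ?thesis
    using w test_functions_sobolev0[OF U \<phi>, of 3] by (auto simp: weak_solution_def)
qed

lemma finite_lists [simp]: "finite {\<alpha> :: 2 list. length \<alpha> = m}"
  using finite_lists_length_eq[of "UNIV :: 2 set" m] by simp

lemma wderiv_le_seminorm:
  assumes "length \<alpha> = m" shows "L2_norm U (wderiv U \<alpha> u) \<le> sobolev_seminorm U m u"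
proof -
  have "L2_inner U (wderiv U \<alpha> u) (wderiv U \<alpha> u) \<le> grad_inner U m u u"
    unfolding grad_inner_def
    by (rule member_le_sum) (use assms in \<open>auto simp: L2_inner_def\<close>)
  then show ?thesis by (simp add: L2_norm_def sobolev_seminorm_def)
qed

text \<open>Globally \<open>v\<close> may have no weak derivatives of higher order, but on a cell it
  agrees with \<open>P\<close>. There the derivative of \<open>w\<close> taken on all of
  \<open>U\<close> splits into the cellwise derivative of the error and a derivative of
  \<open>P\<close>.\<close>

lemma wderiv_split:
  assumes U: "open U" "bounded V" "open V" "V \<subseteq> U" and w: "w \<in> sobolev U m" and v: "v \<in> L2 U"
    and P: "smooth P" "AE x in lebesgue. x \<in> V \<longrightarrow> v x = P x" and l: "length \<alpha> \<le> m"
  shows "wderiv V \<alpha> (\<lambda>x. w x - v x) \<in> L2 V"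
    and "AE x in lebesgue. x \<in> V \<longrightarrow> wderiv U \<alpha> w x = wderiv V \<alpha> (\<lambda>x. w x - v x) x + partials (rev \<alpha>) P x"
proof -
  have wV: "w \<in> L2 V" using w L2_subset[OF _ U(1,3,4)] by (simp add: sobolev_def)
  have vV: "v \<in> L2 V" using v L2_subset[OF _ U(1,3,4)] by simp
  have PV: "Q \<in> L2 V" if "smooth Q" for Q using L2_smooth[OF U(3,2) that] .
  have "has_weak_deriv V \<alpha> v (partials (rev \<alpha>) P)"
    unfolding has_weak_deriv_def
  proof
    fix \<phi> assume \<phi>: "\<phi> \<in> test_functions V"
    have "L2_inner V v (partials \<alpha> \<phi>) = L2_inner V P (partials \<alpha> \<phi>)"
      by (rule L2_inner_cong_AE[OF U(3) P(2) AE_I2 vV PV[OF P(1)]])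
        (auto intro: test_functions_L2[OF U(3) test_functions_partials[OF \<phi>]])
    then show "L2_inner V v (partials \<alpha> \<phi>) = (- 1) ^ length \<alpha> * L2_inner V (partials (rev \<alpha>) P) \<phi>"
      using has_weak_deriv_smooth[OF U(3) P(1), of \<alpha>] \<phi> by (simp add: has_weak_deriv_def)
  qed
  moreover have "has_weak_deriv V \<alpha> w (wderiv U \<alpha> w)" "wderiv U \<alpha> w \<in> L2 V"
    using sobolev_wderiv[OF w l] has_weak_deriv_restrict[OF U(1,3,4)] L2_subset[OF _ U(1,3,4)] by blast+
  ultimately have d: "has_weak_deriv V \<alpha> (\<lambda>x. w x - v x) (\<lambda>x. wderiv U \<alpha> w x - partials (rev \<alpha>) P x)"
      "(\<lambda>x. wderiv U \<alpha> w x - partials (rev \<alpha>) P x) \<in> L2 V"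
    using has_weak_deriv_diff[OF U(3) wV vV] PV[OF smooth_partials[OF P(1)]] L2_diff by blast+
  show "wderiv V \<alpha> (\<lambda>x. w x - v x) \<in> L2 V" using wderiv_props[OF d(2,1)] by blast
  show "AE x in lebesgue. x \<in> V \<longrightarrow> wderiv U \<alpha> w x = wderiv V \<alpha> (\<lambda>x. w x - v x) x + partials (rev \<alpha>) P x"
    using wderiv_AE[OF U(3) d(2,1)] by eventually_elim auto
qed

subsection \<open>Cubic polynomials\<close>

text \<open>Degree at most 3, expressed without coefficients: only smoothness and the vanishing of
  all derivatives of order at least 4 are used in the integrations by parts.\<close>

definition cubic :: "(plane \<Rightarrow> real) \<Rightarrow> bool" where
  "cubic P \<longleftrightarrow> smooth P \<and> (\<forall>\<alpha>. 4 \<le> length \<alpha> \<longrightarrow> partials \<alpha> P = (\<lambda>x. 0))"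

text \<open>A degree bound that suits induction: \<open>pvanish (Suc k)\<close> is to be read as
  degree at most \<open>k\<close>, and \<open>pvanish 0\<close> singles out the zero
  function.\<close>

primrec pvanish :: "nat \<Rightarrow> (plane \<Rightarrow> real) \<Rightarrow> bool" where
  "pvanish 0 f = (f = (\<lambda>x. 0))"
| "pvanish (Suc k) f = (smooth f \<and> (\<forall>i. pvanish k (pd i f)))"

lemma pvanish_smooth: "pvanish k f \<Longrightarrow> smooth f"
  by (cases k) auto

lemma pvanish_partials: "pvanish (length \<alpha>) f \<Longrightarrow> partials \<alpha> f = (\<lambda>x. 0)"
  by (induction \<alpha> arbitrary: f rule: rev_induct) (auto simp: partials_snoc)

lemma pvanish_zero: "pvanish k (\<lambda>x. 0)"
  by (induction k) auto

lemma pvanish_const: "pvanish (Suc k) (\<lambda>x. c)"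
  by (simp add: pvanish_zero smooth_const)

lemma pvanish_add: "pvanish k f \<Longrightarrow> pvanish k g \<Longrightarrow> pvanish k (\<lambda>x. f x + g x)"
  by (induction k arbitrary: f g) (auto simp: dir_deriv_add smooth_dble)

lemma pvanish_mono: "pvanish k f \<Longrightarrow> k \<le> l \<Longrightarrow> pvanish l f"
proof (induction k arbitrary: f l)
  case (Suc k) then show ?case by (cases l) auto
qed (auto simp: pvanish_zero)

lemma pvanish_sum: "(\<And>i. i \<in> I \<Longrightarrow> pvanish k (f i)) \<Longrightarrow> pvanish k (\<lambda>x. \<Sum>i\<in>I. f i x)"
  by (induction I rule: infinite_finite_induct) (auto simp: pvanish_zero intro: pvanish_add)

text \<open>Degrees add. In the Leibniz rule each term differentiates one factor; its degree drops
  by one and the induction hypothesis applies, or the factor was constant and the term is 0.\<close>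

lemma pvanish_mult: "pvanish (Suc k) f \<Longrightarrow> pvanish (Suc l) g \<Longrightarrow> pvanish (Suc (k + l)) (\<lambda>x. f x * g x)"
proof (induction "k + l" arbitrary: k l f g)
  case 0
  then have "pd i (\<lambda>x. f x * g x) = (\<lambda>x. 0)" for i
    by (subst dir_deriv_mult) (auto simp: smooth_dble)
  then show ?case using 0 by auto
next
  case (Suc n)
  have sm: "smooth f" "smooth g" using Suc.prems by (auto intro: pvanish_smooth)
  have A: "pvanish (Suc n) (\<lambda>x. pd i f x * g x)" for i
  proof (cases k)
    case 0 then show ?thesis using Suc.prems by (simp add: pvanish_zero smooth_const)
  next
    case (Suc k')
    then show ?thesis using Suc.prems Suc.hyps(1)[of k' l "pd i f" g] Suc.hyps(2) by auto
  qed
  have B: "pvanish (Suc n) (\<lambda>x. f x * pd i g x)" for i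
  proof (cases l)
    case 0 then show ?thesis using Suc.prems by (simp add: pvanish_zero smooth_const)
  next
    case (Suc l')
    then show ?thesis using Suc.prems Suc.hyps(1)[of k l' f "pd i g"] Suc.hyps(2) by auto
  qed
  have "pvanish (Suc n) (pd i (\<lambda>x. f x * g x))" for i
    unfolding dir_deriv_mult[OF smooth_dble[OF sm(1)] smooth_dble[OF sm(2)]] by (rule pvanish_add[OF A B])
  then have "pvanish (Suc (Suc n)) (\<lambda>x. f x * g x)"
    unfolding pvanish.simps(2)[of "Suc n"] using smooth_mult[OF sm] by blast
  then show ?case unfolding Suc.hyps(2)[symmetric] .
qed

lemma pvanish_nth_power: "pvanish (Suc k) (\<lambda>x. (x $ i) ^ k)"
proof (induction k)
  case 0 then show ?case using pvanish_const[of 0 1] by simp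
next
  case (Suc k)
  have "pvanish (Suc 1) (\<lambda>x. x $ i)" by (auto simp: dir_deriv_nth smooth_nth smooth_const)
  from pvanish_mult[OF this Suc] show ?case by simp
qed

lemma poly_space_cubic: assumes "P \<in> poly_space 3" shows "cubic P"
proof -
  obtain c where P: "P = (\<lambda>x. \<Sum>i\<le>3. \<Sum>j\<le>3 - i. c i j * (x $ 1) ^ i * (x $ 2) ^ j)"
    using assms unfolding poly_space_def by blast
  have "pvanish 4 (\<lambda>x. c i j * (x $ 1) ^ i * (x $ 2) ^ j)" if "i \<le> 3" "j \<le> 3 - i" for i j :: nat
  proof (rule pvanish_mono)
    show "pvanish (Suc (0 + i + j)) (\<lambda>x. c i j * (x $ 1) ^ i * (x $ 2) ^ j)"
      by (intro pvanish_mult pvanish_nth_power pvanish_const)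
  qed (use that in auto)
  then have v: "pvanish 4 P" unfolding P by (intro pvanish_sum) auto
  then show ?thesis
    unfolding cubic_def using pvanish_smooth pvanish_partials pvanish_mono by blast
qed

lemma smooth_partials_diff:
  "smooth P \<Longrightarrow> smooth Q \<Longrightarrow> partials \<alpha> (\<lambda>x. P x - Q x) = (\<lambda>x. partials \<alpha> P x - partials \<alpha> Q x)"
  by (induction \<alpha>) (auto simp: dir_deriv_diff smooth_dble smooth_partials)

lemma cubic_diff: "cubic P \<Longrightarrow> cubic Q \<Longrightarrow> cubic (\<lambda>x. P x - Q x)"
  unfolding cubic_def by (auto simp: smooth_partials_diff)

lemma smooth_constI:
  assumes "smooth g" "\<And>i. pd i g = (\<lambda>x. 0)" shows "\<exists>c. g = (\<lambda>x. c)"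
proof -
  have "(g has_derivative (\<lambda>_. 0)) (at x within UNIV)" for x
    using dble_has_derivative[OF smooth_dble[OF assms(1)], of x] dir_deriv_expand[OF smooth_dble[OF assms(1)]] assms(2) by simp
  then obtain c where "\<And>x. x \<in> UNIV \<Longrightarrow> g x = c" using has_derivative_zero_constant[OF convex_UNIV] by metis
  then show ?thesis by blast
qed

lemma cubic_third_const:
  assumes "cubic P" "length \<alpha> = 3" shows "\<exists>c. partials \<alpha> P = (\<lambda>x. c)"
proof (rule smooth_constI)
  show "smooth (partials \<alpha> P)" using assms smooth_partials unfolding cubic_def by blast
  fix i show "pd i (partials \<alpha> P) = (\<lambda>x. 0)"
    using assms(1)[unfolded cubic_def, THEN conjunct2, rule_format, of "i # \<alpha>"] assms(2) by simp
qed

text \<open>Moving all derivatives onto the cubic produces a derivative of twice the order of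
  \<beta>, hence at least 4, which vanishes.\<close>

lemma cubic_orthogonal:
  assumes P: "cubic P" and \<phi>: "\<phi> \<in> test_functions UNIV" and l: "2 \<le> length \<beta>"
  shows "(\<integral>x. partials \<beta> P x * partials \<beta> \<phi> x \<partial>lborel) = 0"
proof -
  have sm: "smooth (partials \<beta> P)" using P smooth_partials unfolding cubic_def by blast
  have "partials (rev \<beta>) (partials \<beta> P) = partials (rev \<beta> @ \<beta>) P" by (simp add: partials_append)
  also have "\<dots> = (\<lambda>x. 0)" using P l unfolding cubic_def by simp
  finally show ?thesis using integral_partials[OF sm \<phi>, of \<beta>] by simp
qed

subsection \<open>Boundary terms on a half plane\<close>

lemma test_functions_integrable_line:
  assumes "\<phi> \<in> test_functions UNIV" "norm n = 1"
  shows "integrable lborel (\<lambda>t. \<phi> (m + t *\<^sub>R perp n))"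
proof -
  obtain L where L: "L > 0" "\<forall>s t. L \<le> \<bar>s\<bar> \<or> L \<le> \<bar>t\<bar> \<longrightarrow> \<phi> (frame m n (s, t)) = 0"
    using frame_bound[OF assms] by blast
  have z: "\<phi> (m + t *\<^sub>R perp n) = 0" if "\<bar>t\<bar> \<ge> L" for t
    using L(2)[rule_format, of 0 t] that by (simp add: frame_def)
  have "integrable lborel (\<lambda>t. indicator {-L..L} t *\<^sub>R \<phi> (m + t *\<^sub>R perp n))"
    by (intro borel_integrable_compact continuous_on_compose2[OF smooth_continuous[OF test_functions_smooth[OF assms(1)], of UNIV]] continuous_intros) auto
  also have "(\<lambda>t. indicator {-L..L} t *\<^sub>R \<phi> (m + t *\<^sub>R perp n)) = (\<lambda>t. \<phi> (m + t *\<^sub>R perp n))"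
  proof
    fix t show "indicator {-L..L} t *\<^sub>R \<phi> (m + t *\<^sub>R perp n) = \<phi> (m + t *\<^sub>R perp n)"
      using z[of t] by (cases "L \<le> \<bar>t\<bar>") (auto simp: indicator_def)
  qed
  finally show ?thesis .
qed

section \<open>Sums over index lists and derivatives along a line\<close>

lemma sum_lists_Suc: "(\<Sum>\<alpha> | length \<alpha> = Suc m. h \<alpha>) = (\<Sum>i\<in>UNIV. \<Sum>\<alpha> | length \<alpha> = m. h (i # \<alpha> :: 2 list))"
proof -
  have "{\<alpha> :: 2 list. length \<alpha> = Suc m} = (\<lambda>(i, \<alpha>). i # \<alpha>) ` (UNIV \<times> {\<alpha>. length \<alpha> = m})"
    by (auto simp: length_Suc_conv image_def)
  then have "(\<Sum>\<alpha> | length \<alpha> = Suc m. h \<alpha>) = (\<Sum>p\<in>UNIV \<times> {\<alpha>. length \<alpha> = m}. h (fst p # snd p))"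
    by (simp add: sum.reindex inj_on_def case_prod_beta')
  then show ?thesis by (simp add: sum.cartesian_product case_prod_beta')
qed

lemma sum_lists_0: "(\<Sum>\<alpha> | length \<alpha> = 0. h \<alpha>) = h ([] :: 2 list)"
  by simp

lemma sum_lists_2: "(\<Sum>\<alpha> | length \<alpha> = 2. h (\<alpha> :: 2 list)) = (\<Sum>i\<in>UNIV. \<Sum>j\<in>UNIV. h [i, j])"
  unfolding numeral_2_eq_2 sum_lists_Suc sum_lists_0 ..

lemma sum_lists_3: "(\<Sum>\<alpha> | length \<alpha> = 3. h (\<alpha> :: 2 list)) = (\<Sum>i\<in>UNIV. \<Sum>j\<in>UNIV. \<Sum>k\<in>UNIV. h [i, j, k])"
  unfolding numeral_3_eq_3 sum_lists_Suc sum_lists_0 ..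

lemma sum_lists_rev: "(\<Sum>\<alpha> | length \<alpha> = m. h (rev \<alpha>)) = (\<Sum>\<alpha> | length \<alpha> = m. h (\<alpha> :: 2 list))"
  by (rule sum.reindex_bij_witness[of _ rev rev]) auto

lemma dir_deriv_lin:
  "smooth g \<Longrightarrow> dir_deriv d g = (\<lambda>x. d$1 * pd 1 g x + d$2 * pd 2 g x)"
  by (rule ext, subst dir_deriv_expand[OF smooth_dble]) (simp_all add: sum_2)

lemma dir_deriv_cmult: "smooth g \<Longrightarrow> dir_deriv d (\<lambda>x. c * g x) = (\<lambda>x. c * dir_deriv d g x)"
  by (subst dir_deriv_mult) (auto simp: smooth_dble)

lemma dir_deriv_inner: "dir_deriv d (\<lambda>x. n \<bullet> (x - m)) = (\<lambda>x. n \<bullet> d)"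
  by (rule ext, rule dir_derivI) (auto intro!: derivative_eq_intros)

lemma halfplane_pd:
  assumes "\<phi> \<in> test_functions UNIV" "norm n = 1"
  shows "(\<integral>x. indicator (half m n) x * pd i \<phi> x \<partial>lborel) = n $ i * (\<integral>t. \<phi> (m + t *\<^sub>R perp n) \<partial>lborel)"
  using halfplane_divergence[OF assms, of m "axis i 1"] by (simp add: inner_axis)

text \<open>The tangential part of the gradient integrates to zero along the line, so only the
  normal component is left.\<close>

lemma integral_line_pd:
  assumes \<phi>: "\<phi> \<in> test_functions UNIV" and n: "norm n = 1"
  shows "(\<integral>t. pd i \<phi> (m + t *\<^sub>R perp n) \<partial>lborel) = n $ i * (\<integral>t. dir_deriv n \<phi> (m + t *\<^sub>R perp n) \<partial>lborel)"
proof -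
  have "pd i \<phi> (m + t *\<^sub>R perp n) = n $ i * dir_deriv n \<phi> (m + t *\<^sub>R perp n)
     + perp n $ i * dir_deriv (perp n) \<phi> (m + t *\<^sub>R perp n)" for t
    using dir_deriv_decomp[OF n smooth_dble[OF test_functions_smooth[OF \<phi>]], of "axis i 1"]
    by (simp add: inner_axis)
  then show ?thesis
    using test_functions_integrable_line[OF test_functions_dir_deriv[OF \<phi>] n, of _ m]
    by (simp add: integral_line_tangential[OF \<phi> n])
qed

context
  fixes D \<psi> \<phi> :: "plane \<Rightarrow> real" and m n :: plane
  assumes D: "cubic D" and psi: "\<psi> \<in> test_functions UNIV" and n: "norm n = 1"
  defines "\<phi> \<equiv> \<lambda>x. (n \<bullet> (x - m)) * \<psi> x"
begin

private lemma phi: "\<phi> \<in> test_functions UNIV"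
  unfolding \<phi>_def by (rule test_functions_mult[OF smooth_inner psi])

private lemma sm: "smooth \<psi>" "smooth \<phi>" "smooth D"
  using psi phi test_functions_smooth D unfolding cubic_def by blast+

private lemma pd_phi: "pd i \<phi> = (\<lambda>x. n $ i * \<psi> x + (n \<bullet> (x - m)) * pd i \<psi> x)"
  unfolding \<phi>_def using dir_deriv_mult[OF smooth_dble[OF smooth_inner] smooth_dble[OF sm(1)]]
  by (simp add: dir_deriv_inner inner_axis)

private lemma pd_pd_phi: "pd j (pd i \<phi>) = (\<lambda>x. n $ i * pd j \<psi> x + (n $ j * pd i \<psi> x + (n \<bullet> (x - m)) * pd j (pd i \<psi>) x))"
  unfolding pd_phi
  by (subst dir_deriv_add) (auto simp: dir_deriv_mult smooth_dble smooth_mult smooth_const smooth_inner sm smooth_pd dir_deriv_inner inner_axis dir_deriv_cmult)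

private lemma line: "n \<bullet> (m + t *\<^sub>R perp n - m) = 0"
  by simp

text \<open>Third derivatives of \<open>D\<close> are constant, so the divergence theorem leaves
  second derivatives of \<phi> on the line. There the term with the factor \<open>s\<close> drops
  out and \<open>n $ k * pd j \<psi> + n $ j * pd k \<psi>\<close> remains; both summands have the
  same integral, which is the factor 2.\<close>

lemma halfplane_third_order:
  "(\<Sum>\<alpha> | length \<alpha> = 3. \<integral>x. indicator (half m n) x * (partials \<alpha> D x * partials \<alpha> \<phi> x) \<partial>lborel)
   = 2 * dir_deriv n (dir_deriv n (dir_deriv n D)) m * (\<integral>t. dir_deriv n \<psi> (m + t *\<^sub>R perp n) \<partial>lborel)"
proof -
  define I where "I = (\<integral>t. dir_deriv n \<psi> (m + t *\<^sub>R perp n) \<partial>lborel)"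
  define c where "c i j k = partials [i, j, k] D m" for i j k
  have c: "partials [i, j, k] D = (\<lambda>x. c i j k)" for i j k
    using cubic_third_const[OF D, of "[i, j, k]"] by (auto simp: c_def)
  have pdl: "integrable lborel (\<lambda>t. pd i \<psi> (m + t *\<^sub>R perp n))" for i
    by (rule test_functions_integrable_line[OF test_functions_dir_deriv[OF psi] n])
  have "(\<integral>x. indicator (half m n) x * (partials [i, j, k] D x * partials [i, j, k] \<phi> x) \<partial>lborel)
      = c i j k * (n $ i * (2 * n $ j * n $ k * I))" for i j k
  proof -
    have t: "pd j (pd k \<phi>) \<in> test_functions UNIV" by (intro test_functions_dir_deriv phi)
    have "(\<integral>x. indicator (half m n) x * (partials [i, j, k] D x * partials [i, j, k] \<phi> x) \<partial>lborel)
       = (\<integral>x. c i j k * (indicator (half m n) x * pd i (pd j (pd k \<phi>)) x) \<partial>lborel)"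
      unfolding c by (simp add: mult_ac)
    also have "\<dots> = c i j k * (n $ i * (\<integral>t. pd j (pd k \<phi>) (m + t *\<^sub>R perp n) \<partial>lborel))"
      unfolding integral_mult_right_zero halfplane_pd[OF t n] ..
    also have "(\<integral>t. pd j (pd k \<phi>) (m + t *\<^sub>R perp n) \<partial>lborel)
        = (\<integral>t. n $ k * pd j \<psi> (m + t *\<^sub>R perp n) + n $ j * pd k \<psi> (m + t *\<^sub>R perp n) \<partial>lborel)"
      unfolding pd_pd_phi line by simp
    also have "\<dots> = n $ k * (n $ j * I) + n $ j * (n $ k * I)"
      using pdl by (simp add: integral_line_pd[OF psi n] I_def)
    finally show ?thesis by (simp add: algebra_simps)
  qed
  then have "(\<Sum>\<alpha> | length \<alpha> = 3. \<integral>x. indicator (half m n) x * (partials \<alpha> D x * partials \<alpha> \<phi> x) \<partial>lborel)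
      = (\<Sum>i\<in>UNIV. \<Sum>j\<in>UNIV. \<Sum>k\<in>UNIV. c i j k * (n $ i * (2 * n $ j * n $ k * I)))"
    unfolding sum_lists_3 by simp
  also have "\<dots> = 2 * dir_deriv n (dir_deriv n (dir_deriv n D)) m * I"
    using c
    by (simp add: dir_deriv_lin[where d = n] smooth_add smooth_mult smooth_const smooth_pd sm
        dir_deriv_add smooth_dble dir_deriv_cmult sum_2 algebra_simps)
  finally show ?thesis unfolding I_def .
qed

text \<open>Only one derivative is moved. The resulting volume term is a constant third derivative
  of \<open>D\<close> times an integral of \<phi> over the line, where \<phi> is 0; in the boundary
  term the gradient of \<phi> equals \<open>\<psi> n\<close>.\<close>

lemma halfplane_second_order:
  "(\<Sum>\<alpha> | length \<alpha> = 2. \<integral>x. indicator (half m n) x * (partials \<alpha> D x * partials \<alpha> \<phi> x) \<partial>lborel)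
   = (\<integral>t. dir_deriv n (dir_deriv n D) (m + t *\<^sub>R perp n) * \<psi> (m + t *\<^sub>R perp n) \<partial>lborel)"
proof -
  let ?H = "half m n"
  have Hm: "?H \<in> sets borel" by (intro borel_open open_Collect_less continuous_intros)
  define c where "c i j = partials [i, i, j] D m" for i j
  have c: "pd i (pd i (pd j D)) = (\<lambda>x. c i j)" for i j
    using cubic_third_const[OF D, of "[i, i, j]"] by (auto simp: c_def)
  define D2 where "D2 i j = pd i (pd j D)" for i j
  have sD2: "smooth (D2 i j)" for i j unfolding D2_def by (intro smooth_pd sm)
  have tl: "integrable lborel (\<lambda>t. D2 i j (m + t *\<^sub>R perp n) * \<psi> (m + t *\<^sub>R perp n))" for i j
    by (rule test_functions_integrable_line[OF test_functions_mult[OF sD2 psi] n])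
  have int: "integrable lborel (\<lambda>x. indicator ?H x * g x)" if "g \<in> test_functions UNIV" for g
    using integrable_mult_indicator[of ?H lborel g] Hm test_functions_integrable[OF that] by simp
  have "(\<integral>x. indicator ?H x * (partials [i, j] D x * partials [i, j] \<phi> x) \<partial>lborel)
      = n $ i * n $ j * (\<integral>t. D2 i j (m + t *\<^sub>R perp n) * \<psi> (m + t *\<^sub>R perp n) \<partial>lborel)" for i j
  proof -
    have t1: "(\<lambda>x. D2 i j x * pd j \<phi> x) \<in> test_functions UNIV"
      by (rule test_functions_mult[OF sD2 test_functions_dir_deriv[OF phi]])
    have "pd i (\<lambda>x. D2 i j x * pd j \<phi> x) = (\<lambda>x. c i j * pd j \<phi> x + D2 i j x * pd i (pd j \<phi>) x)"
      unfolding dir_deriv_mult[OF smooth_dble[OF sD2] smooth_dble[OF smooth_pd[OF sm(2)]]] by (simp add: D2_def c)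
    then have e: "indicator ?H x * (partials [i, j] D x * partials [i, j] \<phi> x)
       = indicator ?H x * pd i (\<lambda>x. D2 i j x * pd j \<phi> x) x - c i j * (indicator ?H x * pd j \<phi> x)" for x
      by (simp add: D2_def algebra_simps)
    have "(\<integral>x. indicator ?H x * (partials [i, j] D x * partials [i, j] \<phi> x) \<partial>lborel)
       = (\<integral>x. indicator ?H x * pd i (\<lambda>x. D2 i j x * pd j \<phi> x) x \<partial>lborel) - c i j * (\<integral>x. indicator ?H x * pd j \<phi> x \<partial>lborel)"
      unfolding e using int[OF test_functions_dir_deriv[OF t1, of "axis i 1"]] int[OF test_functions_dir_deriv[OF phi, of "axis j 1"]]
      by simp
    also have "\<dots> = n $ i * (\<integral>t. D2 i j (m + t *\<^sub>R perp n) * pd j \<phi> (m + t *\<^sub>R perp n) \<partial>lborel)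
        - c i j * (n $ j * (\<integral>t. \<phi> (m + t *\<^sub>R perp n) \<partial>lborel))"
      unfolding halfplane_pd[OF t1 n] halfplane_pd[OF phi n] ..
    also have "(\<integral>t. \<phi> (m + t *\<^sub>R perp n) \<partial>lborel) = 0" unfolding \<phi>_def line by simp
    also have "(\<integral>t. D2 i j (m + t *\<^sub>R perp n) * pd j \<phi> (m + t *\<^sub>R perp n) \<partial>lborel)
        = n $ j * (\<integral>t. D2 i j (m + t *\<^sub>R perp n) * \<psi> (m + t *\<^sub>R perp n) \<partial>lborel)"
      unfolding pd_phi line integral_mult_right_zero[symmetric] by (simp add: mult_ac)
    finally show ?thesis by simp
  qed
  then have "(\<Sum>\<alpha> | length \<alpha> = 2. \<integral>x. indicator ?H x * (partials \<alpha> D x * partials \<alpha> \<phi> x) \<partial>lborel)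
     = (\<Sum>i\<in>UNIV. \<Sum>j\<in>UNIV. n $ i * n $ j * (\<integral>t. D2 i j (m + t *\<^sub>R perp n) * \<psi> (m + t *\<^sub>R perp n) \<partial>lborel))"
    unfolding sum_lists_2 by simp
  also have "\<dots> = (\<integral>t. (\<Sum>i\<in>UNIV. \<Sum>j\<in>UNIV. n $ i * n $ j * (D2 i j (m + t *\<^sub>R perp n) * \<psi> (m + t *\<^sub>R perp n))) \<partial>lborel)"
    using tl by simp
  also have "(\<lambda>t. \<Sum>i\<in>UNIV. \<Sum>j\<in>UNIV. n $ i * n $ j * (D2 i j (m + t *\<^sub>R perp n) * \<psi> (m + t *\<^sub>R perp n)))
     = (\<lambda>t. dir_deriv n (dir_deriv n D) (m + t *\<^sub>R perp n) * \<psi> (m + t *\<^sub>R perp n))"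
    by (simp add: D2_def dir_deriv_lin[where d = n] smooth_add smooth_mult smooth_const smooth_pd sm
        dir_deriv_add smooth_dble dir_deriv_cmult sum_2 algebra_simps)
  finally show ?thesis .
qed

end

text \<open>The derivative of the second normal derivative in direction \<open>p\<close> is a third
  derivative of a cubic, hence a constant \<open>b\<close>. Subtracting \<open>b * t\<close> leaves
  a function of \<open>t\<close> with zero derivative.\<close>

lemma cubic_dir_deriv_line:
  assumes "cubic D"
  obtains a b where "\<And>t. dir_deriv n (dir_deriv n D) (m + t *\<^sub>R p) = a + b * t"
    "\<And>x. dir_deriv n (dir_deriv n (dir_deriv n D)) x = dir_deriv n (dir_deriv n (dir_deriv n D)) m"
proof -
  have sm: "smooth D" using assms cubic_def by blast
  have c: "pd i (pd j (pd k D)) = (\<lambda>x. pd i (pd j (pd k D)) m)" for i j k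
    using cubic_third_const[OF assms, of "[i, j, k]"] by auto
  have third: "dir_deriv p (dir_deriv n (dir_deriv n D)) x = dir_deriv p (dir_deriv n (dir_deriv n D)) m" for p x
    using fun_cong[OF c, of _ _ _ x]
    by (simp add: dir_deriv_lin[where d = n] dir_deriv_lin[where d = p] smooth_add smooth_mult smooth_const smooth_pd sm
        dir_deriv_add smooth_dble dir_deriv_cmult)
  define g where "g = dir_deriv n (dir_deriv n D)"
  have sg: "smooth g" unfolding g_def by (intro smooth_dir_deriv sm)
  have l: "dir_deriv (k *\<^sub>R p) g x = k * dir_deriv p g x" for k x
    using linear_cmul[OF has_derivative_linear[OF dble_has_derivative[OF smooth_dble[OF sg]]]] by simp
  define b where "b = dir_deriv p g m"
  have tb: "dir_deriv p g x = b" for x unfolding b_def g_def by (rule third)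
  have "((\<lambda>t. g (m + t *\<^sub>R p) - b * t) has_derivative (\<lambda>_. 0)) (at t within UNIV)" for t
  proof -
    have 1: "((\<lambda>t. m + t *\<^sub>R p) has_derivative (\<lambda>h. h *\<^sub>R p)) (at t)"
      by (auto intro!: derivative_eq_intros)
    have "((\<lambda>t. g (m + t *\<^sub>R p)) has_derivative (\<lambda>h. h * b)) (at t)"
      using has_derivative_compose[OF 1 dble_has_derivative[OF smooth_dble[OF sg]]] unfolding l tb .
    then show ?thesis by (auto intro!: derivative_eq_intros)
  qed
  then have "\<exists>a. \<forall>t\<in>UNIV. g (m + t *\<^sub>R p) - b * t = a"
    by (intro has_derivative_zero_constant[OF convex_UNIV])
  then obtain a where "g (m + t *\<^sub>R p) - b * t = a" for t by auto
  then have "g (m + t *\<^sub>R p) = a + b * t" for t by (simp add: field_simps)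
  then show ?thesis using that third unfolding g_def by blast
qed

subsection \<open>Residual identities\<close>

lemma L2_inner_borel:
  assumes "open V" "g \<in> borel_measurable borel" "h \<in> borel_measurable borel"
  shows "L2_inner V g h = (\<integral>x. indicator V x * (g x * h x) \<partial>lborel)"
proof -
  have "(\<lambda>x. indicator V x * (g x * h x)) \<in> borel_measurable borel"
    using assms by (intro borel_measurable_times borel_measurable_indicator) (auto simp: borel_open)
  then show ?thesis using assms(1) by (simp add: L2_inner_eq integral_completion)
qed

text \<open>The support of \<open>h\<close> may leave \<open>V\<close>, because in the edge identity
  the test function crosses the edge.\<close>

lemma L2_inner_split:
  assumes U: "open U" "bounded V" "open V" "V \<subseteq> U" and w: "w \<in> sobolev U 3" and v: "v \<in> L2 U"
    and P: "smooth P" "AE x in lebesgue. x \<in> V \<longrightarrow> v x = P x" and l: "length \<alpha> \<le> 3"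
    and h: "h \<in> test_functions X"
  shows "L2_inner V (wderiv U \<alpha> w) h = L2_inner V (wderiv V \<alpha> (\<lambda>x. w x - v x)) h
    + L2_inner V (partials (rev \<alpha>) P) h"
proof -
  note s = wderiv_split[OF U w v P l]
  have PV: "partials (rev \<alpha>) P \<in> L2 V" using L2_smooth[OF U(3,2) smooth_partials[OF P(1)]] .
  have hV: "h \<in> L2 V" using test_functions_L2[OF U(3) h] .
  have WV: "wderiv U \<alpha> w \<in> L2 V"
    using sobolev_wderiv(1)[OF w l] L2_subset[OF _ U(1,3,4)] by blast
  have "L2_inner V (wderiv U \<alpha> w) h = L2_inner V (\<lambda>x. wderiv V \<alpha> (\<lambda>x. w x - v x) x + partials (rev \<alpha>) P x) h"
    by (rule L2_inner_cong_AE[OF U(3) s(2) AE_I2 WV L2_add[OF s(1) PV] hV hV]) simp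
  then show ?thesis using L2_inner_add_left[OF s(1) PV hV] by simp
qed

text \<open>Inside a cell \<open>cubic_orthogonal\<close> removes the polynomial part of each
  derivative of \<open>w\<close>, and only the error remains.\<close>

lemma residual_interior:
  assumes U: "open U" "bounded V" "open V" "V \<subseteq> U" and w: "weak_solution U \<iota> f w" and v: "v \<in> L2 U"
    and P: "cubic P" "AE x in lebesgue. x \<in> V \<longrightarrow> v x = P x"
    and \<phi>: "\<phi> \<in> test_functions V"
  shows "L2_inner V f \<phi> =
    \<iota>\<^sup>2 * (\<Sum>\<alpha> | length \<alpha> = 3. L2_inner V (wderiv V \<alpha> (\<lambda>x. w x - v x)) (partials (rev \<alpha>) \<phi>))
    + (\<Sum>\<alpha> | length \<alpha> = 2. L2_inner V (wderiv V \<alpha> (\<lambda>x. w x - v x)) (partials (rev \<alpha>) \<phi>))"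
proof -
  have ws: "w \<in> sobolev U 3" using w by (simp add: weak_solution_def sobolev0_def)
  have smP: "smooth P" using P(1) by (simp add: cubic_def)
  have \<phi>U: "\<phi> \<in> test_functions U" "\<phi> \<in> test_functions UNIV" using \<phi> U(4) test_functions_mono by blast+
  have e: "L2_inner U g h = L2_inner V g h" if "h \<in> test_functions V" for g h
    using that test_functions_mono[OF that U(4)] by (simp add: L2_inner_test U(1,3))
  have "L2_inner U (wderiv U \<alpha> w) (partials (rev \<alpha>) \<phi>)
    = L2_inner V (wderiv V \<alpha> (\<lambda>x. w x - v x)) (partials (rev \<alpha>) \<phi>)" if l: "2 \<le> length \<alpha>" "length \<alpha> \<le> 3" for \<alpha>
  proof -
    have t: "partials (rev \<alpha>) \<phi> \<in> test_functions V" by (rule test_functions_partials[OF \<phi>])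
    have "L2_inner V (partials (rev \<alpha>) P) (partials (rev \<alpha>) \<phi>) = 0"
      using cubic_orthogonal[OF P(1) \<phi>U(2), of "rev \<alpha>"] l
      by (simp add: L2_inner_test_borel[OF U(3) t smooth_borel[OF smooth_partials[OF smP]]])
    then show ?thesis
      unfolding e[OF t] L2_inner_split[OF U ws v smP P(2) l(2) t] by simp
  qed
  then show ?thesis using weak_solution_test[OF U(1) w \<phi>U(1)] by (simp add: e[OF \<phi>])
qed

text \<open>On each side of the line the derivatives of \<open>w\<close> split into error and
  polynomial. The errors are collected in \<open>R\<close>, and the two polynomial parts give the
  boundary terms on the left.\<close>

lemma residual_edge:
  fixes m n :: plane
  assumes U: "open U" and Vp: "bounded Vp" "open Vp" "Vp \<subseteq> U" and Vm: "bounded Vm" "open Vm" "Vm \<subseteq> U"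
    and w: "weak_solution U \<iota> f w" and v: "v \<in> L2 U"
    and P: "cubic P" "AE x in lebesgue. x \<in> Vp \<longrightarrow> v x = P x"
    and Q: "cubic Q" "AE x in lebesgue. x \<in> Vm \<longrightarrow> v x = Q x"
    and n: "norm n = 1"
    and B: "cball m r \<subseteq> U"
      "\<And>x. x \<in> cball m r \<Longrightarrow> n \<bullet> (x - m) < 0 \<Longrightarrow> x \<in> Vp" "\<And>x. x \<in> cball m r \<Longrightarrow> n \<bullet> (x - m) > 0 \<Longrightarrow> x \<in> Vm"
      "\<And>x. x \<in> Vp \<Longrightarrow> n \<bullet> (x - m) < 0" "\<And>x. x \<in> Vm \<Longrightarrow> n \<bullet> (x - m) > 0"
    and \<psi>: "smooth \<psi>" "\<And>x. x \<notin> cball m r \<Longrightarrow> \<psi> x = 0"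
    and f: "f \<in> L2 U"
  defines "D \<equiv> \<lambda>x. P x - Q x" and "\<phi> \<equiv> \<lambda>x. (n \<bullet> (x - m)) * \<psi> x"
  defines "R \<equiv> \<lambda>V. L2_inner V f \<phi> -
    \<iota>\<^sup>2 * (\<Sum>\<alpha> | length \<alpha> = 3. L2_inner V (wderiv V \<alpha> (\<lambda>x. w x - v x)) (partials (rev \<alpha>) \<phi>))
    - (\<Sum>\<alpha> | length \<alpha> = 2. L2_inner V (wderiv V \<alpha> (\<lambda>x. w x - v x)) (partials (rev \<alpha>) \<phi>))"
  shows "\<iota>\<^sup>2 * (2 * dir_deriv n (dir_deriv n (dir_deriv n D)) m * (\<integral>t. dir_deriv n \<psi> (m + t *\<^sub>R perp n) \<partial>lborel))
     + (\<integral>t. dir_deriv n (dir_deriv n D) (m + t *\<^sub>R perp n) * \<psi> (m + t *\<^sub>R perp n) \<partial>lborel) = R Vp + R Vm"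
proof -
  let ?H = "half m n"
  have n0: "n \<noteq> 0" using n by auto
  have ws: "w \<in> sobolev U 3" using w by (simp add: weak_solution_def sobolev0_def)
  have sm: "smooth P" "smooth Q" using P(1) Q(1) by (auto simp: cubic_def)
  have cD: "cubic D" unfolding D_def by (rule cubic_diff[OF P(1) Q(1)])
  have \<psi>t: "\<psi> \<in> test_functions UNIV"
    unfolding test_functions_iff using \<psi> compact_cball by blast
  have \<phi>t: "\<phi> \<in> test_functions U"
  proof -
    have "smooth \<phi>" unfolding \<phi>_def by (rule smooth_mult[OF smooth_inner \<psi>(1)])
    moreover have "\<forall>x. x \<notin> cball m r \<longrightarrow> \<phi> x = 0" unfolding \<phi>_def using \<psi>(2) by simp
    ultimately show ?thesis unfolding test_functions_iff using B(1) compact_cball by blast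
  qed
  have \<phi>T: "\<phi> \<in> test_functions UNIV" using \<phi>t test_functions_mono by blast
  have out: "x \<notin> cball m r \<Longrightarrow> partials \<beta> \<phi> x = 0" for \<beta> x
    by (rule partials_outside[OF closed_cball]) (use \<psi>(2) in \<open>auto simp: \<phi>_def\<close>)
  have AEh: "AE x in lebesgue. n \<bullet> (x - m) \<noteq> 0"
  proof -
    have "negligible {x. n \<bullet> x = n \<bullet> m}" using n0 by (intro negligible_hyperplane) simp
    then have "AE x in lebesgue. x \<notin> {x. n \<bullet> x = n \<bullet> m}" by (intro AE_not_in) (simp add: negligible_iff_null_sets)
    then show ?thesis by eventually_elim (simp add: inner_diff_right)
  qed
  \<comment> \<open>Up to the line, which is a null set, the disc carrying the test function is
    covered by the two disjoint cells.\<close>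
  have split: "L2_inner U g (partials \<beta> \<phi>) = L2_inner Vp g (partials \<beta> \<phi>) + L2_inner Vm g (partials \<beta> \<phi>)"
    if g: "g \<in> L2 U" for g \<beta>
  proof -
    let ?h = "partials \<beta> \<phi>"
    have h: "?h \<in> test_functions U" by (rule test_functions_partials[OF \<phi>t])
    have i: "integrable lebesgue (\<lambda>x. indicator V x * (g x * ?h x))" if "open V" "V \<subseteq> U" for V
      using L2_mult_integrable[OF L2_subset[OF g U that] test_functions_L2[OF that(1) h]] that(1)
      by (simp add: integrable_restrict_space)
    have "L2_inner U g ?h = (\<integral>x. indicator U x * (g x * ?h x) \<partial>lebesgue)" using U by (simp add: L2_inner_eq)
    also have "\<dots> = (\<integral>x. indicator Vp x * (g x * ?h x) + indicator Vm x * (g x * ?h x) \<partial>lebesgue)"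
    proof (rule integral_cong_AE)
      show "(\<lambda>x. indicator U x * (g x * ?h x)) \<in> borel_measurable lebesgue" using i[OF U order_refl] by simp
      show "(\<lambda>x. indicator Vp x * (g x * ?h x) + indicator Vm x * (g x * ?h x)) \<in> borel_measurable lebesgue"
        using i[OF Vp(2,3)] i[OF Vm(2,3)] by (intro borel_measurable_add) simp_all
      show "AE x in lebesgue. indicator U x * (g x * ?h x) = indicator Vp x * (g x * ?h x) + indicator Vm x * (g x * ?h x)"
        using AEh
      proof eventually_elim
        case (elim x)
        show ?case
        proof (cases "x \<in> cball m r")
          case True
          then consider "x \<in> Vp" "x \<notin> Vm" | "x \<in> Vm" "x \<notin> Vp" using B(2-5)[of x] elim by linarith
          then show ?thesis using True B(1) by cases auto
        qed (simp add: out)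
      qed
    qed
    also have "\<dots> = L2_inner Vp g ?h + L2_inner Vm g ?h"
      using i[OF Vp(2,3)] i[OF Vm(2,3)] Vp Vm by (simp add: L2_inner_eq)
    finally show ?thesis .
  qed
  \<comment> \<open>The integral of the \<open>Q\<close> term over the whole plane is 0, so its part
    beyond the line is minus its part on the half plane; both cubics then combine to
    \<open>D\<close> on one side.\<close>
  have poly: "L2_inner Vp (partials \<beta> P) (partials \<beta> \<phi>) + L2_inner Vm (partials \<beta> Q) (partials \<beta> \<phi>)
      = (\<integral>x. indicator ?H x * (partials \<beta> D x * partials \<beta> \<phi> x) \<partial>lborel)" if l: "2 \<le> length \<beta>" for \<beta>
  proof -
    let ?h = "partials \<beta> \<phi>"
    have h: "?h \<in> test_functions UNIV" by (rule test_functions_partials[OF \<phi>T])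
    have Hm: "?H \<in> sets borel" by (intro borel_open open_Collect_less continuous_intros)
    have int: "integrable lborel (\<lambda>x. indicator A x * (p x * ?h x))" if "smooth p" "A \<in> sets borel" for p A
      using integrable_mult_indicator[of A lborel, OF _ test_functions_integrable[OF test_functions_mult[OF that(1) h]]] that(2)
      by simp
    have AEb: "AE x in lborel. n \<bullet> (x - m) \<noteq> 0"
    proof -
      have "{x. n \<bullet> (x - m) = 0} \<in> sets borel"
        by (intro borel_closed closed_Collect_eq continuous_intros)
      then show ?thesis using AEh by (simp add: AE_completion_iff)
    qed
    have "L2_inner Vp (partials \<beta> P) ?h = (\<integral>x. indicator ?H x * (partials \<beta> P x * ?h x) \<partial>lborel)"
      unfolding L2_inner_borel[OF Vp(2) smooth_borel[OF smooth_partials[OF sm(1)]] smooth_borel[OF test_functions_smooth[OF h]]]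
    proof (rule Bochner_Integration.integral_cong[OF refl])
      fix x show "indicator Vp x * (partials \<beta> P x * ?h x) = indicator ?H x * (partials \<beta> P x * ?h x)"
      proof (cases "x \<in> cball m r")
        case True
        then have "x \<in> Vp \<longleftrightarrow> x \<in> ?H" using B(2,4)[of x] by auto
        then show ?thesis by (simp add: indicator_def)
      qed (simp add: out)
    qed
    moreover have "L2_inner Vm (partials \<beta> Q) ?h = (\<integral>x. partials \<beta> Q x * ?h x - indicator ?H x * (partials \<beta> Q x * ?h x) \<partial>lborel)"
      unfolding L2_inner_borel[OF Vm(2) smooth_borel[OF smooth_partials[OF sm(2)]] smooth_borel[OF test_functions_smooth[OF h]]]
    proof (rule integral_cong_AE)
      show "(\<lambda>x. indicator Vm x * (partials \<beta> Q x * ?h x)) \<in> borel_measurable lborel"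
        using int[OF smooth_partials[OF sm(2)] borel_open[OF Vm(2)]] by simp
      show "(\<lambda>x. partials \<beta> Q x * ?h x - indicator ?H x * (partials \<beta> Q x * ?h x)) \<in> borel_measurable lborel"
        using int[OF smooth_partials[OF sm(2)] Hm] test_functions_integrable[OF test_functions_mult[OF smooth_partials[OF sm(2)] h]]
        by (intro borel_measurable_diff) simp_all
      show "AE x in lborel. indicator Vm x * (partials \<beta> Q x * ?h x) = partials \<beta> Q x * ?h x - indicator ?H x * (partials \<beta> Q x * ?h x)"
        using AEb
      proof eventually_elim
        case (elim x)
        show ?case
        proof (cases "x \<in> cball m r")
          case True
          then have "x \<in> Vm \<longleftrightarrow> x \<notin> ?H" using B(3,5)[of x] elim by force
          then show ?thesis by (simp add: indicator_def)
        qed (simp add: out)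
      qed
    qed
    moreover have "(\<integral>x. partials \<beta> Q x * ?h x - indicator ?H x * (partials \<beta> Q x * ?h x) \<partial>lborel)
      = - (\<integral>x. indicator ?H x * (partials \<beta> Q x * ?h x) \<partial>lborel)"
      using cubic_orthogonal[OF Q(1) \<phi>T l] int[OF smooth_partials[OF sm(2)] Hm]
        test_functions_integrable[OF test_functions_mult[OF smooth_partials[OF sm(2)] h]] by simp
    moreover have "(\<integral>x. indicator ?H x * (partials \<beta> P x * ?h x) \<partial>lborel) - (\<integral>x. indicator ?H x * (partials \<beta> Q x * ?h x) \<partial>lborel)
       = (\<integral>x. indicator ?H x * (partials \<beta> D x * ?h x) \<partial>lborel)"
    proof -
      have "(\<lambda>x. indicator ?H x * (partials \<beta> D x * ?h x))
        = (\<lambda>x. indicator ?H x * (partials \<beta> P x * ?h x) - indicator ?H x * (partials \<beta> Q x * ?h x))"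
        unfolding D_def smooth_partials_diff[OF sm] left_diff_distrib right_diff_distrib ..
      then show ?thesis
        using Bochner_Integration.integral_diff[OF int[OF smooth_partials[OF sm(1)] Hm] int[OF smooth_partials[OF sm(2)] Hm]]
        by simp
    qed
    ultimately show ?thesis by simp
  qed
  define G where "G V \<alpha> = L2_inner V (wderiv V \<alpha> (\<lambda>x. w x - v x)) (partials (rev \<alpha>) \<phi>)" for V \<alpha>
  define J where "J \<beta> = (\<integral>x. indicator ?H x * (partials \<beta> D x * partials \<beta> \<phi> x) \<partial>lborel)" for \<beta>
  have main: "L2_inner U (wderiv U \<alpha> w) (partials (rev \<alpha>) \<phi>) = G Vp \<alpha> + G Vm \<alpha> + J (rev \<alpha>)"
    if l: "2 \<le> length \<alpha>" "length \<alpha> \<le> 3" for \<alpha>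
  proof -
    have h: "partials (rev \<alpha>) \<phi> \<in> test_functions U" by (rule test_functions_partials[OF \<phi>t])
    show ?thesis
      using split[OF sobolev_wderiv(1)[OF ws l(2)], of "rev \<alpha>"] poly[of "rev \<alpha>"] l
        L2_inner_split[OF U Vp ws v sm(1) P(2) l(2) h] L2_inner_split[OF U Vm ws v sm(2) Q(2) l(2) h]
      by (simp add: G_def J_def)
  qed
  have sums: "(\<Sum>\<alpha> | length \<alpha> = k. L2_inner U (wderiv U \<alpha> w) (partials (rev \<alpha>) \<phi>))
    = (\<Sum>\<alpha> | length \<alpha> = k. G Vp \<alpha>) + (\<Sum>\<alpha> | length \<alpha> = k. G Vm \<alpha>) + (\<Sum>\<alpha> | length \<alpha> = k. J \<alpha>)"
    if "k = 2 \<or> k = 3" for k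
  proof -
    have "(\<Sum>\<alpha> | length \<alpha> = k. L2_inner U (wderiv U \<alpha> w) (partials (rev \<alpha>) \<phi>))
      = (\<Sum>\<alpha> | length \<alpha> = k. G Vp \<alpha> + G Vm \<alpha> + J (rev \<alpha>))"
      using that by (intro sum.cong refl main) auto
    then show ?thesis by (simp add: sum.distrib sum_lists_rev)
  qed
  have J3: "(\<Sum>\<alpha> | length \<alpha> = 3. J \<alpha>) = 2 * dir_deriv n (dir_deriv n (dir_deriv n D)) m * (\<integral>t. dir_deriv n \<psi> (m + t *\<^sub>R perp n) \<partial>lborel)"
    unfolding J_def \<phi>_def by (rule halfplane_third_order[OF cD \<psi>t n])
  have J2: "(\<Sum>\<alpha> | length \<alpha> = 2. J \<alpha>) = (\<integral>t. dir_deriv n (dir_deriv n D) (m + t *\<^sub>R perp n) * \<psi> (m + t *\<^sub>R perp n) \<partial>lborel)"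
    unfolding J_def \<phi>_def by (rule halfplane_second_order[OF cD \<psi>t n])
  have "\<iota>\<^sup>2 * ((\<Sum>\<alpha> | length \<alpha> = 3. G Vp \<alpha>) + (\<Sum>\<alpha> | length \<alpha> = 3. G Vm \<alpha>) + (\<Sum>\<alpha> | length \<alpha> = 3. J \<alpha>))
    + ((\<Sum>\<alpha> | length \<alpha> = 2. G Vp \<alpha>) + (\<Sum>\<alpha> | length \<alpha> = 2. G Vm \<alpha>) + (\<Sum>\<alpha> | length \<alpha> = 2. J \<alpha>))
    = L2_inner Vp f \<phi> + L2_inner Vm f \<phi>"
    using weak_solution_test[OF U w \<phi>t] split[OF f, of "[]"] sums[of 2] sums[of 3] by simp
  then show ?thesis
    unfolding R_def J3[symmetric] J2[symmetric] G_def[symmetric] by (simp add: algebra_simps)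
qed

subsection \<open>Bounds for the cell residuals\<close>

text \<open>The disc has area \<open>pi * r\<^sup>2\<close>, at most \<open>4 * r\<^sup>2\<close>;
  the root of 4 is the constant 2.\<close>

lemma L2_norm_bounded:
  assumes V: "open V" and h: "h \<in> test_functions UNIV" and b: "\<And>x. \<bar>h x\<bar> \<le> M" "\<And>x. x \<notin> cball m r \<Longrightarrow> h x = 0"
    and r: "0 < r"
  shows "L2_norm V h \<le> 2 * M * r"
proof -
  have M: "0 \<le> M" using b(1)[of m] by linarith
  have hm: "h \<in> borel_measurable borel" using smooth_borel[OF test_functions_smooth[OF h]] .
  have "L2_inner V h h = (\<integral>x. indicator V x * (h x * h x) \<partial>lborel)" by (rule L2_inner_borel[OF V hm hm])
  also have "\<dots> \<le> (\<integral>x. M\<^sup>2 * indicator (cball m r) x \<partial>lborel)"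
  proof (rule integral_mono)
    show "integrable lborel (\<lambda>x. indicator V x * (h x * h x))"
      using integrable_mult_indicator[of V lborel, OF _ test_functions_integrable[OF test_functions_mult[OF test_functions_smooth[OF h] h]]] V
      by (simp add: borel_open)
    show "integrable lborel (\<lambda>x. M\<^sup>2 * indicator (cball m r) x)"
      using emeasure_bounded_finite[OF bounded_cball, of m r]
      by (intro integrable_mult_right) (simp add: integrable_indicator_iff)
    fix x
    have "h x * h x \<le> M\<^sup>2" using b(1)[of x] M by (simp add: abs_le_square_iff[symmetric] flip: power2_eq_square)
    then show "indicator V x * (h x * h x) \<le> M\<^sup>2 * indicator (cball m r) x"
      using b(2)[of x] by (auto simp: indicator_def)
  qed
  also have "\<dots> = M\<^sup>2 * (pi * r\<^sup>2)"
    using r by (simp add: content_cball unit_ball_vol_2)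
  also have "\<dots> \<le> M\<^sup>2 * (4 * r\<^sup>2)"
    using pi_less_4 by (intro mult_left_mono mult_right_mono) auto
  also have "\<dots> = (2 * M * r)\<^sup>2" by (simp add: power_mult_distrib)
  finally show ?thesis unfolding L2_norm_def using M r by (intro real_le_lsqrt) auto
qed

lemma card_lists: "card {\<alpha> :: 2 list. length \<alpha> = k} = 2 ^ k"
  using card_lists_length_eq[of "UNIV :: 2 set" k] by simp

text \<open>Cauchy-Schwarz is applied to each of the \<open>2 ^ k\<close> index lists, with every
  single derivative bounded by the full seminorm.\<close>

lemma sum_wderiv_bound:
  assumes V: "open V" and g: "\<And>\<alpha>. length \<alpha> = k \<Longrightarrow> wderiv V \<alpha> u \<in> L2 V" and \<phi>: "\<phi> \<in> test_functions UNIV"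
    and b: "\<And>\<alpha> x. length \<alpha> = k \<Longrightarrow> \<bar>partials \<alpha> \<phi> x\<bar> \<le> M" "\<And>\<alpha> x. x \<notin> cball m r \<Longrightarrow> partials \<alpha> \<phi> x = 0" and r: "0 < r"
  shows "\<bar>\<Sum>\<alpha> | length \<alpha> = k. L2_inner V (wderiv V \<alpha> u) (partials (rev \<alpha>) \<phi>)\<bar>
    \<le> 2 ^ k * (sobolev_seminorm V k u * (2 * M * r))"
proof -
  have "\<bar>L2_inner V (wderiv V \<alpha> u) (partials (rev \<alpha>) \<phi>)\<bar> \<le> sobolev_seminorm V k u * (2 * M * r)"
    if l: "length \<alpha> = k" for \<alpha>
  proof -
    have t: "partials (rev \<alpha>) \<phi> \<in> test_functions UNIV" by (rule test_functions_partials[OF \<phi>])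
    have "\<bar>L2_inner V (wderiv V \<alpha> u) (partials (rev \<alpha>) \<phi>)\<bar>
      \<le> L2_norm V (wderiv V \<alpha> u) * L2_norm V (partials (rev \<alpha>) \<phi>)"
      by (rule L2_Cauchy_Schwarz[OF g[OF l] test_functions_L2[OF V t]])
    also have "\<dots> \<le> sobolev_seminorm V k u * (2 * M * r)"
    proof (intro mult_mono wderiv_le_seminorm l)
      show "L2_norm V (partials (rev \<alpha>) \<phi>) \<le> 2 * M * r"
        by (rule L2_norm_bounded[OF V t]) (use b l r in auto)
      show "0 \<le> sobolev_seminorm V k u" using wderiv_le_seminorm[OF l, of V u] L2_norm_nonneg order_trans by blast
    qed auto
    finally show ?thesis .
  qed
  then have "\<bar>\<Sum>\<alpha> | length \<alpha> = k. L2_inner V (wderiv V \<alpha> u) (partials (rev \<alpha>) \<phi>)\<bar>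
    \<le> (\<Sum>\<alpha> :: 2 list | length \<alpha> = k. sobolev_seminorm V k u * (2 * M * r))"
    by (intro order_trans[OF sum_abs] sum_mono) auto
  then show ?thesis by (simp add: card_lists)
qed

subsection \<open>Scaled bump functions\<close>

lemma dir_deriv_scale:
  assumes g: "smooth g"
  shows "dir_deriv d (\<lambda>x. c * g (k *\<^sub>R (x - m))) = (\<lambda>x. c * k * dir_deriv d g (k *\<^sub>R (x - m)))"
    and "dble (\<lambda>x. c * g (k *\<^sub>R (x - m)))"
proof -
  note D = dble_has_derivative[OF smooth_dble[OF g]]
  have hd: "((\<lambda>x. c * g (k *\<^sub>R (x - m))) has_derivative (\<lambda>d. c * dir_deriv (k *\<^sub>R d) g (k *\<^sub>R (x - m)))) (at x)" for x
  proof -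
    have "((\<lambda>x. k *\<^sub>R (x - m)) has_derivative (\<lambda>d. k *\<^sub>R d)) (at x)"
      by (auto intro!: derivative_eq_intros)
    from has_derivative_compose[OF this D] show ?thesis by (rule has_derivative_mult_right)
  qed
  have l: "dir_deriv (k *\<^sub>R d) g x = k * dir_deriv d g x" for k d x
    using linear_cmul[OF has_derivative_linear[OF D]] by simp
  show "dir_deriv d (\<lambda>x. c * g (k *\<^sub>R (x - m))) = (\<lambda>x. c * k * dir_deriv d g (k *\<^sub>R (x - m)))"
    by (rule ext, subst dir_derivI[OF hd]) (simp add: l)
  show "dble (\<lambda>x. c * g (k *\<^sub>R (x - m)))" using hd differentiableI by blast
qed

lemma smooth_scale: assumes "smooth g" shows "smooth (\<lambda>x. c * g (k *\<^sub>R (x - m)))"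
proof -
  have "cdiff l (\<lambda>x. c * g (k *\<^sub>R (x - m)))" for l
    using assms
  proof (induction l arbitrary: c g)
    case 0 then show ?case using dir_deriv_scale(2) by simp
  next
    case (Suc l)
    then show ?case using dir_deriv_scale(2)[OF Suc.prems] smooth_pd[OF Suc.prems]
      by (auto simp: dir_deriv_scale(1)[OF Suc.prems])
  qed
  then show ?thesis unfolding smooth_iff by blast
qed

lemma partials_scale:
  assumes "smooth g"
  shows "partials \<alpha> (\<lambda>x. c * g (k *\<^sub>R (x - m))) = (\<lambda>x. c * k ^ length \<alpha> * partials \<alpha> g (k *\<^sub>R (x - m)))"
proof (induction \<alpha>)
  case (Cons i \<alpha>)
  show ?case unfolding partials_Cons Cons dir_deriv_scale(1)[OF smooth_partials[OF assms]] by (simp add: mult_ac)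
qed simp

lemma partials_sum:
  assumes "\<And>i. i \<in> I \<Longrightarrow> smooth (g i)"
  shows "partials \<alpha> (\<lambda>x. \<Sum>i\<in>I. g i x) = (\<lambda>x. \<Sum>i\<in>I. partials \<alpha> (g i) x)"
  using assms
proof (induction I rule: infinite_finite_induct)
  case (insert i I)
  have a: "partials \<alpha> (\<lambda>x. f x + h x) = (\<lambda>x. partials \<alpha> f x + partials \<alpha> h x)" if "smooth f" "smooth h" for f h
    using that by (induction \<alpha>) (auto simp: dir_deriv_add smooth_dble smooth_partials)
  show ?case using insert a[of "g i" "\<lambda>x. \<Sum>i\<in>I. g i x"] by (simp add: smooth_sum)
next
  case empty then show ?case by (induction \<alpha>) auto
next
  case (infinite I) then show ?case by (induction \<alpha>) auto
qed

text \<open>The constant precedes the coefficients, centres and radii. Directions such as the normal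
  of an edge enter only through the coefficients \<open>c\<close>, so one \<open>M\<close> serves
  all edges of all meshes.\<close>

lemma scaled_family_bound:
  assumes I: "finite I" "I \<noteq> {}" and t: "\<And>i. i \<in> I \<Longrightarrow> \<Theta> i \<in> test_functions UNIV"
  shows "\<exists>M>0. \<forall>c A m r \<alpha> x. (\<forall>i\<in>I. \<bar>c i\<bar> \<le> A) \<and> 0 < r \<and> length \<alpha> \<le> 3 \<longrightarrow>
    \<bar>partials \<alpha> (\<lambda>x. \<Sum>i\<in>I. c i * \<Theta> i ((1 / r) *\<^sub>R (x - m))) x\<bar> \<le> M * A / r ^ length \<alpha>"
proof -
  have "\<exists>M>0. \<forall>x. \<bar>partials \<alpha> (\<Theta> i) x\<bar> \<le> M" if "i \<in> I" for i \<alpha>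
    using test_functions_bounded[OF test_functions_partials[OF t[OF that]]] by metis
  then obtain B where B: "\<And>i \<alpha>. i \<in> I \<Longrightarrow> B i \<alpha> > 0 \<and> (\<forall>x. \<bar>partials \<alpha> (\<Theta> i) x\<bar> \<le> B i \<alpha>)" by metis
  define L where "L = {\<alpha> :: 2 list. length \<alpha> \<le> 3}"
  have L: "finite L" using finite_lists_length_le[of "UNIV :: 2 set" 3] by (simp add: L_def)
  define M where "M = 1 + (\<Sum>i\<in>I. \<Sum>\<alpha>\<in>L. B i \<alpha>)"
  have M: "M > 0" unfolding M_def using B by (intro add_pos_nonneg sum_nonneg) (auto intro: less_imp_le)
  show ?thesis
  proof (intro exI[of _ M] conjI M allI impI)
    fix c :: "'a \<Rightarrow> real" and A r :: real and m x and \<alpha> :: "2 list"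
    assume "(\<forall>i\<in>I. \<bar>c i\<bar> \<le> A) \<and> 0 < r \<and> length \<alpha> \<le> 3"
    then have c: "\<And>i. i \<in> I \<Longrightarrow> \<bar>c i\<bar> \<le> A" and r: "0 < r" and l: "length \<alpha> \<le> 3" by auto
    have sm: "i \<in> I \<Longrightarrow> smooth (\<Theta> i)" for i using t test_functions_smooth by blast
    show "\<bar>partials \<alpha> (\<lambda>x. \<Sum>i\<in>I. c i * \<Theta> i ((1 / r) *\<^sub>R (x - m))) x\<bar> \<le> M * A / r ^ length \<alpha>"
    proof -
      have A: "0 \<le> A" using c I(2) by (meson abs_ge_zero all_not_in_conv order_trans)
      have "\<bar>partials \<alpha> (\<lambda>x. \<Sum>i\<in>I. c i * \<Theta> i ((1 / r) *\<^sub>R (x - m))) x\<bar>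
        = \<bar>\<Sum>i\<in>I. c i * (1 / r) ^ length \<alpha> * partials \<alpha> (\<Theta> i) ((1 / r) *\<^sub>R (x - m))\<bar>"
        by (subst partials_sum[OF smooth_scale[OF sm]]) (simp_all add: partials_scale[OF sm])
      also have "\<dots> \<le> (\<Sum>i\<in>I. A * (1 / r) ^ length \<alpha> * (\<Sum>\<alpha>\<in>L. B i \<alpha>))"
      proof (intro order_trans[OF sum_abs] sum_mono)
        fix i assume i: "i \<in> I"
        have "\<bar>partials \<alpha> (\<Theta> i) ((1 / r) *\<^sub>R (x - m))\<bar> \<le> B i \<alpha>" using B[OF i] by blast
        also have "\<dots> \<le> (\<Sum>\<alpha>\<in>L. B i \<alpha>)"
          using B[OF i] L l by (intro member_le_sum) (auto simp: L_def intro: less_imp_le)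
        finally have "\<bar>c i\<bar> * (1 / r) ^ length \<alpha> * \<bar>partials \<alpha> (\<Theta> i) ((1 / r) *\<^sub>R (x - m))\<bar>
           \<le> A * (1 / r) ^ length \<alpha> * (\<Sum>\<alpha>\<in>L. B i \<alpha>)"
          using c[OF i] r A by (intro mult_mono) auto
        then show "\<bar>c i * (1 / r) ^ length \<alpha> * partials \<alpha> (\<Theta> i) ((1 / r) *\<^sub>R (x - m))\<bar>
           \<le> A * (1 / r) ^ length \<alpha> * (\<Sum>\<alpha>\<in>L. B i \<alpha>)"
          using r by (simp add: abs_mult power_abs)
      qed
      also have "\<dots> = (A * (1 / r) ^ length \<alpha>) * (M - 1)" by (simp add: M_def sum_distrib_left)
      also have "\<dots> \<le> (A * (1 / r) ^ length \<alpha>) * M" using A r by (intro mult_left_mono) auto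
      finally show ?thesis by (simp add: power_one_over mult_ac)
    qed
  qed
qed

section \<open>The radial bump, its dilates and its translates\<close>

definition bump :: "plane \<Rightarrow> real" where "bump y = cutoff 1 0 (1 - y \<bullet> y)"

lemma smooth_bump: "smooth bump"
proof -
  have "smooth (\<lambda>y. cutoff 1 0 (1 - (y$1 * y$1 + y$2 * y$2)))"
    by (intro smooth_cutoff smooth_diff smooth_add smooth_mult smooth_nth smooth_const) simp
  also have "(\<lambda>y. cutoff 1 0 (1 - (y$1 * y$1 + y$2 * y$2))) = bump"
    by (simp add: fun_eq_iff bump_def inner_vec_def sum_2)
  finally show ?thesis .
qed

lemma bump_outside: "y \<notin> cball 0 1 \<Longrightarrow> bump y = 0"
  by (auto simp: bump_def cutoff_def dot_square_norm power_less_one_iff)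

lemma bump_test: "bump \<in> test_functions UNIV"
  unfolding test_functions_iff using smooth_bump bump_outside compact_cball by blast

lemma bump_nonneg: "0 \<le> bump y"
  by (simp add: bump_def cutoff_def)

lemma bump_ge: assumes "norm y \<le> 1 / 2" shows "exp (- 2) \<le> bump y"
proof -
  have "norm y ^ 2 \<le> (1/2) ^ 2" using assms by (intro power_mono) auto
  then have u: "1 - y \<bullet> y \<ge> 3 / 4" by (simp add: dot_square_norm power2_eq_square)
  then have "1 / (1 - y \<bullet> y) \<le> 2" by (simp add: field_simps)
  then show ?thesis using u by (simp add: bump_def cutoff_def)
qed

text \<open>The bump depends on \<open>y \<bullet> y\<close> alone, so its gradient at
  \<open>y\<close> is a multiple of \<open>y\<close>.\<close>

lemma bump_dir_deriv: "\<exists>k. dir_deriv d bump y = k * (d \<bullet> y)"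
proof -
  have 1: "((\<lambda>y :: plane. 1 - y \<bullet> y) has_derivative (\<lambda>d. - (2 * (d \<bullet> y)))) (at y)"
    by (auto intro!: derivative_eq_intros simp: inner_commute)
  obtain k where "((\<lambda>y. cutoff 1 0 (1 - y \<bullet> y)) has_derivative (\<lambda>d. k * (- (2 * (d \<bullet> y))))) (at y)"
    using has_derivative_compose[OF 1 cutoff_deriv[of 1 0 "1 - y \<bullet> y", unfolded has_field_derivative_def]] by auto
  then have "dir_deriv d bump y = k * (- (2 * (d \<bullet> y)))" unfolding bump_def[abs_def] by (rule dir_derivI)
  then show ?thesis by (metis mult.assoc mult_minus_left mult_minus_right)
qed

definition sbump :: "plane \<Rightarrow> real \<Rightarrow> plane \<Rightarrow> real" where
  "sbump m r x = bump ((1 / r) *\<^sub>R (x - m))"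

lemma smooth_sbump: "smooth (sbump m r)"
  using smooth_scale[OF smooth_bump, of 1 "1 / r" m] by (simp add: sbump_def[abs_def])

lemma norm_scaled: "0 < r \<Longrightarrow> norm ((1 / r) *\<^sub>R x :: plane) = norm x / r"
  unfolding norm_scaleR by simp

lemma sbump_outside: assumes "0 < r" "x \<notin> cball m r" shows "sbump m r x = 0"
proof -
  have "r < norm (x - m)" using assms(2) by (simp add: dist_norm norm_minus_commute)
  then show ?thesis
    unfolding sbump_def using assms(1)
    by (intro bump_outside) (simp only: mem_cball dist_0_norm norm_scaled, simp add: field_simps)
qed

lemma sbump_test: "0 < r \<Longrightarrow> cball m r \<subseteq> U \<Longrightarrow> sbump m r \<in> test_functions U"
  unfolding test_functions_iff by (auto intro!: smooth_sbump exI[of _ "cball m r"] sbump_outside simp del: mem_cball)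

lemma sbump_nonneg: "0 \<le> sbump m r x"
  by (simp add: sbump_def bump_nonneg)

lemma sbump_ge: "0 < r \<Longrightarrow> norm (x - m) \<le> r / 2 \<Longrightarrow> exp (- 2) \<le> sbump m r x"
  unfolding sbump_def by (rule bump_ge) (simp only: norm_scaled, simp add: field_simps)

text \<open>Applied with the normal of an edge, this says that a bump centred on the edge has no
  normal derivative along it.\<close>

lemma sbump_dir_deriv_normal:
  assumes "d \<bullet> (x - m) = 0" shows "dir_deriv d (sbump m r) x = 0"
proof -
  have "dir_deriv d (sbump m r) x = 1 * (1 / r) * dir_deriv d bump ((1 / r) *\<^sub>R (x - m))"
    using dir_deriv_scale(1)[OF smooth_bump, of d 1 "1 / r" m] by (simp add: sbump_def[abs_def])
  then show ?thesis using bump_dir_deriv[of d "(1 / r) *\<^sub>R (x - m)"] assms by auto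
qed

lemma sbump_bound_0:
  obtains M where "M > 0"
    "\<And>m r \<alpha> x. 0 < r \<Longrightarrow> length \<alpha> \<le> 3 \<Longrightarrow> \<bar>partials \<alpha> (sbump m r) x\<bar> \<le> M / r ^ length \<alpha>"
proof -
  obtain M where M: "M > 0" "\<forall>c A m r \<alpha> x. (\<forall>i\<in>{()}. \<bar>c i\<bar> \<le> A) \<and> 0 < r \<and> length \<alpha> \<le> 3 \<longrightarrow>
    \<bar>partials \<alpha> (\<lambda>x. \<Sum>i\<in>{()}. c i * bump ((1 / r) *\<^sub>R (x - m))) x\<bar> \<le> M * A / r ^ length \<alpha>"
    using scaled_family_bound[of "{()}" "\<lambda>_. bump", OF _ _ bump_test] by auto
  show ?thesis
    by (rule that[OF M(1)]) (use M(2)[rule_format, of "\<lambda>_. 1" 1] in \<open>simp add: sbump_def[abs_def]\<close>)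
qed

lemma unit_nth: "norm (a :: plane) = 1 \<Longrightarrow> \<bar>a $ i\<bar> \<le> 1"
  using component_le_norm_cart[of a i] by simp

lemma inner_scaled: "0 < r \<Longrightarrow> (a :: plane) \<bullet> (x - m) = (\<Sum>i\<in>UNIV. (r * a $ i) * ((1 / r) *\<^sub>R (x - m)) $ i)"
  by (simp add: inner_vec_def sum_2)

text \<open>The linear factor is a combination of the two scaled coordinates with coefficients
  \<open>r * a $ i\<close>, each at most \<open>r\<close> in absolute value; the fixed family
  consists of the bump times a coordinate.\<close>

lemma sbump_bound_1:
  obtains M where "M > 0"
    "\<And>a m r \<alpha> x. norm a = 1 \<Longrightarrow> 0 < r \<Longrightarrow> length \<alpha> \<le> 3 \<Longrightarrow>
      \<bar>partials \<alpha> (\<lambda>x. (a \<bullet> (x - m)) * sbump m r x) x\<bar> \<le> M * r / r ^ length \<alpha>"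
proof -
  obtain M where M: "M > 0" "\<forall>c A m r \<alpha> x. (\<forall>i\<in>UNIV. \<bar>c i\<bar> \<le> A) \<and> 0 < r \<and> length \<alpha> \<le> 3 \<longrightarrow>
    \<bar>partials \<alpha> (\<lambda>x. \<Sum>i::2\<in>UNIV. c i * (\<lambda>y. y $ i * bump y) ((1 / r) *\<^sub>R (x - m))) x\<bar> \<le> M * A / r ^ length \<alpha>"
    using scaled_family_bound[of "UNIV :: 2 set" "\<lambda>i y. y $ i * bump y",
        OF finite UNIV_not_empty test_functions_mult[OF smooth_nth bump_test]] by blast
  show ?thesis
  proof (rule that[OF M(1)])
    fix a m x :: plane and r :: real and \<alpha> :: "2 list"
    assume a: "norm a = 1" "0 < r" "length \<alpha> \<le> 3"
    have e: "(\<lambda>x. (a \<bullet> (x - m)) * sbump m r x) = (\<lambda>x. \<Sum>i\<in>UNIV. (r * a $ i) * (\<lambda>y. y $ i * bump y) ((1 / r) *\<^sub>R (x - m)))"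
      unfolding inner_scaled[OF a(2)] sbump_def sum_distrib_right by (simp only: mult.assoc)
    have c: "\<bar>r * a $ i\<bar> \<le> r" for i
      using unit_nth[OF a(1), of i] a(2) by (simp add: abs_mult)
    show "\<bar>partials \<alpha> (\<lambda>x. (a \<bullet> (x - m)) * sbump m r x) x\<bar> \<le> M * r / r ^ length \<alpha>"
      unfolding e by (rule M(2)[rule_format, of "\<lambda>i. r * a $ i" r r \<alpha> m x]) (use c a(2,3) in blast)
  qed
qed

text \<open>Two linear factors give four fixed functions, the bump times a product of coordinates,
  with coefficients of size at most \<open>r\<^sup>2\<close>.\<close>

lemma sbump_bound_2:
  obtains M where "M > 0"
    "\<And>a b m r \<alpha> x. norm a = 1 \<Longrightarrow> norm b = 1 \<Longrightarrow> 0 < r \<Longrightarrow> length \<alpha> \<le> 3 \<Longrightarrow>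
      \<bar>partials \<alpha> (\<lambda>x. (a \<bullet> (x - m)) * ((b \<bullet> (x - m)) * sbump m r x)) x\<bar> \<le> M * r\<^sup>2 / r ^ length \<alpha>"
proof -
  obtain M where M: "M > 0" "\<forall>c A m r \<alpha> x. (\<forall>i\<in>UNIV. \<bar>c i\<bar> \<le> A) \<and> 0 < r \<and> length \<alpha> \<le> 3 \<longrightarrow>
    \<bar>partials \<alpha> (\<lambda>x. \<Sum>i::2\<times>2\<in>UNIV. c i * (\<lambda>y. y $ fst i * (y $ snd i * bump y)) ((1 / r) *\<^sub>R (x - m))) x\<bar> \<le> M * A / r ^ length \<alpha>"
    using scaled_family_bound[of "UNIV :: (2\<times>2) set" "\<lambda>i y. y $ fst i * (y $ snd i * bump y)",
        OF finite UNIV_not_empty test_functions_mult[OF smooth_nth test_functions_mult[OF smooth_nth bump_test]]]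
    by blast
  show ?thesis
  proof (rule that[OF M(1)])
    fix a b m x :: plane and r :: real and \<alpha> :: "2 list"
    assume a: "norm a = 1" "norm b = 1" "0 < r" "length \<alpha> \<le> 3"
    have e: "(\<lambda>x. (a \<bullet> (x - m)) * ((b \<bullet> (x - m)) * sbump m r x))
      = (\<lambda>x. \<Sum>i\<in>UNIV. (r\<^sup>2 * (a $ fst i * b $ snd i)) * (\<lambda>y. y $ fst i * (y $ snd i * bump y)) ((1 / r) *\<^sub>R (x - m)))"
    proof
      fix x
      define y where "y = (1 / r) *\<^sub>R (x - m)"
      have pairs: "(\<Sum>p\<in>UNIV. h p) = (\<Sum>i\<in>UNIV. \<Sum>j\<in>UNIV. h (i, j))" for h :: "2 \<times> 2 \<Rightarrow> real"
        by (simp add: sum.cartesian_product)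
      show "(a \<bullet> (x - m)) * ((b \<bullet> (x - m)) * sbump m r x)
        = (\<Sum>i\<in>UNIV. (r\<^sup>2 * (a $ fst i * b $ snd i)) * (\<lambda>y. y $ fst i * (y $ snd i * bump y)) ((1 / r) *\<^sub>R (x - m)))"
        unfolding inner_scaled[OF a(3)] sbump_def pairs y_def[symmetric]
        by (simp add: sum_2 power2_eq_square algebra_simps)
    qed
    have c: "\<bar>r\<^sup>2 * (a $ fst i * b $ snd i)\<bar> \<le> r\<^sup>2" for i
    proof -
      have "\<bar>a $ fst i\<bar> * \<bar>b $ snd i\<bar> \<le> 1 * 1"
        using unit_nth[OF a(1)] unit_nth[OF a(2)] by (intro mult_mono) auto
      then have "r\<^sup>2 * (\<bar>a $ fst i\<bar> * \<bar>b $ snd i\<bar>) \<le> r\<^sup>2 * 1" by (intro mult_left_mono) auto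
      then show ?thesis by (simp add: abs_mult)
    qed
    show "\<bar>partials \<alpha> (\<lambda>x. (a \<bullet> (x - m)) * ((b \<bullet> (x - m)) * sbump m r x)) x\<bar> \<le> M * r\<^sup>2 / r ^ length \<alpha>"
      unfolding e
      by (rule M(2)[rule_format, of "\<lambda>i. r\<^sup>2 * (a $ fst i * b $ snd i)" "r\<^sup>2" r \<alpha> m x]) (use c a(3,4) in blast)
  qed
qed

section \<open>Lower bounds for moments of the bump\<close>

lemma integral_ge_on:
  fixes g :: "'a::euclidean_space \<Rightarrow> real"
  assumes "integrable lborel g" "\<And>x. 0 \<le> g x" "\<And>x. x \<in> S \<Longrightarrow> c \<le> g x" "S \<in> sets borel" "bounded S"
  shows "c * measure lborel S \<le> integral\<^sup>L lborel g"
proof -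
  have i: "integrable lborel (\<lambda>x. c * indicator S x)"
    using emeasure_bounded_finite[OF assms(5)] assms(4)
    by (intro integrable_mult_right) (simp add: integrable_indicator_iff)
  have "(\<integral>x. c * indicator S x \<partial>lborel) \<le> integral\<^sup>L lborel g"
    by (rule integral_mono[OF i assms(1)]) (use assms(2,3) in \<open>auto simp: indicator_def\<close>)
  then show ?thesis using assms(4) by simp
qed

lemma sbump_integral_ge:
  assumes r: "0 < r" shows "exp (- 2) * (r\<^sup>2 / 2) \<le> (\<integral>x. sbump m r x \<partial>lborel)"
proof -
  have "exp (- 2) * measure lborel (cball m (r / 2)) \<le> (\<integral>x. sbump m r x \<partial>lborel)"
    by (rule integral_ge_on) (use r in \<open>auto intro!: test_functions_integrable[OF sbump_test] sbump_nonneg sbump_ge simp: dist_norm norm_minus_commute\<close>)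
  moreover have "measure lborel (cball m (r / 2)) = pi * (r / 2)\<^sup>2"
    using r by (simp add: content_cball unit_ball_vol_2)
  moreover have "exp (- 2) * (r\<^sup>2 / 2) \<le> exp (- 2) * (pi * (r / 2)\<^sup>2)"
  proof (intro mult_left_mono)
    have "2 * (r / 2)\<^sup>2 \<le> pi * (r / 2)\<^sup>2" using pi_gt3 by (intro mult_right_mono) auto
    then show "r\<^sup>2 / 2 \<le> pi * (r / 2)\<^sup>2" by (simp add: power_divide)
  qed simp
  ultimately show ?thesis by (simp only:)
qed

lemma sbump_line_integrals:
  assumes r: "0 < r" and n: "norm n = 1"
  shows "exp (- 2) * r \<le> (\<integral>t. sbump m r (m + t *\<^sub>R perp n) \<partial>lborel)"
    and "exp (- 2) * (r ^ 3 / 64) \<le> (\<integral>t. t\<^sup>2 * sbump m r (m + t *\<^sub>R perp n) \<partial>lborel)"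
    and "(\<integral>t. t * sbump m r (m + t *\<^sub>R perp n) \<partial>lborel) = 0"
    and "integrable lborel (\<lambda>t. sbump m r (m + t *\<^sub>R perp n))"
    and "integrable lborel (\<lambda>t. t * sbump m r (m + t *\<^sub>R perp n))"
    and "integrable lborel (\<lambda>t. t\<^sup>2 * sbump m r (m + t *\<^sub>R perp n))"
proof -
  have t: "sbump m r \<in> test_functions UNIV" by (rule sbump_test[OF r]) simp
  have p1: "perp n \<bullet> (m + t *\<^sub>R perp n - m) = t" for t
    using n by (simp add: norm_eq_1[symmetric])
  have ge: "exp (- 2) \<le> sbump m r (m + t *\<^sub>R perp n)" if "\<bar>t\<bar> \<le> r / 2" for t
    using that n by (intro sbump_ge[OF r]) simp
  show i0: "integrable lborel (\<lambda>t. sbump m r (m + t *\<^sub>R perp n))"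
    by (rule test_functions_integrable_line[OF t n])
  show "integrable lborel (\<lambda>t. t * sbump m r (m + t *\<^sub>R perp n))"
    using test_functions_integrable_line[OF test_functions_mult[OF smooth_inner[of "perp n" m] t] n, of m] unfolding p1 .
  show i2: "integrable lborel (\<lambda>t. t\<^sup>2 * sbump m r (m + t *\<^sub>R perp n))"
    using test_functions_integrable_line[OF test_functions_mult[OF smooth_power[OF smooth_inner[of "perp n" m], of 2] t] n, of m] unfolding p1 .
  have "exp (- 2) * measure lborel {- (r/2)..r/2} \<le> (\<integral>t. sbump m r (m + t *\<^sub>R perp n) \<partial>lborel)"
    by (rule integral_ge_on[OF i0]) (auto intro!: sbump_nonneg ge)
  then show "exp (- 2) * r \<le> (\<integral>t. sbump m r (m + t *\<^sub>R perp n) \<partial>lborel)" using r by simp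
  \<comment> \<open>Half of the support of \<open>t\<close> near 0 is given up: on
    \<open>{r/4..r/2}\<close>, of length \<open>r / 4\<close>, the factor \<open>t\<^sup>2\<close>
    is at least \<open>r\<^sup>2 / 16\<close>, and the product is \<open>r ^ 3 / 64\<close>.\<close>
  have "(r / 4)\<^sup>2 * exp (- 2) * measure lborel {r/4..r/2} \<le> (\<integral>t. t\<^sup>2 * sbump m r (m + t *\<^sub>R perp n) \<partial>lborel)"
  proof (rule integral_ge_on[OF i2])
    fix x :: real assume "x \<in> {r/4..r/2}"
    then show "(r / 4)\<^sup>2 * exp (- 2) \<le> x\<^sup>2 * sbump m r (m + x *\<^sub>R perp n)"
      using r by (intro mult_mono power_mono ge) auto
  qed (auto intro: mult_nonneg_nonneg sbump_nonneg)
  then show "exp (- 2) * (r ^ 3 / 64) \<le> (\<integral>t. t\<^sup>2 * sbump m r (m + t *\<^sub>R perp n) \<partial>lborel)"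
    using r by (simp add: power2_eq_square power3_eq_cube field_simps)
  \<comment> \<open>The bump is even along the line, so the first moment changes sign under the
    reflection of \<open>t\<close>.\<close>
  have sym: "sbump m r (m + (- t) *\<^sub>R perp n) = sbump m r (m + t *\<^sub>R perp n)" for t
    by (simp add: sbump_def bump_def)
  have "(\<integral>t. t * sbump m r (m + t *\<^sub>R perp n) \<partial>lborel) = (\<integral>t. - (t * sbump m r (m + t *\<^sub>R perp n)) \<partial>lborel)"
    by (subst lborel_integral_real_affine[of "-1" _ 0]) (use sym in auto)
  then show "(\<integral>t. t * sbump m r (m + t *\<^sub>R perp n) \<partial>lborel) = 0" by simp
qed

subsection \<open>Geometry of the triangulation\<close>

text \<open>The proof computes barycentric coordinates of \<open>x\<close>. The height above the
  edge gives the weight \<open>w\<close> of \<open>c\<close>, the displacement along the edge gives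
  \<open>q\<close>, and the weights are nonnegative because \<open>w\<close> is at most 1/8 and
  \<open>q\<close> at most 1/4 in absolute value.\<close>

lemma half_disc_in_triangle:
  fixes a b c n z x :: plane
  assumes n: "norm n = 1" "n \<bullet> (b - a) = 0" "n \<bullet> (c - a) < 0" and ab: "a \<noteq> b"
    and K: "K = convex hull {a, b, c}" and z: "cball z \<rho> \<subseteq> K" and \<rho>: "0 < \<rho>"
    and h: "diameter K \<le> h" and r: "2 * r * h \<le> \<rho>\<^sup>2"
    and x: "dist (midpoint a b) x \<le> r" "n \<bullet> (x - midpoint a b) \<le> 0"
  shows "x \<in> K" "2 * \<rho> \<le> dist a b"
proof -
  define m where "m = midpoint a b"
  have m2: "m = (1/2) *\<^sub>R a + (1/2) *\<^sub>R b" by (simp add: m_def midpoint_def scaleR_add_right)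
  define H where "H = - (n \<bullet> (c - a))"
  have H: "H > 0" using n by (simp add: H_def)
  have nb: "n \<bullet> b = n \<bullet> a" using n(2) by (simp add: inner_diff_right)
  have nc: "n \<bullet> c = n \<bullet> a - H" by (simp add: H_def inner_diff_right)
  have hull: "\<exists>u v w. 0 \<le> u \<and> 0 \<le> v \<and> 0 \<le> w \<and> u + v + w = 1 \<and> y = u *\<^sub>R a + v *\<^sub>R b + w *\<^sub>R c"
    if "y \<in> K" for y using that unfolding K convex_hull_3 by auto
  have height: "n \<bullet> (u *\<^sub>R a + v *\<^sub>R b + w *\<^sub>R c) = n \<bullet> a - w * H" if "u + v + w = 1" for u v w :: real
  proof -
    have "n \<bullet> (u *\<^sub>R a + v *\<^sub>R b + w *\<^sub>R c) = (u + v + w) * (n \<bullet> a) - w * H"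
      by (simp add: inner_add_right nb nc algebra_simps)
    then show ?thesis using that by simp
  qed
  have nn: "n \<bullet> n = 1" using n(1) by (simp add: norm_eq_1)
  \<comment> \<open>The inscribed disc has a diameter in direction \<open>n\<close>, so the height
    of the triangle is at least \<open>2 * \<rho>\<close>.\<close>
  have H2: "2 * \<rho> \<le> H"
  proof -
    have "z + \<rho> *\<^sub>R n \<in> K" "z - \<rho> *\<^sub>R n \<in> K"
      using z \<rho> n(1) by (auto simp: subset_iff dist_norm)
    then obtain u v w u' v' w' where
      1: "0 \<le> u" "0 \<le> v" "0 \<le> w" "u + v + w = 1" "z + \<rho> *\<^sub>R n = u *\<^sub>R a + v *\<^sub>R b + w *\<^sub>R c" and
      2: "0 \<le> u'" "0 \<le> v'" "0 \<le> w'" "u' + v' + w' = 1" "z - \<rho> *\<^sub>R n = u' *\<^sub>R a + v' *\<^sub>R b + w' *\<^sub>R c"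
      using hull by meson
    have "n \<bullet> (z + \<rho> *\<^sub>R n) = n \<bullet> a - w * H" "n \<bullet> (z - \<rho> *\<^sub>R n) = n \<bullet> a - w' * H"
      using height 1 2 by auto
    then have "2 * \<rho> = (w' - w) * H" using nn by (simp add: inner_add_right inner_diff_right algebra_simps)
    moreover have "(w' - w) * H \<le> 1 * H" using 1 2 H by (intro mult_right_mono) auto
    ultimately show ?thesis by simp
  qed
  define l where "l = dist a b"
  have l0: "l > 0" using ab by (simp add: l_def)
  define t where "t = (1/l) *\<^sub>R (b - a)"
  have nt: "n \<bullet> t = 0" "norm t = 1" using n l0 by (auto simp: t_def l_def dist_norm norm_minus_commute)
  \<comment> \<open>The diameter parallel to the edge has end points of equal height, hence equal
    weights at \<open>c\<close>; their difference is a multiple of \<open>b - a\<close> with factor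
    at most 1 in absolute value.\<close>
  show l2: "2 * \<rho> \<le> dist a b"
  proof -
    have "z + \<rho> *\<^sub>R t \<in> K" "z - \<rho> *\<^sub>R t \<in> K"
      using z \<rho> nt by (auto simp: subset_iff dist_norm)
    then obtain u v w u' v' w' where
      1: "0 \<le> u" "0 \<le> v" "0 \<le> w" "u + v + w = 1" "z + \<rho> *\<^sub>R t = u *\<^sub>R a + v *\<^sub>R b + w *\<^sub>R c" and
      2: "0 \<le> u'" "0 \<le> v'" "0 \<le> w'" "u' + v' + w' = 1" "z - \<rho> *\<^sub>R t = u' *\<^sub>R a + v' *\<^sub>R b + w' *\<^sub>R c"
      using hull by meson
    have "n \<bullet> (z + \<rho> *\<^sub>R t) = n \<bullet> a - w * H" "n \<bullet> (z - \<rho> *\<^sub>R t) = n \<bullet> a - w' * H"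
      using height 1 2 by auto
    then have "w' * H = w * H" using nt by (simp only: inner_add_right inner_diff_right) auto
    then have w: "w' = w" using H by simp
    have "(2 * \<rho>) *\<^sub>R t = (z + \<rho> *\<^sub>R t) - (z - \<rho> *\<^sub>R t)" by (simp add: scaleR_2 flip: scaleR_scaleR)
    also have "\<dots> = (u - u') *\<^sub>R a + (v - v') *\<^sub>R b"
      unfolding 1 2 w by (simp add: algebra_simps)
    also have "u - u' = - (v - v')" using 1 2 w by simp
    also have "- (v - v') *\<^sub>R a + (v - v') *\<^sub>R b = (v - v') *\<^sub>R (b - a)" by (simp add: algebra_simps)
    finally have "norm ((2 * \<rho>) *\<^sub>R t) = norm ((v - v') *\<^sub>R (b - a))" by simp
    then have "2 * \<rho> = \<bar>v - v'\<bar> * l" using \<rho> nt by (simp add: l_def dist_norm norm_minus_commute)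
    moreover have "\<bar>v - v'\<bar> * l \<le> 1 * l" using 1 2 l0 by (intro mult_right_mono) auto
    ultimately show ?thesis by (simp add: l_def)
  qed
  \<comment> \<open>The height of \<open>x\<close> relative to the height \<open>H\<close> of the
    apex: the weight that \<open>c\<close> must get.\<close>
  define w where "w = - (n \<bullet> (x - m)) / H"
  have r0: "0 \<le> r" using x(1) zero_le_dist order_trans by blast
  have w0: "0 \<le> w" using x(2) H by (simp add: w_def m_def field_simps)
  have "\<bar>n \<bullet> (x - m)\<bar> \<le> r"
    using Cauchy_Schwarz_ineq2[of n "x - m"] n x(1) by (simp add: dist_norm norm_minus_commute m_def)
  then have wr: "w * H \<le> r" using H by (simp add: w_def)
  then have wr2: "w * (2 * \<rho>) \<le> r" using mult_left_mono[OF H2 w0] by linarith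
  have sub: "bounded K" unfolding K by (simp add: bounded_convex_hull)
  have cm: "norm (c - m) \<le> h"
  proof -
    have "c \<in> K" unfolding K by (simp add: hull_inc)
    moreover have "m \<in> K" unfolding K m_def
      using midpoint_in_closed_segment[of a b] hull_mono[of "{a, b}" "{a, b, c}" convex]
      by (auto simp: segment_convex_hull)
    ultimately show ?thesis using diameter_bounded_bound[OF sub] h by (metis dist_norm order_trans)
  qed
  \<comment> \<open>What remains after moving from the midpoint towards \<open>c\<close> is parallel
    to the edge.\<close>
  define y where "y = x - m - w *\<^sub>R (c - m)"
  have "n \<bullet> m = n \<bullet> a" unfolding m2 by (simp add: inner_add_right nb)
  moreover have "w * H = n \<bullet> m - n \<bullet> x" using H by (simp add: w_def inner_diff_right)
  ultimately have ny: "n \<bullet> y = 0"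
    unfolding y_def inner_diff_right inner_scaleR_right nc by (simp add: algebra_simps)
  define v where "v = (y \<bullet> t)"
  have y: "y = v *\<^sub>R t"
  proof -
    have e: "n$1 * n$1 + n$2 * n$2 = 1" "t$1 * t$1 + t$2 * t$2 = 1" "n$1 * t$1 + n$2 * t$2 = 0" "n$1 * y$1 + n$2 * y$2 = 0"
      using nn nt ny by (auto simp: inner_vec_def sum_2 norm_eq_1)
    have "y$1 = (y$1 * t$1 + y$2 * t$2) * t$1" "y$2 = (y$1 * t$1 + y$2 * t$2) * t$2"
      using e by algebra+
    then show ?thesis by (simp add: v_def vec_eq_iff forall_2 inner_vec_def sum_2)
  qed
  have "\<bar>v\<bar> = norm y" using y nt by simp
  also have "\<dots> \<le> r + w * h"
  proof -
    have "norm y \<le> norm (x - m) + norm (w *\<^sub>R (c - m))" unfolding y_def by (rule norm_triangle_ineq4)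
    also have "norm (x - m) \<le> r" using x(1) by (simp add: dist_norm norm_minus_commute m_def)
    also have "norm (w *\<^sub>R (c - m)) \<le> w * h" using cm w0 by (simp add: mult_left_mono)
    finally show ?thesis by simp
  qed
  finally have vb: "\<bar>v\<bar> \<le> r + w * h" .
  have h2: "2 * \<rho> \<le> h"
  proof -
    have "diameter (cball z \<rho>) \<le> diameter K" by (rule diameter_subset[OF z sub])
    then show ?thesis using h \<rho> by simp
  qed
  \<comment> \<open>Since \<open>2 * \<rho> \<le> h\<close>, the hypothesis on \<open>r\<close>
    gives both \<open>4 * r \<le> \<rho>\<close> and \<open>4 * w * h \<le> \<rho>\<close>. So the
    displacement along the edge is at most \<open>\<rho> / 2\<close>, a quarter of the edge
    length.\<close>
  have r1: "2 * r * (2 * \<rho>) \<le> \<rho>\<^sup>2" using mult_left_mono[OF h2, of "2 * r"] r0 r by linarith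
  then have r2: "4 * r \<le> \<rho>" using \<rho> by (simp add: power2_eq_square)
  have "\<rho> * (8 * w) \<le> \<rho> * 1" using wr2 r2 by (simp add: mult_ac)
  then have w8: "8 * w \<le> 1" using \<rho> by (simp only: mult_le_cancel_left_pos)
  have wh: "4 * w * h \<le> \<rho>"
  proof -
    have "(w * (2 * \<rho>)) * (2 * h) \<le> r * (2 * h)" using wr2 h2 \<rho> by (intro mult_right_mono) auto
    then have "(4 * w * h) * \<rho> \<le> \<rho> * \<rho>" using r by (simp add: power2_eq_square mult_ac)
    then show ?thesis using \<rho> by simp
  qed
  have "\<bar>v\<bar> \<le> \<rho> / 2" using vb r2 wh by linarith
  also have "\<dots> \<le> l / 4" using l2 by (simp add: l_def)
  finally have vl: "\<bar>v / l\<bar> \<le> 1/4" using l0 by (simp add: field_simps)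
  define q where "q = v / l"
  have "y = q *\<^sub>R (b - a)" using y by (simp add: q_def t_def)
  moreover have "x = m + y + w *\<^sub>R (c - m)" by (simp add: y_def)
  ultimately have "x = m + q *\<^sub>R (b - a) + w *\<^sub>R (c - m)" by simp
  also have "\<dots> = ((1 - w)/2 - q) *\<^sub>R a + ((1 - w)/2 + q) *\<^sub>R b + w *\<^sub>R c"
    unfolding m2 vec_eq_iff vector_add_component vector_minus_component vector_scaleR_component real_scaleR_def
    by (intro allI) (simp add: field_simps)
  finally have "x = ((1 - w)/2 - q) *\<^sub>R a + ((1 - w)/2 + q) *\<^sub>R b + w *\<^sub>R c" .
  moreover have ql: "\<bar>q\<bar> \<le> 1/4" using vl by (simp add: q_def)
  moreover have "0 \<le> (1 - w)/2 - q" using abs_le_D1[OF ql] w8 by (simp add: field_simps)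
  moreover have "0 \<le> (1 - w)/2 + q" using abs_le_D2[OF ql] w8 by (simp add: field_simps)
  moreover have "(1 - w)/2 - q + ((1 - w)/2 + q) + w = 1" by (simp add: field_simps)
  ultimately show "x \<in> K" unfolding K convex_hull_3 using w0 by blast
qed

section \<open>Triangles, their edges and inscribed discs\<close>

lemma triangle_interior_nonempty:
  assumes "2 simplex (K :: plane set)" shows "interior K \<noteq> {}"
proof -
  obtain C where C: "\<not> affine_dependent C" "int (card C) = 2 + 1" "K = convex hull C"
    using assms unfolding simplex_def by blast
  then have "card C = Suc DIM(plane)" by simp
  then show ?thesis using C interior_convex_hull_eq_empty by blast
qed

lemma triangle_compact_convex:
  assumes "2 simplex (K :: plane set)" shows "compact K" "convex K"
  using assms unfolding simplex_def by (auto intro!: finite_imp_compact_convex_hull aff_independent_finite)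

text \<open>Faces of a simplex are hulls of subsets of its vertices, and dimension one forces two of
  them; the remaining vertex is \<open>c\<close>.\<close>

lemma triangle_edge:
  assumes "2 simplex (K :: plane set)" "e edge_of K"
  obtains a b c where "\<not> affine_dependent {a, b, c}" "card {a, b, c} = 3"
    "K = convex hull {a, b, c}" "e = closed_segment a b" "a \<noteq> b"
proof -
  obtain C where C: "\<not> affine_dependent C" "int (card C) = 2 + 1" "K = convex hull C"
    using assms unfolding simplex_def by blast
  have "e face_of convex hull C" "aff_dim e = 1" using assms(2) C by (auto simp: edge_of_def)
  then obtain S where S: "S \<subseteq> C" "e = convex hull S"
    using face_of_convex_hull_affine_independent[OF C(1)] by blast
  have "\<not> affine_dependent S" using C(1) S(1) affine_dependent_subset by blast
  then have "int (card S) = 2"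
    using aff_dim_affine_independent[of S] \<open>aff_dim e = 1\<close> S by (simp add: aff_dim_convex_hull)
  then obtain a b where ab: "S = {a, b}" "a \<noteq> b" by (metis card_2_iff of_nat_eq_iff of_nat_numeral)
  have "finite C" using C(1) aff_independent_finite by blast
  then have "card (C - S) = 1" using C(2) \<open>int (card S) = 2\<close> S(1) by (simp add: card_Diff_subset finite_subset)
  then obtain c where "C - S = {c}" by (auto simp: card_1_singleton_iff)
  then have "C = {a, b, c}" using ab S by auto
  then show ?thesis using that C ab S by (simp add: segment_convex_hull)
qed

text \<open>The intersection is a face of both cells, and a face that meets the interior is the
  whole cell.\<close>

lemma triangulation_interiors_disjoint:
  assumes "triangulation T" "K \<in> T" "K' \<in> T" "K \<noteq> K'"
  shows "interior K \<inter> interior K' = {}"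
proof (rule ccontr)
  assume n: "interior K \<inter> interior K' \<noteq> {}"
  have "K \<inter> K' face_of K" "K' \<inter> K face_of K'" using assms by (auto simp: triangulation_def)
  then have "K \<inter> K' = K" "K' \<inter> K = K'"
    using n interior_subset face_of_disjoint_interior by blast+
  then show False using assms by blast
qed

text \<open>Whether the supremum of inscribed diameters is attained is left open: half of it is
  exceeded by some disc, which accounts for 4 in place of 2 in the radius.\<close>

lemma inscribed_disc:
  assumes K: "2 simplex K" and g: "diameter K / incircle_diameter K \<le> \<gamma>" "1 \<le> \<gamma>"
  obtains z where "cball z (diameter K / (4 * \<gamma>)) \<subseteq> K" "diameter K > 0"
proof -
  define S where "S = {2 * r | r. 0 \<le> r \<and> (\<exists>c. cball c r \<subseteq> K)}"
  have bK: "bounded K" using triangle_compact_convex(1)[OF K] compact_imp_bounded by blast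
  have ub: "s \<le> diameter K" if s: "s \<in> S" for s
  proof -
    obtain r c where rc: "s = 2 * r" "0 \<le> r" "cball c r \<subseteq> K" using s unfolding S_def by blast
    then show ?thesis using diameter_subset[OF rc(3) bK] by (simp add: diameter_cball)
  qed
  obtain y where "y \<in> interior K" using triangle_interior_nonempty[OF K] by blast
  then obtain s where ys: "0 < s" "cball y s \<subseteq> K" unfolding mem_interior_cball by blast
  then have s: "2 * s \<in> S" by (auto simp: S_def)
  have bd: "bdd_above S" using ub by (auto simp: bdd_above_def)
  have pos: "Sup S > 0" using cSup_upper[OF s bd] ys by linarith
  have d: "diameter K > 0" using ub[OF s] ys by linarith
  have "diameter K \<le> \<gamma> * Sup S"
    using g(1) pos unfolding incircle_diameter_def S_def[symmetric] by (simp only: pos_divide_le_eq)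
  then have "diameter K / (2 * \<gamma>) \<le> Sup S / 2" using g(2) by (simp add: field_simps)
  also have "\<dots> < Sup S" using pos by simp
  finally obtain q where q: "q \<in> S" "diameter K / (2 * \<gamma>) < q"
    using less_cSupE[of _ S] s by (metis empty_iff)
  then obtain r c where rc: "q = 2 * r" "cball c r \<subseteq> K" unfolding S_def by blast
  have "cball c (diameter K / (4 * \<gamma>)) \<subseteq> cball c r"
    using q rc by (intro subset_cball) (simp add: field_simps)
  then show ?thesis using that d rc by blast
qed

lemma diameter_closed_segment: "diameter (closed_segment a b :: 'a::euclidean_space set) = dist a b"
proof (rule antisym)
  show "diameter (closed_segment a b) \<le> dist a b"
  proof (rule diameter_le)
    fix x y assume "x \<in> closed_segment a b" "y \<in> closed_segment a b"
    then obtain u v where u: "0 \<le> u" "u \<le> 1" "x = (1 - u) *\<^sub>R a + u *\<^sub>R b"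
      and v: "0 \<le> v" "v \<le> 1" "y = (1 - v) *\<^sub>R a + v *\<^sub>R b"
      unfolding in_segment by metis
    have "x - y = (v - u) *\<^sub>R (a - b)" unfolding u v by (simp add: algebra_simps)
    then have "norm (x - y) = \<bar>v - u\<bar> * dist a b" by (simp add: dist_norm)
    also have "\<dots> \<le> 1 * dist a b" using u v by (intro mult_right_mono) auto
    finally show "norm (x - y) \<le> dist a b" by simp
  qed simp
  show "dist a b \<le> diameter (closed_segment a b)"
    by (rule diameter_bounded_bound) (auto intro: compact_imp_bounded)
qed

text \<open>Shape regularity gives an inscribed disc of radius \<open>\<rho> = diameter K / (4 \<gamma>)\<close>, and the radius
  \<open>r = diameter e / (32 \<gamma>\<^sup>2)\<close> is such that \<open>2 r diameter K \<le> \<rho>\<^sup>2\<close>.\<close>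

lemma half_disc_in_cell:
  assumes K: "2 simplex K" "e edge_of K" and g: "diameter K / incircle_diameter K \<le> \<gamma>" "1 \<le> \<gamma>"
    and e: "e = closed_segment a b" and n: "norm n = 1" "n \<bullet> (b - a) = 0"
  shows "((\<forall>y\<in>K. n \<bullet> (y - midpoint a b) \<le> 0) \<and>
      (\<forall>x. dist (midpoint a b) x \<le> diameter e / (32 * \<gamma>\<^sup>2) \<longrightarrow> n \<bullet> (x - midpoint a b) \<le> 0 \<longrightarrow> x \<in> K)) \<or>
     ((\<forall>y\<in>K. n \<bullet> (y - midpoint a b) \<ge> 0) \<and>
      (\<forall>x. dist (midpoint a b) x \<le> diameter e / (32 * \<gamma>\<^sup>2) \<longrightarrow> n \<bullet> (x - midpoint a b) \<ge> 0 \<longrightarrow> x \<in> K))"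
    (is ?P) and "diameter e \<le> diameter K" "a \<noteq> b"
proof -
  obtain a' b' c where abc: "\<not> affine_dependent {a', b', c}" "card {a', b', c} = 3"
    "K = convex hull {a', b', c}" "e = closed_segment a' b'" "a' \<noteq> b'" using triangle_edge[OF K] .
  \<comment> \<open>A segment determines its end points up to order, so the given \<open>a\<close>
    and \<open>b\<close> are vertices of \<open>K\<close>.\<close>
  have seteq: "{a', b'} = {a, b}" using abc(4) e closed_segment_eq by metis
  then have ab: "\<not> affine_dependent {a, b, c}" "K = convex hull {a, b, c}"
  proof -
    have "{a', b', c} = insert c {a', b'}" by auto
    also have "\<dots> = {a, b, c}" unfolding seteq by auto
    finally show "\<not> affine_dependent {a, b, c}" "K = convex hull {a, b, c}" using abc by auto
  qed
  show "a \<noteq> b" using seteq abc(5) by auto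
  then have a_ne_b: "a \<noteq> b" .
  have bK: "bounded K" using triangle_compact_convex(1)[OF K(1)] compact_imp_bounded by blast
  show de: "diameter e \<le> diameter K"
    using diameter_subset[OF edge_of_imp_subset[OF K(2)] bK] .
  obtain z where z: "cball z (diameter K / (4 * \<gamma>)) \<subseteq> K" "diameter K > 0"
    using inscribed_disc[OF K(1) g] .
  define \<rho> where "\<rho> = diameter K / (4 * \<gamma>)"
  have \<rho>: "\<rho> > 0" using z g by (simp add: \<rho>_def)
  define r where "r = diameter e / (32 * \<gamma>\<^sup>2)"
  have r: "2 * r * diameter K \<le> \<rho>\<^sup>2"
    using de z(2) g by (simp add: r_def \<rho>_def power_divide power2_eq_square field_simps)
  \<comment> \<open>Otherwise all three vertices lie on one line and \<open>K\<close> has empty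
    interior.\<close>
  have nc: "n \<bullet> (c - a) \<noteq> 0"
  proof
    assume 0: "n \<bullet> (c - a) = 0"
    have "K \<subseteq> {x. n \<bullet> x = n \<bullet> a}"
      unfolding ab(2) using n 0
      by (intro hull_minimal) (auto simp: inner_diff_right convex_hyperplane)
    then have "interior K \<subseteq> interior {x. n \<bullet> x = n \<bullet> a}" by (rule interior_mono)
    moreover have "n \<noteq> 0" using n by auto
    ultimately show False using triangle_interior_nonempty[OF K(1)] by simp
  qed
  have side: "(\<forall>y\<in>K. n' \<bullet> (y - midpoint a b) \<le> 0) \<and>
      (\<forall>x. dist (midpoint a b) x \<le> r \<longrightarrow> n' \<bullet> (x - midpoint a b) \<le> 0 \<longrightarrow> x \<in> K)"
    if n': "n' \<bullet> (c - a) < 0" "norm n' = 1" "n' \<bullet> (b - a) = 0" for n'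
  proof -
    have mid': "n' \<bullet> midpoint a b = n' \<bullet> a"
      using n' by (simp add: midpoint_def inner_add_right inner_diff_right)
    have "K \<subseteq> {x. n' \<bullet> x \<le> n' \<bullet> a}"
      unfolding ab(2) using n'
      by (intro hull_minimal) (auto simp: inner_diff_right convex_halfspace_le)
    then show ?thesis
      using half_disc_in_triangle(1)[OF n'(2,3,1) a_ne_b ab(2) _ \<rho> order_refl r] z(1)
      by (auto simp: \<rho>_def inner_diff_right mid')
  qed
  show ?P
  proof (cases "n \<bullet> (c - a) < 0")
    case True
    show ?thesis using side[OF True n] unfolding r_def by (rule disjI1)
  next
    case False
    then have "- n \<bullet> (c - a) < 0" "norm (- n) = 1" "- n \<bullet> (b - a) = 0" using nc n by auto
    from side[OF this] show ?thesis
      unfolding r_def inner_minus_left neg_le_0_iff_le by (rule disjI2)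
  qed
qed

text \<open>The outward normal fixes the side of \<open>Kp\<close>. If \<open>Km\<close> were on the
  same side, both interiors would contain the same open half disc, against the disjointness of cell
  interiors.\<close>

lemma edge_neighbourhood:
  assumes T: "triangulation T" "\<forall>K\<in>T. 2 simplex K" "shape_regular \<gamma> T" "1 \<le> \<gamma>"
    and K: "Kp \<in> T" "Km \<in> T" "Kp \<noteq> Km" "e edge_of Kp" "e edge_of Km"
    and n: "outward_unit_normal Kp e n"
  obtains a b where "e = closed_segment a b" "a \<noteq> b" "norm n = 1" "n \<bullet> (b - a) = 0"
    "\<And>x. dist (midpoint a b) x < diameter e / (32 * \<gamma>\<^sup>2) \<Longrightarrow> n \<bullet> (x - midpoint a b) < 0 \<Longrightarrow> x \<in> interior Kp"
    "\<And>x. dist (midpoint a b) x < diameter e / (32 * \<gamma>\<^sup>2) \<Longrightarrow> n \<bullet> (x - midpoint a b) > 0 \<Longrightarrow> x \<in> interior Km"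
    "\<And>x. dist (midpoint a b) x < diameter e / (32 * \<gamma>\<^sup>2) \<Longrightarrow> x \<in> Kp \<union> Km"
    "\<And>x. x \<in> interior Kp \<Longrightarrow> n \<bullet> (x - midpoint a b) < 0"
    "\<And>x. x \<in> interior Km \<Longrightarrow> n \<bullet> (x - midpoint a b) > 0"
    "diameter e \<le> diameter Kp" "diameter e \<le> diameter Km"
proof -
  have gK: "diameter Kp / incircle_diameter Kp \<le> \<gamma>" "diameter Km / incircle_diameter Km \<le> \<gamma>"
    and sK: "2 simplex Kp" "2 simplex Km"
    using T K by (auto simp: shape_regular_def)
  obtain a b where e: "e = closed_segment a b" using triangle_edge[OF sK(1) K(4)] by metis
  define m where "m = midpoint a b"
  define r where "r = diameter e / (32 * \<gamma>\<^sup>2)"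
  have me: "m \<in> e" unfolding e m_def by simp
  have n1: "norm n = 1" and nab: "n \<bullet> (b - a) = 0" and nK: "\<And>y. y \<in> Kp \<Longrightarrow> n \<bullet> (y - m) \<le> 0"
    using n me unfolding outward_unit_normal_def e by auto
  have n0: "n \<noteq> 0" using n1 by auto
  note Hp = half_disc_in_cell[OF sK(1) K(4) gK(1) T(4) e n1 nab, folded m_def r_def]
  note Hm = half_disc_in_cell[OF sK(2) K(5) gK(2) T(4) e n1 nab, folded m_def r_def]
  have r0: "r > 0" using Hp(3) T(4) by (simp add: r_def e diameter_closed_segment)
  have "\<not> (\<forall>y\<in>Kp. n \<bullet> (y - m) \<ge> 0)"
  proof
    assume "\<forall>y\<in>Kp. n \<bullet> (y - m) \<ge> 0"
    then have "Kp \<subseteq> {x. n \<bullet> x = n \<bullet> m}" using nK by (force simp: inner_diff_right)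
    then have "interior Kp \<subseteq> interior {x. n \<bullet> x = n \<bullet> m}" by (rule interior_mono)
    then show False using triangle_interior_nonempty[OF sK(1)] n0 by auto
  qed
  then have P: "\<And>x. dist m x \<le> r \<Longrightarrow> n \<bullet> (x - m) \<le> 0 \<Longrightarrow> x \<in> Kp"
    using Hp(1) by (elim disjE) simp_all
  have op: "open {x. dist m x < r \<and> n \<bullet> (x - m) < 0}" "open {x. dist m x < r \<and> n \<bullet> (x - m) > 0}"
    by (intro open_Collect_conj open_Collect_less continuous_intros)+
  have iP: "{x. dist m x < r \<and> n \<bullet> (x - m) < 0} \<subseteq> interior Kp"
    using P by (intro interior_maximal[OF _ op(1)]) auto
  have "\<not> (\<forall>x. dist m x \<le> r \<longrightarrow> n \<bullet> (x - m) \<le> 0 \<longrightarrow> x \<in> Km)"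
  proof
    assume "\<forall>x. dist m x \<le> r \<longrightarrow> n \<bullet> (x - m) \<le> 0 \<longrightarrow> x \<in> Km"
    then have "{x. dist m x < r \<and> n \<bullet> (x - m) < 0} \<subseteq> interior Km"
      by (intro interior_maximal[OF _ op(1)]) auto
    \<comment> \<open>A point at half the radius on the side of \<open>Kp\<close> shows that the
      half disc is not empty.\<close>
    moreover have "m - (r/2) *\<^sub>R n \<in> {x. dist m x < r \<and> n \<bullet> (x - m) < 0}"
    proof -
      have "m - (r/2) *\<^sub>R n - m = (- (r/2)) *\<^sub>R n" by simp
      then have "n \<bullet> (m - (r/2) *\<^sub>R n - m) = - (r/2) * (n \<bullet> n)" by (simp only: inner_scaleR_right)
      moreover have "n \<bullet> n = 1" using n1 by (simp add: norm_eq_1)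
      moreover have "dist m (m - (r/2) *\<^sub>R n) = r/2" using n1 r0 by (simp add: dist_norm)
      ultimately show ?thesis using r0 by simp
    qed
    ultimately show False using iP triangulation_interiors_disjoint[OF T(1) K(1-3)] by blast
  qed
  then have MM: "(\<forall>y\<in>Km. n \<bullet> (y - m) \<ge> 0) \<and>
      (\<forall>x. dist m x \<le> r \<longrightarrow> n \<bullet> (x - m) \<ge> 0 \<longrightarrow> x \<in> Km)"
    using Hm(1) by (elim disjE) simp_all
  have M: "\<And>x. dist m x \<le> r \<Longrightarrow> n \<bullet> (x - m) \<ge> 0 \<Longrightarrow> x \<in> Km" and M': "\<forall>y\<in>Km. n \<bullet> (y - m) \<ge> 0"
    using MM by simp_all
  have iM: "{x. dist m x < r \<and> n \<bullet> (x - m) > 0} \<subseteq> interior Km"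
    using M by (intro interior_maximal[OF _ op(2)]) auto
  have "interior Kp \<subseteq> interior {x. n \<bullet> x \<le> n \<bullet> m}"
    using nK by (intro interior_mono) (auto simp: inner_diff_right)
  then have I1: "\<And>x. x \<in> interior Kp \<Longrightarrow> n \<bullet> (x - m) < 0"
    using n0 by (auto simp: inner_diff_right)
  have "interior Km \<subseteq> interior {x. n \<bullet> x \<ge> n \<bullet> m}"
    using M' by (intro interior_mono) (auto simp: inner_diff_right)
  then have I2: "\<And>x. x \<in> interior Km \<Longrightarrow> n \<bullet> (x - m) > 0"
    using n0 by (auto simp: inner_diff_right)
  have U: "\<And>x. dist m x < r \<Longrightarrow> x \<in> Kp \<union> Km" using P M linear[of "n \<bullet> (_ - m)" 0] by (meson UnI1 UnI2 less_imp_le)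
  have J1: "\<And>x. dist m x < r \<Longrightarrow> n \<bullet> (x - m) < 0 \<Longrightarrow> x \<in> interior Kp" using iP by blast
  have J2: "\<And>x. dist m x < r \<Longrightarrow> n \<bullet> (x - m) > 0 \<Longrightarrow> x \<in> interior Km" using iM by blast
  show ?thesis
    using that[OF e Hp(3) n1 nab, folded m_def r_def, OF J1 J2 U I1 I2 Hp(2) Hm(2)] .
qed

subsection \<open>Assembling the estimates\<close>

lemma L2_norm_triangle:
  assumes "f \<in> L2 U" "g \<in> L2 U" shows "L2_norm U (\<lambda>x. f x + g x) \<le> L2_norm U f + L2_norm U g"
proof -
  have fg: "(\<lambda>x. f x + g x) \<in> L2 U" by (rule L2_add[OF assms])
  have c: "L2_inner U h k = L2_inner U k h" for h k by (simp add: L2_inner_def mult.commute)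
  have "(L2_norm U (\<lambda>x. f x + g x))\<^sup>2 = L2_inner U f f + 2 * L2_inner U f g + L2_inner U g g"
    unfolding L2_norm_sq L2_inner_add_left[OF assms fg] c[of _ "\<lambda>x. f x + g x"]
      L2_inner_add_left[OF assms assms(1)] L2_inner_add_left[OF assms assms(2)]
    by (simp add: c[of g f])
  also have "\<dots> \<le> L2_inner U f f + 2 * (L2_norm U f * L2_norm U g) + L2_inner U g g"
    using L2_Cauchy_Schwarz[OF assms] by (simp add: abs_le_iff)
  also have "\<dots> = (L2_norm U f + L2_norm U g)\<^sup>2"
    by (simp add: power2_sum L2_norm_sq)
  finally show ?thesis by (rule power2_le_imp_le) simp
qed

lemma L2_norm_const_le:
  assumes V: "open V" "V \<subseteq> cball z h" and h: "0 < h"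
  shows "L2_norm V (\<lambda>x. c) \<le> 2 * \<bar>c\<bar> * h"
proof -
  have bV: "bounded V" using V(2) bounded_subset bounded_cball by blast
  have "L2_inner V (\<lambda>x. c) (\<lambda>x. c) = (\<integral>x. indicator V x * (c * c) \<partial>lborel)"
    by (rule L2_inner_borel[OF V(1)]) auto
  also have "\<dots> \<le> (\<integral>x. c\<^sup>2 * indicator (cball z h) x \<partial>lborel)"
  proof (rule integral_mono)
    show "integrable lborel (\<lambda>x. indicator V x * (c * c))"
      using emeasure_bounded_finite[OF bV] V(1)
      by (intro integrable_mult_left) (simp add: integrable_indicator_iff borel_open)
    show "integrable lborel (\<lambda>x. c\<^sup>2 * indicator (cball z h) x)"
      using emeasure_bounded_finite[OF bounded_cball, of z h]
      by (intro integrable_mult_right) (simp add: integrable_indicator_iff)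
    fix x show "indicator V x * (c * c) \<le> c\<^sup>2 * indicator (cball z h) x"
      using V(2) by (auto simp: indicator_def power2_eq_square)
  qed
  also have "\<dots> = c\<^sup>2 * (pi * h\<^sup>2)" using h by (simp add: content_cball unit_ball_vol_2)
  also have "\<dots> \<le> c\<^sup>2 * (4 * h\<^sup>2)"
    using pi_less_4 by (intro mult_left_mono mult_right_mono) auto
  also have "\<dots> = (2 * \<bar>c\<bar> * h)\<^sup>2" by (simp add: power_mult_distrib)
  finally show ?thesis unfolding L2_norm_def using h by (intro real_le_lsqrt) auto
qed

lemma seminorm_nonneg: "0 \<le> sobolev_seminorm V k u"
  unfolding sobolev_seminorm_def grad_inner_def L2_inner_def by (intro real_sqrt_ge_zero sum_nonneg) simp

text \<open>Each derivative of \<phi> costs a factor \<open>1 / r\<close>, and the norm over a disc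
  of radius \<open>r\<close> gains \<open>r\<close>. The constant 16 is 2 for the disc times 8 index
  lists of length three; length two would need only 8.\<close>

lemma cell_residual_bound:
  assumes V: "open V" and f: "f \<in> L2 V" and g: "\<And>\<alpha>. length \<alpha> \<le> 3 \<Longrightarrow> wderiv V \<alpha> u \<in> L2 V"
    and \<phi>: "\<phi> \<in> test_functions UNIV" "\<And>x. x \<notin> cball m r \<Longrightarrow> \<phi> x = 0" and r: "0 < r"
    and b: "\<And>\<alpha> x. length \<alpha> \<le> 3 \<Longrightarrow> \<bar>partials \<alpha> \<phi> x\<bar> \<le> A / r ^ length \<alpha>"
  shows "\<bar>L2_inner V f \<phi>\<bar> \<le> 2 * A * (r * L2_norm V f)"
    and "\<bar>\<iota>\<^sup>2 * (\<Sum>\<alpha> | length \<alpha> = 3. L2_inner V (wderiv V \<alpha> u) (partials (rev \<alpha>) \<phi>))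
      + (\<Sum>\<alpha> | length \<alpha> = 2. L2_inner V (wderiv V \<alpha> u) (partials (rev \<alpha>) \<phi>))\<bar>
      \<le> 16 * A * (\<iota>\<^sup>2 * sobolev_seminorm V 3 u / r\<^sup>2 + sobolev_seminorm V 2 u / r)"
proof -
  have A: "0 \<le> A" using b[of "[]" m] by (simp add: order_trans[OF abs_ge_zero])
  have "\<bar>L2_inner V f \<phi>\<bar> \<le> L2_norm V f * L2_norm V \<phi>"
    by (rule L2_Cauchy_Schwarz[OF f test_functions_L2[OF V \<phi>(1)]])
  also have "\<dots> \<le> L2_norm V f * (2 * A * r)"
    by (intro mult_left_mono L2_norm_bounded[OF V \<phi>(1) _ \<phi>(2) r]) (use b[of "[]"] in auto)
  finally show "\<bar>L2_inner V f \<phi>\<bar> \<le> 2 * A * (r * L2_norm V f)" by (simp add: mult_ac)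
  define S3 where "S3 = sobolev_seminorm V 3 u"
  define S2 where "S2 = sobolev_seminorm V 2 u"
  have S: "0 \<le> S3" "0 \<le> S2" by (auto simp: S3_def S2_def seminorm_nonneg)
  define E3 where "E3 = (\<Sum>\<alpha> | length \<alpha> = 3. L2_inner V (wderiv V \<alpha> u) (partials (rev \<alpha>) \<phi>))"
  define E2 where "E2 = (\<Sum>\<alpha> | length \<alpha> = 2. L2_inner V (wderiv V \<alpha> u) (partials (rev \<alpha>) \<phi>))"
  have "\<bar>E3\<bar> \<le> 2 ^ 3 * (S3 * (2 * (A / r ^ 3) * r))" unfolding E3_def S3_def
  proof (rule sum_wderiv_bound[OF V g \<phi>(1) _ partials_outside[OF closed_cball \<phi>(2)] r])
    fix \<alpha> :: "2 list" and x assume "length \<alpha> = 3" then show "\<bar>partials \<alpha> \<phi> x\<bar> \<le> A / r ^ 3" using b[of \<alpha> x] by simp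
  qed auto
  then have 3: "\<bar>E3\<bar> \<le> 16 * A * (S3 / r\<^sup>2)" using r by (simp add: field_simps power2_eq_square power3_eq_cube)
  have "\<bar>E2\<bar> \<le> 2 ^ 2 * (S2 * (2 * (A / r ^ 2) * r))" unfolding E2_def S2_def
  proof (rule sum_wderiv_bound[OF V g \<phi>(1) _ partials_outside[OF closed_cball \<phi>(2)] r])
    fix \<alpha> :: "2 list" and x assume "length \<alpha> = 2" then show "\<bar>partials \<alpha> \<phi> x\<bar> \<le> A / r ^ 2" using b[of \<alpha> x] by simp
  qed auto
  then have "\<bar>E2\<bar> \<le> 8 * (A * (S2 / r))" using r by (simp add: field_simps power2_eq_square)
  also have "\<dots> \<le> 16 * (A * (S2 / r))" using A S r by (intro mult_right_mono) auto
  finally have 2: "\<bar>E2\<bar> \<le> 16 * A * (S2 / r)" by simp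
  have "\<bar>\<iota>\<^sup>2 * E3 + E2\<bar> \<le> \<iota>\<^sup>2 * \<bar>E3\<bar> + \<bar>E2\<bar>" using abs_triangle_ineq[of "\<iota>\<^sup>2 * E3" E2] by (simp add: abs_mult)
  also have "\<dots> \<le> \<iota>\<^sup>2 * (16 * A * (S3 / r\<^sup>2)) + 16 * A * (S2 / r)"
    by (intro add_mono mult_left_mono 2 3) simp
  finally show "\<bar>\<iota>\<^sup>2 * E3 + E2\<bar> \<le> 16 * A * (\<iota>\<^sup>2 * S3 / r\<^sup>2 + S2 / r)"
    by (simp add: algebra_simps)
qed

section \<open>The discrete setting and the estimate on a cell\<close>

abbreviation (input) osc :: "(plane \<Rightarrow> real) \<Rightarrow> plane set \<Rightarrow> real" where
  "osc f K \<equiv> L2_norm (interior K) (\<lambda>x. f x - proj0 (interior K) f)"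

abbreviation (input) err :: "nat \<Rightarrow> (plane \<Rightarrow> real) \<Rightarrow> (plane \<Rightarrow> real) \<Rightarrow> plane set \<Rightarrow> real" where
  "err k w v K \<equiv> sobolev_seminorm (interior K) k (\<lambda>x. w x - v x)"

text \<open>All data are bundled with the domain, so that the estimates can fix a constant depending
  on \<gamma> alone before any of them.\<close>

definition admissible where
  "admissible \<gamma> \<Omega> T \<iota> f w v \<longleftrightarrow> convex_polygon \<Omega> \<and> 1 \<le> \<gamma> \<and> triangulation_of \<Omega> T \<and> shape_regular \<gamma> T \<and>
    0 < \<iota> \<and> \<iota> < 1 \<and> f \<in> L2 \<Omega> \<and> weak_solution \<Omega> \<iota> f w \<and> v \<in> hermite_space \<Omega> T"

lemma convex_polygon_open: "convex_polygon \<Omega> \<Longrightarrow> open \<Omega>"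
  unfolding convex_polygon_def by auto

text \<open>Cells cover the closure of the domain, while test functions need support in the open
  domain; open subsets of the closure are brought into it by this identity.\<close>

lemma convex_polygon_interior_closure: assumes "convex_polygon \<Omega>" shows "interior (closure \<Omega>) = \<Omega>"
proof -
  obtain P where P: "polytope P" "\<Omega> = interior P" "\<Omega> \<noteq> {}" using assms unfolding convex_polygon_def by blast
  have "closure \<Omega> = closure P"
    using P convex_closure_interior[OF polytope_imp_convex[OF P(1)]] by simp
  also have "\<dots> = P" using P(1) by (simp add: polytope_imp_closed)
  finally show ?thesis using P by simp
qed

lemma cell_facts:
  assumes a: "admissible \<gamma> \<Omega> T \<iota> f w v" and K: "K \<in> T"
  shows "open (interior K)" "bounded (interior K)" "interior K \<subseteq> \<Omega>" "2 simplex K"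
    "cubic (restr v K)" "AE x in lebesgue. x \<in> interior K \<longrightarrow> v x = restr v K x" "v \<in> L2 \<Omega>" "f \<in> L2 (interior K)"
    "length \<alpha> \<le> 3 \<Longrightarrow> wderiv (interior K) \<alpha> (\<lambda>x. w x - v x) \<in> L2 (interior K)"
proof -
  have cp: "convex_polygon \<Omega>" using a by (simp add: admissible_def)
  note o\<Omega> = convex_polygon_open[OF cp]
  have T: "triangulation_of \<Omega> T" using a by (simp add: admissible_def)
  show s: "2 simplex K" using T K by (simp add: triangulation_of_def)
  show oV: "open (interior K)" by simp
  show bV: "bounded (interior K)"
    using triangle_compact_convex(1)[OF s] compact_imp_bounded bounded_interior by blast
  have "K \<subseteq> closure \<Omega>" using T K by (auto simp: triangulation_of_def)
  then show V\<Omega>: "interior K \<subseteq> \<Omega>" using interior_mono convex_polygon_interior_closure[OF cp] by blast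
  have v: "v \<in> hermite_space \<Omega> T" using a by (simp add: admissible_def)
  then show vL: "v \<in> L2 \<Omega>" by (simp add: hermite_space_def sobolev_def)
  have "\<exists>p. p \<in> poly_space 3 \<and> (AE x in lebesgue_on (interior K). v x = p x)"
    using v K unfolding hermite_space_def by blast
  then have p: "restr v K \<in> poly_space 3 \<and> (AE x in lebesgue_on (interior K). v x = restr v K x)"
    unfolding restr_def by (rule someI_ex)
  then show c: "cubic (restr v K)" using poly_space_cubic by blast
  show ae: "AE x in lebesgue. x \<in> interior K \<longrightarrow> v x = restr v K x"
    using p by (simp add: AE_restrict_space_iff)
  show "f \<in> L2 (interior K)" using L2_subset[OF _ o\<Omega> oV V\<Omega>] a by (simp add: admissible_def)
  show "wderiv (interior K) \<alpha> (\<lambda>x. w x - v x) \<in> L2 (interior K)" if "length \<alpha> \<le> 3"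
    using wderiv_split(1)[OF o\<Omega> bV oV V\<Omega> _ vL _ ae that, of w] c a
    by (simp add: cubic_def admissible_def weak_solution_def sobolev0_def)
qed

theorem interior_estimate:
  fixes \<gamma> :: real
  obtains C where "C \<ge> 1" "\<And>\<Omega> T \<iota> f w v K. admissible \<gamma> \<Omega> T \<iota> f w v \<Longrightarrow> K \<in> T \<Longrightarrow>
    L2_norm (interior K) f \<le> C * (osc f K + \<iota>\<^sup>2 / diameter K ^ 3 * err 3 w v K + 1 / diameter K ^ 2 * err 2 w v K)"
proof -
  obtain M where M: "M > 0" "\<And>m r \<alpha> x. 0 < r \<Longrightarrow> length \<alpha> \<le> 3 \<Longrightarrow> \<bar>partials \<alpha> (sbump m r) x\<bar> \<le> M / r ^ length \<alpha>"
    using sbump_bound_0 by blast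
  \<comment> \<open>The factor \<open>64 * exp 2 * M\<close> comes from dividing by the integral of
    the bump, and \<open>(8 * \<gamma>) ^ 4\<close> is the largest power of \<open>h / r\<close>
    that occurs.\<close>
  define C where "C = 1 + 64 * exp 2 * M * (8 * \<gamma>) ^ 4"
  have C: "C \<ge> 1" using M by (simp add: C_def)
  show ?thesis
  proof (rule that[OF C])
    fix \<Omega> T \<iota> f w v K assume a: "admissible \<gamma> \<Omega> T \<iota> f w v" and K: "K \<in> T"
    define V where "V = interior K"
    note cf = cell_facts[OF a K, folded V_def]
    have g1: "1 \<le> \<gamma>" using a by (simp add: admissible_def)
    have o\<Omega>: "open \<Omega>" using a convex_polygon_open by (simp add: admissible_def)
    define h where "h = diameter K"
    obtain z where z: "cball z (h / (4 * \<gamma>)) \<subseteq> K" "h > 0"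
      using inscribed_disc[OF cf(4), of \<gamma>] a K g1 unfolding h_def admissible_def shape_regular_def by blast
    \<comment> \<open>Half of the inscribed radius, so that the closed disc lies in the interior of
      the cell.\<close>
    define r where "r = h / (8 * \<gamma>)"
    have r: "0 < r" "h / (4 * \<gamma>) = 2 * r" "h = 8 * \<gamma> * r" using z g1 by (auto simp: r_def field_simps)
    have "ball z (2 * r) \<subseteq> V" unfolding V_def using z(1) ball_subset_cball[of z "2 * r"]
      by (intro interior_maximal) (auto simp: r(2))
    then have cV: "cball z r \<subseteq> V" using r(1) by (force simp: subset_iff)
    define \<phi> where "\<phi> = sbump z r"
    have \<phi>: "\<phi> \<in> test_functions V" unfolding \<phi>_def by (rule sbump_test[OF r(1) cV])
    have \<phi>U: "\<phi> \<in> test_functions UNIV" using test_functions_mono[OF \<phi>] by simp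
    have \<phi>o: "x \<notin> cball z r \<Longrightarrow> \<phi> x = 0" for x unfolding \<phi>_def by (rule sbump_outside[OF r(1)])
    define c0 where "c0 = proj0 V f"
    have cL: "(\<lambda>x. c0) \<in> L2 V" by (rule L2_smooth[OF cf(1,2) smooth_const])
    have fcL: "(\<lambda>x. f x - c0) \<in> L2 V" by (rule L2_diff[OF cf(8) cL])
    define Os where "Os = L2_norm V (\<lambda>x. f x - c0)"
    define S3 where "S3 = sobolev_seminorm V 3 (\<lambda>x. w x - v x)"
    define S2 where "S2 = sobolev_seminorm V 2 (\<lambda>x. w x - v x)"
    have S: "0 \<le> S3" "0 \<le> S2" "0 \<le> Os" by (auto simp: S3_def S2_def Os_def seminorm_nonneg)
    note bd = cell_residual_bound[OF cf(1) _ cf(9) \<phi>U \<phi>o r(1) M(2)[OF r(1), of _ z, folded \<phi>_def]]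
    have "\<bar>L2_inner V f \<phi>\<bar> \<le> 16 * M * (\<iota>\<^sup>2 * S3 / r\<^sup>2 + S2 / r)"
      using residual_interior[OF o\<Omega> cf(2,1,3) _ cf(7,5,6) \<phi>, of \<iota> f w] bd(2)[OF cf(8), where \<iota> = \<iota>] a
      by (simp add: admissible_def S3_def S2_def)
    moreover have "\<bar>L2_inner V (\<lambda>x. f x - c0) \<phi>\<bar> \<le> 2 * M * (r * Os)"
      unfolding Os_def by (rule bd(1)[OF fcL])
    moreover have "L2_inner V (\<lambda>x. f x - c0) \<phi> = L2_inner V f \<phi> - c0 * (\<integral>x. \<phi> x \<partial>lborel)"
      by (simp add: L2_inner_diff_left[OF cf(8) cL test_functions_L2[OF cf(1) \<phi>]] L2_inner_test_borel[OF cf(1) \<phi>])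
    ultimately have "\<bar>c0 * (\<integral>x. \<phi> x \<partial>lborel)\<bar> \<le> 16 * M * (\<iota>\<^sup>2 * S3 / r\<^sup>2 + S2 / r) + 2 * M * (r * Os)"
      by linarith
    also have "\<dots> \<le> 16 * M * (\<iota>\<^sup>2 * S3 / r\<^sup>2 + S2 / r + r * Os)"
      using M(1) r(1) S by (simp add: distrib_left mult_right_mono)
    finally have c1: "\<bar>c0\<bar> * \<bar>\<integral>x. \<phi> x \<partial>lborel\<bar> \<le> 16 * M * (\<iota>\<^sup>2 * S3 / r\<^sup>2 + S2 / r + r * Os)"
      by (simp add: abs_mult)
    have "\<bar>c0\<bar> * (exp (- 2) * (r\<^sup>2 / 2)) \<le> \<bar>c0\<bar> * \<bar>\<integral>x. \<phi> x \<partial>lborel\<bar>"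
      using sbump_integral_ge[OF r(1), of z] unfolding \<phi>_def by (intro mult_left_mono) auto
    with c1 have "\<bar>c0\<bar> * (exp (- 2) * (r\<^sup>2 / 2)) \<le> 16 * M * (\<iota>\<^sup>2 * S3 / r\<^sup>2 + S2 / r + r * Os)" by linarith
    \<comment> \<open>The factor cancels the lower bound for the integral of the bump and leaves
      \<open>2 * \<bar>c0\<bar> * h\<close>, which bounds the norm of the constant on a set
      contained in a disc of radius \<open>h\<close>.\<close>
    then have "(2 * exp 2 * (2 * h) / r\<^sup>2) * (\<bar>c0\<bar> * (exp (- 2) * (r\<^sup>2 / 2)))
      \<le> (2 * exp 2 * (2 * h) / r\<^sup>2) * (16 * M * (\<iota>\<^sup>2 * S3 / r\<^sup>2 + S2 / r + r * Os))"
      using z(2) by (intro mult_left_mono) auto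
    moreover have "(2 * exp 2 * (2 * h) / r\<^sup>2) * (\<bar>c0\<bar> * (exp (- 2) * (r\<^sup>2 / 2))) = 2 * \<bar>c0\<bar> * h"
      using r(1) by (simp add: exp_minus field_simps)
    moreover have "(2 * exp 2 * (2 * h) / r\<^sup>2) * (16 * M * (\<iota>\<^sup>2 * S3 / r\<^sup>2 + S2 / r + r * Os))
      = 64 * exp 2 * M * ((8 * \<gamma>) ^ 4 * (\<iota>\<^sup>2 / h ^ 3 * S3) + (8 * \<gamma>) ^ 3 * (1 / h\<^sup>2 * S2) + (8 * \<gamma>) * Os)"
    proof -
      have e: "h / r\<^sup>2 * (\<iota>\<^sup>2 * S3 / r\<^sup>2) = (8 * \<gamma>) ^ 4 * (\<iota>\<^sup>2 / h ^ 3 * S3)"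
        "h / r\<^sup>2 * (S2 / r) = (8 * \<gamma>) ^ 3 * (1 / h\<^sup>2 * S2)" "h / r\<^sup>2 * (r * Os) = (8 * \<gamma>) * Os"
        using z(2) g1 by (simp_all add: r_def power_divide power_mult_distrib field_simps eval_nat_numeral)
      have "(2 * exp 2 * (2 * h) / r\<^sup>2) * (16 * M * (\<iota>\<^sup>2 * S3 / r\<^sup>2 + S2 / r + r * Os))
        = 64 * exp 2 * M * (h / r\<^sup>2 * (\<iota>\<^sup>2 * S3 / r\<^sup>2) + h / r\<^sup>2 * (S2 / r) + h / r\<^sup>2 * (r * Os))"
        by (simp add: algebra_simps)
      then show ?thesis unfolding e .
    qed
    moreover have "(8 * \<gamma>) ^ 4 * (\<iota>\<^sup>2 / h ^ 3 * S3) + (8 * \<gamma>) ^ 3 * (1 / h\<^sup>2 * S2) + (8 * \<gamma>) * Os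
      \<le> (8 * \<gamma>) ^ 4 * (Os + \<iota>\<^sup>2 / h ^ 3 * S3 + 1 / h\<^sup>2 * S2)"
    proof -
      have "(8 * \<gamma>) ^ 3 * (1 / h\<^sup>2 * S2) \<le> (8 * \<gamma>) ^ 4 * (1 / h\<^sup>2 * S2)"
        using g1 S z(2) by (intro mult_right_mono power_increasing) auto
      moreover have "(8 * \<gamma>) ^ 1 * Os \<le> (8 * \<gamma>) ^ 4 * Os"
        using g1 S by (intro mult_right_mono power_increasing) auto
      ultimately show ?thesis unfolding distrib_left power_one_right by linarith
    qed
    then have "64 * exp 2 * M * ((8 * \<gamma>) ^ 4 * (\<iota>\<^sup>2 / h ^ 3 * S3) + (8 * \<gamma>) ^ 3 * (1 / h\<^sup>2 * S2) + (8 * \<gamma>) * Os)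
      \<le> 64 * exp 2 * M * ((8 * \<gamma>) ^ 4 * (Os + \<iota>\<^sup>2 / h ^ 3 * S3 + 1 / h\<^sup>2 * S2))"
      using M(1) by (intro mult_left_mono) auto
    ultimately have c2: "2 * \<bar>c0\<bar> * h \<le> 64 * exp 2 * M * ((8 * \<gamma>) ^ 4 * (Os + \<iota>\<^sup>2 / h ^ 3 * S3 + 1 / h\<^sup>2 * S2))"
      by linarith
    have "V \<subseteq> cball z h"
    proof
      fix x assume "x \<in> V"
      moreover have "z \<in> K" using z(1) r by auto
      ultimately show "x \<in> cball z h"
        using diameter_bounded_bound[OF compact_imp_bounded[OF triangle_compact_convex(1)[OF cf(4)]]] interior_subset
        unfolding V_def h_def by (metis mem_cball subsetD)
    qed
    then have "L2_norm V (\<lambda>x. c0) \<le> 2 * \<bar>c0\<bar> * h" by (rule L2_norm_const_le[OF cf(1) _ z(2)])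
    moreover have "L2_norm V f \<le> Os + L2_norm V (\<lambda>x. c0)"
      using L2_norm_triangle[OF fcL cL] by (simp add: Os_def)
    moreover have "0 \<le> \<iota>\<^sup>2 / h ^ 3 * S3" "0 \<le> 1 / h\<^sup>2 * S2" using S z(2) by auto
    ultimately have "L2_norm V f \<le> (Os + \<iota>\<^sup>2 / h ^ 3 * S3 + 1 / h\<^sup>2 * S2)
      + 64 * exp 2 * M * ((8 * \<gamma>) ^ 4 * (Os + \<iota>\<^sup>2 / h ^ 3 * S3 + 1 / h\<^sup>2 * S2))"
      using c2 by linarith
    also have "\<dots> = C * (Os + \<iota>\<^sup>2 / h ^ 3 * S3 + 1 / h\<^sup>2 * S2)"
      unfolding C_def distrib_right[of 1] mult_1 mult.assoc ..
    finally have "L2_norm V f \<le> C * (Os + \<iota>\<^sup>2 / h ^ 3 * S3 + 1 / h\<^sup>2 * S2)" .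
    then show "L2_norm (interior K) f \<le> C * (osc f K + \<iota>\<^sup>2 / diameter K ^ 3 * err 3 w v K + 1 / diameter K ^ 2 * err 2 w v K)"
      unfolding V_def h_def Os_def c0_def S3_def S2_def .
  qed
qed

text \<open>Whichever end points the choice returns, they span \<open>e\<close>, and their distance
  is the diameter of \<open>e\<close>.\<close>

lemma edge_L2_norm_le:
  assumes e: "e = closed_segment a b" and g: "\<And>x. x \<in> e \<Longrightarrow> \<bar>g x\<bar> \<le> B"
  shows "(edge_L2_norm e g)\<^sup>2 \<le> diameter e * B\<^sup>2"
proof -
  define p where "p = (SOME (a, b). e = closed_segment a b)"
  have "case p of (a, b) \<Rightarrow> e = closed_segment a b"
    unfolding p_def by (rule someI[of _ "(a, b)"]) (simp add: e)
  then obtain c d where p: "p = (c, d)" and cd: "e = closed_segment c d" by (cases p) auto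
  define I where "I = integral {0..1} (\<lambda>t. (g (linepath c d t))\<^sup>2)"
  have b: "norm ((g (linepath c d t))\<^sup>2) \<le> B\<^sup>2" if "t \<in> cbox 0 1" for t
  proof -
    have "linepath c d t \<in> e" using that unfolding cd by (simp add: linepath_in_path)
    then have "\<bar>g (linepath c d t)\<bar> \<le> \<bar>B\<bar>" using g by fastforce
    then show ?thesis by (simp add: abs_le_square_iff)
  qed
  \<comment> \<open>If the square is not integrable its integral is 0 by convention, which satisfies
    the bound as well.\<close>
  have I1: "\<bar>I\<bar> \<le> B\<^sup>2"
  proof (cases "(\<lambda>t. (g (linepath c d t))\<^sup>2) integrable_on cbox 0 1")
    case True
    have "norm (integral (cbox 0 1) (\<lambda>t. (g (linepath c d t))\<^sup>2)) \<le> B\<^sup>2 * measure lborel (cbox 0 (1::real))"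
      by (rule Henstock_Kurzweil_Integration.integrable_bound[OF _ True b]) auto
    then show ?thesis by (simp add: I_def)
  next
    case False
    then show ?thesis by (simp add: I_def not_integrable_integral)
  qed
  have I0: "0 \<le> I" unfolding I_def
    by (cases "(\<lambda>t. (g (linepath c d t))\<^sup>2) integrable_on {0..1}")
      (auto simp: not_integrable_integral intro: Henstock_Kurzweil_Integration.integral_nonneg)
  have "edge_L2_norm e g = sqrt (dist c d * I)"
    unfolding edge_L2_norm_def p_def[symmetric] p I_def by simp
  then have "(edge_L2_norm e g)\<^sup>2 = dist c d * I" using I0 by simp
  also have "\<dots> \<le> dist c d * B\<^sup>2" using I1 by (intro mult_left_mono) auto
  finally show ?thesis by (simp add: cd diameter_closed_segment)
qed

lemma edge_param:
  assumes "norm n = 1" "n \<bullet> (b - a) = 0" "x \<in> closed_segment a b"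
  obtains t where "\<bar>t\<bar> \<le> dist a b / 2" "x = midpoint a b + t *\<^sub>R perp n"
proof -
  obtain u where u: "0 \<le> u" "u \<le> 1" "x = (1 - u) *\<^sub>R a + u *\<^sub>R b" using assms(3) unfolding in_segment by metis
  have e: "x - midpoint a b = (u - 1/2) *\<^sub>R (b - a)"
    unfolding u(3) midpoint_def by (simp add: algebra_simps scaleR_2[symmetric])
  define t where "t = perp n \<bullet> (x - midpoint a b)"
  have "n \<bullet> (x - midpoint a b) = 0" unfolding e using assms(2) by simp
  then have x: "x - midpoint a b = t *\<^sub>R perp n"
    using plane_decomp[OF assms(1), of "x - midpoint a b"] by (simp add: t_def)
  then have "\<bar>t\<bar> = norm (x - midpoint a b)" using assms(1) by simp
  also have "\<dots> = \<bar>u - 1/2\<bar> * dist a b" unfolding e by (simp add: dist_norm norm_minus_commute)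
  also have "\<dots> \<le> 1/2 * dist a b"
    using u(1,2) by (intro mult_right_mono) (simp_all add: abs_le_iff field_simps)
  finally show ?thesis using that[of t] x by (simp add: algebra_simps)
qed

lemma square_sum3: "(a + b + c)\<^sup>2 \<le> 3 * (a\<^sup>2 + b\<^sup>2 + (c::real)\<^sup>2)"
proof -
  have "0 \<le> (a - b)\<^sup>2 + (b - c)\<^sup>2 + (a - c)\<^sup>2" by simp
  then show ?thesis by (simp add: power2_eq_square algebra_simps)
qed

lemma square_sum2: "(a + b)\<^sup>2 \<le> 2 * (a\<^sup>2 + (b::real)\<^sup>2)"
proof -
  have "0 \<le> (a - b)\<^sup>2" by simp
  then show ?thesis by (simp add: power2_eq_square algebra_simps)
qed

lemma abs_diff_diff_le: "\<bar>x\<bar> \<le> p \<Longrightarrow> \<bar>y + z\<bar> \<le> q \<Longrightarrow> \<bar>x - y - z\<bar> \<le> p + (q::real)"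
  by linarith

text \<open>One sum \<open>S\<close> serves both jumps: the third derivative carries one more
  inverse length than the second, so its squared bound is \<open>S\<close> times the squared edge
  length.\<close>

theorem edge_estimate:
  fixes \<gamma> :: real
  obtains C where "C > 0" "\<And>\<Omega> T \<iota> f w v e Kp Km n S. admissible \<gamma> \<Omega> T \<iota> f w v \<Longrightarrow>
      Kp \<in> edge_patch T e \<Longrightarrow> Km \<in> edge_patch T e \<Longrightarrow> Kp \<noteq> Km \<and> outward_unit_normal Kp e n \<Longrightarrow>
      S = (\<Sum>K\<in>edge_patch T e. diameter e ^ 3 * (osc f K)\<^sup>2 + \<iota> ^ 4 / diameter e ^ 3 * (err 3 w v K)\<^sup>2
        + 1 / diameter e * (err 2 w v K)\<^sup>2) \<Longrightarrow>
      0 \<le> S \<and> 0 < diameter e \<and> (edge_L2_norm e (jump 2 n v Kp Km))\<^sup>2 \<le> C * S \<and>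
      \<iota> ^ 4 * (edge_L2_norm e (jump 3 n v Kp Km))\<^sup>2 \<le> C * ((diameter e)\<^sup>2 * S)"
proof (rule interior_estimate[of \<gamma>], rule sbump_bound_1, rule sbump_bound_2, goal_cases)
  case (1 C1 M1 M2)
  note that = 1(1) and C1 = 1(2,3) and M1 = 1(4,5) and M2 = 1(6,7)
  \<comment> \<open>The ratio of edge length to bump radius: half of the radius found in
    \<open>edge_neighbourhood\<close>, so that the closed disc fits into the open one.\<close>
  define g where "g = 64 * \<gamma>\<^sup>2"
  \<comment> \<open>\<open>C3\<close> bounds \<open>a0 + b0 * t\<close> on the whole edge, where
    \<open>t\<close> is at most \<open>h / 2 = g * r / 2\<close> in absolute value;
    \<open>C4\<close> belongs to the third derivative.\<close>
  define C3 where "C3 = 32 * exp 2 * C1 * M1 + g / 2 * (2048 * exp 2 * C1 * M2)"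
  define C4 where "C4 = 16 * exp 2 * C1 * M2"
  define C where "C = 6 * g ^ 4 * (C3\<^sup>2 + C4\<^sup>2) + 1"
  have C0: "C > 0" unfolding C_def by (intro add_nonneg_pos) auto
  show ?thesis
  proof (rule that[OF C0])
    fix \<Omega> T \<iota> f w v e Kp Km n S
    assume a: "admissible \<gamma> \<Omega> T \<iota> f w v" and Kp: "Kp \<in> edge_patch T e" and Km: "Km \<in> edge_patch T e"
      and "Kp \<noteq> Km \<and> outward_unit_normal Kp e n"
      and S: "S = (\<Sum>K\<in>edge_patch T e. diameter e ^ 3 * (osc f K)\<^sup>2 + \<iota> ^ 4 / diameter e ^ 3 * (err 3 w v K)\<^sup>2
        + 1 / diameter e * (err 2 w v K)\<^sup>2)"
    then have ne: "Kp \<noteq> Km" and n: "outward_unit_normal Kp e n" by auto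
    have KT: "Kp \<in> T" "Km \<in> T" "e edge_of Kp" "e edge_of Km" using Kp Km by (auto simp: edge_patch_def)
    have T: "triangulation T" "\<forall>K\<in>T. 2 simplex K" "shape_regular \<gamma> T" "1 \<le> \<gamma>" "\<Union>T = closure \<Omega>"
      and cp: "convex_polygon \<Omega>" and ws: "weak_solution \<Omega> \<iota> f w" and fL: "f \<in> L2 \<Omega>"
      using a by (auto simp: admissible_def triangulation_of_def)
    have g1: "1 \<le> g" unfolding g_def using one_le_power[OF T(4), of 2] by simp
    define h where "h = diameter e"
    obtain p q where pq: "e = closed_segment p q" "p \<noteq> q" "norm n = 1" "n \<bullet> (q - p) = 0"
      "\<And>x. dist (midpoint p q) x < diameter e / (32 * \<gamma>\<^sup>2) \<Longrightarrow> n \<bullet> (x - midpoint p q) < 0 \<Longrightarrow> x \<in> interior Kp"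
      "\<And>x. dist (midpoint p q) x < diameter e / (32 * \<gamma>\<^sup>2) \<Longrightarrow> n \<bullet> (x - midpoint p q) > 0 \<Longrightarrow> x \<in> interior Km"
      "\<And>x. dist (midpoint p q) x < diameter e / (32 * \<gamma>\<^sup>2) \<Longrightarrow> x \<in> Kp \<union> Km"
      "\<And>x. x \<in> interior Kp \<Longrightarrow> n \<bullet> (x - midpoint p q) < 0"
      "\<And>x. x \<in> interior Km \<Longrightarrow> n \<bullet> (x - midpoint p q) > 0"
      "diameter e \<le> diameter Kp" "diameter e \<le> diameter Km"
    proof (rule edge_neighbourhood[OF T(1-4) KT(1,2) ne KT(3,4) n], goal_cases)
      case (1 p q)
      show ?thesis by (rule that[OF 1(2-)])
    qed
    define m where "m = midpoint p q"
    define r where "r = h / g"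
    have h: "h > 0" "h = dist p q" using pq(1,2) by (simp_all add: h_def diameter_closed_segment)
    have r: "0 < r" "diameter e / (32 * \<gamma>\<^sup>2) = 2 * r" "h = g * r" "r \<le> h"
      using h(1) g1 T(4) by (auto simp: r_def g_def h_def[symmetric] field_simps)
    have near: "dist m x < 2 * r" if "x \<in> cball m r" for x using that r(1) by simp
    have U: "open \<Omega>" using convex_polygon_open[OF cp] .
    have "Kp \<union> Km \<subseteq> closure \<Omega>" using KT T(5) by blast
    then have "ball m (2 * r) \<subseteq> closure \<Omega>"
      using pq(7) unfolding m_def[symmetric] r(2) by (auto simp only: mem_ball subset_iff)
    then have "ball m (2 * r) \<subseteq> \<Omega>"
      using interior_maximal[OF _ open_ball] convex_polygon_interior_closure[OF cp] by blast
    then have cm: "cball m r \<subseteq> \<Omega>" using near by (auto simp: subset_iff)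
    note cfp = cell_facts[OF a KT(1)] and cfm = cell_facts[OF a KT(2)]
    define D where "D = (\<lambda>x. restr v Kp x - restr v Km x)"
    have sP: "smooth (restr v Kp)" "smooth (restr v Km)" using cfp(5) cfm(5) by (auto simp: cubic_def)
    have cD: "cubic D" unfolding D_def by (rule cubic_diff[OF cfp(5) cfm(5)])
    have nn: "0 \<le> err 3 w v K" "0 \<le> err 2 w v K" "0 \<le> osc f K" for K by (auto simp: seminorm_nonneg)
    \<comment> \<open>The contribution of one cell in the scaling of a point value of the second
      normal derivative of \<open>D\<close>.\<close>
    define Y where "Y K = r * osc f K + \<iota>\<^sup>2 * err 3 w v K / r\<^sup>2 + err 2 w v K / r" for K
    have Y0: "0 \<le> Y K" for K unfolding Y_def using nn r(1) by (intro add_nonneg_nonneg) auto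
    define D3 where "D3 = dir_deriv n (dir_deriv n (dir_deriv n D)) m"
    \<comment> \<open>The cell estimate replaces the load by its oscillation and the error; powers
      of the cell diameter are traded for powers of \<open>r\<close>, since
      \<open>r \<le> h \<le> diameter K\<close>.\<close>
    have X: "r * L2_norm (interior K) f + \<iota>\<^sup>2 * err 3 w v K / r\<^sup>2 + err 2 w v K / r \<le> 2 * C1 * Y K"
      if K: "K \<in> T" "h \<le> diameter K" for K
    proof -
      define d where "d = diameter K"
      have d: "r \<le> d" "0 < d"
        using order_trans[OF r(4) K(2)] less_le_trans[OF h(1) K(2)] by (simp_all add: d_def)
      have "r * L2_norm (interior K) f \<le> r * (C1 * (osc f K + \<iota>\<^sup>2 / d ^ 3 * err 3 w v K + 1 / d\<^sup>2 * err 2 w v K))"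
        using C1(2)[OF a K(1)] r(1) unfolding d_def by (intro mult_left_mono) auto
      also have "\<dots> = C1 * (r * osc f K + r / d ^ 3 * (\<iota>\<^sup>2 * err 3 w v K) + r / d\<^sup>2 * err 2 w v K)" by (simp add: algebra_simps)
      also have "\<dots> \<le> C1 * (r * osc f K + 1 / r\<^sup>2 * (\<iota>\<^sup>2 * err 3 w v K) + 1 / r * err 2 w v K)"
      proof (intro mult_left_mono add_mono mult_right_mono)
        have "r ^ 3 \<le> d ^ 3" "r\<^sup>2 \<le> d\<^sup>2" using d r(1) by (auto intro: power_mono)
        then show "r / d ^ 3 \<le> 1 / r\<^sup>2" "r / d\<^sup>2 \<le> 1 / r"
          using d r(1) by (simp_all add: field_simps power2_eq_square power3_eq_cube)
      qed (use nn C1(1) r(1) in auto)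
      also have "\<dots> = C1 * Y K" by (simp add: Y_def)
      finally have 1: "r * L2_norm (interior K) f \<le> C1 * Y K" .
      have "\<iota>\<^sup>2 * err 3 w v K / r\<^sup>2 + err 2 w v K / r \<le> 1 * Y K" using nn r(1) by (simp add: Y_def)
      also have "\<dots> \<le> C1 * Y K" using C1(1) Y0 by (intro mult_right_mono) auto
      finally show ?thesis using 1 by linarith
    qed
    \<comment> \<open>The common form of the three tests: \<open>A\<close> measures the size of
      \<open>(n \<bullet> (x - m)) * \<psi> x\<close> and is all that the bound keeps of
      \<psi>.\<close>
    have key: "\<bar>\<iota>\<^sup>2 * (2 * D3 * (\<integral>t. dir_deriv n \<psi> (m + t *\<^sub>R perp n) \<partial>lborel))
      + (\<integral>t. dir_deriv n (dir_deriv n D) (m + t *\<^sub>R perp n) * \<psi> (m + t *\<^sub>R perp n) \<partial>lborel)\<bar>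
      \<le> 32 * C1 * A * (Y Kp + Y Km)"
      if \<psi>: "smooth \<psi>" "\<And>x. x \<notin> cball m r \<Longrightarrow> \<psi> x = 0" and A: "0 \<le> A"
        and b: "\<And>\<alpha> x. length \<alpha> \<le> 3 \<Longrightarrow> \<bar>partials \<alpha> (\<lambda>x. (n \<bullet> (x - m)) * \<psi> x) x\<bar> \<le> A / r ^ length \<alpha>" for \<psi> A
    proof -
      define \<phi> where "\<phi> = (\<lambda>x. (n \<bullet> (x - m)) * \<psi> x)"
      have \<phi>o: "x \<notin> cball m r \<Longrightarrow> \<phi> x = 0" for x using \<psi>(2) by (simp add: \<phi>_def)
      have \<phi>t: "\<phi> \<in> test_functions UNIV"
        unfolding test_functions_iff
        using smooth_mult[OF smooth_inner \<psi>(1), of n m] \<phi>o by (auto simp: \<phi>_def intro!: exI[of _ "cball m r"] simp del: mem_cball)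
      define R where "R V = L2_inner V f \<phi> -
        \<iota>\<^sup>2 * (\<Sum>\<alpha> | length \<alpha> = 3. L2_inner V (wderiv V \<alpha> (\<lambda>x. w x - v x)) (partials (rev \<alpha>) \<phi>))
        - (\<Sum>\<alpha> | length \<alpha> = 2. L2_inner V (wderiv V \<alpha> (\<lambda>x. w x - v x)) (partials (rev \<alpha>) \<phi>))" for V
      have R: "\<bar>R (interior K)\<bar> \<le> 32 * C1 * A * Y K" if K: "K \<in> T" "h \<le> diameter K" for K
      proof -
        note cf = cell_facts[OF a K(1)]
        note bd = cell_residual_bound[OF cf(1,8,9) \<phi>t \<phi>o r(1) b[folded \<phi>_def]]
        have "\<bar>R (interior K)\<bar> \<le> 2 * A * (r * L2_norm (interior K) f) + 16 * A * (\<iota>\<^sup>2 * err 3 w v K / r\<^sup>2 + err 2 w v K / r)"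
          unfolding R_def by (rule abs_diff_diff_le[OF bd(1) bd(2)])
        also have "\<dots> \<le> 16 * A * (r * L2_norm (interior K) f) + 16 * A * (\<iota>\<^sup>2 * err 3 w v K / r\<^sup>2 + err 2 w v K / r)"
          using A r(1) by (intro add_right_mono mult_right_mono) auto
        also have "\<dots> = 16 * A * (r * L2_norm (interior K) f + \<iota>\<^sup>2 * err 3 w v K / r\<^sup>2 + err 2 w v K / r)"
          by (simp add: distrib_left)
        also have "\<dots> \<le> 16 * A * (2 * C1 * Y K)" using A X[OF K] by (intro mult_left_mono) auto
        finally show ?thesis by (simp add: mult_ac)
      qed
      have "\<iota>\<^sup>2 * (2 * D3 * (\<integral>t. dir_deriv n \<psi> (m + t *\<^sub>R perp n) \<partial>lborel))
        + (\<integral>t. dir_deriv n (dir_deriv n D) (m + t *\<^sub>R perp n) * \<psi> (m + t *\<^sub>R perp n) \<partial>lborel)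
        = R (interior Kp) + R (interior Km)"
        unfolding R_def \<phi>_def D3_def D_def
        by (rule residual_edge[OF U cfp(2,1,3) cfm(2,1,3) ws cfp(7,5,6) cfm(5,6) pq(3) cm _ _ _ _ \<psi> fL])
          (use pq(5,6,8,9) near in \<open>auto simp: m_def[symmetric] r(2) simp del: mem_cball\<close>)
      then show ?thesis
        using R[OF KT(1)] R[OF KT(2)] pq(10,11) unfolding h_def by (simp add: distrib_left)
    qed
    obtain a0 b0 where ab: "\<And>t. dir_deriv n (dir_deriv n D) (m + t *\<^sub>R perp n) = a0 + b0 * t"
      "\<And>x. dir_deriv n (dir_deriv n (dir_deriv n D)) x = D3"
    proof (rule cubic_dir_deriv_line[OF cD, where n = n and m = m and p = "perp n"], goal_cases)
      case (1 a b)
      show ?thesis by (rule that[OF 1(2) 1(3)[folded D3_def]])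
    qed
    define Ys where "Ys = Y Kp + Y Km"
    have Ys0: "0 \<le> Ys" using Y0 by (simp add: Ys_def)
    note L = sbump_line_integrals[OF r(1) pq(3), of m]
    have nn1: "n \<bullet> n = 1" using pq(3) by (simp add: norm_eq_1)
    have line0: "n \<bullet> (m + t *\<^sub>R perp n - m) = 0" for t by simp
    have linet: "perp n \<bullet> (m + t *\<^sub>R perp n - m) = t" for t
      using pq(3) by (simp add: norm_eq_1[symmetric])
    have dn0: "dir_deriv n (sbump m r) (m + t *\<^sub>R perp n) = 0" for t
      by (rule sbump_dir_deriv_normal[OF line0])
    have so: "x \<notin> cball m r \<Longrightarrow> sbump m r x = 0" for x by (rule sbump_outside[OF r(1)])
    have mult_dd: "dir_deriv n (\<lambda>x. (c \<bullet> (x - m)) * sbump m r x) x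
        = (c \<bullet> n) * sbump m r x + (c \<bullet> (x - m)) * dir_deriv n (sbump m r) x" for c x
      by (subst dir_deriv_mult[OF smooth_dble[OF smooth_inner] smooth_dble[OF smooth_sbump]])
        (simp add: dir_deriv_inner)
    \<comment> \<open>On the line the test function vanishes and its normal derivative is the bump.
      With \<open>A = M2 * r\<^sup>2\<close> and a bump integral of order \<open>r\<close>, one
      factor \<open>r\<close> survives.\<close>
    have E3: "\<bar>\<iota>\<^sup>2 * D3\<bar> \<le> C4 * (r * Ys)"
    proof -
      have "\<bar>\<iota>\<^sup>2 * (2 * D3 * (\<integral>t. sbump m r (m + t *\<^sub>R perp n) \<partial>lborel))\<bar> \<le> 32 * C1 * (M2 * r\<^sup>2) * Ys"
        using key[of "\<lambda>x. (n \<bullet> (x - m)) * sbump m r x" "M2 * r\<^sup>2"] M2 r(1) pq(3) so smooth_mult[OF smooth_inner smooth_sbump]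
        unfolding mult_dd line0 Ys_def by (simp add: nn1)
      then have "2 * \<bar>\<iota>\<^sup>2 * D3\<bar> * \<bar>\<integral>t. sbump m r (m + t *\<^sub>R perp n) \<partial>lborel\<bar> \<le> 32 * C1 * (M2 * r\<^sup>2) * Ys"
        by (simp add: abs_mult mult_ac)
      moreover have "2 * \<bar>\<iota>\<^sup>2 * D3\<bar> * (exp (- 2) * r) \<le> 2 * \<bar>\<iota>\<^sup>2 * D3\<bar> * \<bar>\<integral>t. sbump m r (m + t *\<^sub>R perp n) \<partial>lborel\<bar>"
        using L(1) by (intro mult_left_mono) auto
      ultimately have "2 * \<bar>\<iota>\<^sup>2 * D3\<bar> * (exp (- 2) * r) \<le> 32 * C1 * (M2 * r\<^sup>2) * Ys" by linarith
      then have "\<bar>\<iota>\<^sup>2 * D3\<bar> * (2 * exp (- 2) * r) \<le> (16 * exp 2 * C1 * M2 * (r * Ys)) * (2 * exp (- 2) * r)"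
        by (simp add: exp_minus field_simps power2_eq_square)
      then show ?thesis unfolding C4_def by (rule mult_right_le_imp_le) (use r(1) in simp)
    qed
    \<comment> \<open>The normal derivative of the bump is 0 on the line and its first moment
      vanishes, so \<open>a0\<close> is all that is left.\<close>
    have Ea: "\<bar>a0\<bar> \<le> 32 * exp 2 * C1 * M1 * Ys"
    proof -
      have e: "(\<integral>t. (a0 + b0 * t) * sbump m r (m + t *\<^sub>R perp n) \<partial>lborel) = a0 * (\<integral>t. sbump m r (m + t *\<^sub>R perp n) \<partial>lborel)"
      proof -
        have "(\<integral>t. (a0 + b0 * t) * sbump m r (m + t *\<^sub>R perp n) \<partial>lborel)
          = (\<integral>t. a0 * sbump m r (m + t *\<^sub>R perp n) + b0 * (t * sbump m r (m + t *\<^sub>R perp n)) \<partial>lborel)"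
          by (simp add: algebra_simps)
        then show ?thesis using L(3-5) by simp
      qed
      have "\<bar>a0 * (\<integral>t. sbump m r (m + t *\<^sub>R perp n) \<partial>lborel)\<bar> \<le> 32 * C1 * (M1 * r) * Ys"
        using key[of "sbump m r" "M1 * r"] M1 r(1) pq(3) so smooth_sbump unfolding dn0 ab(1) e Ys_def by simp
      moreover have "\<bar>a0\<bar> * (exp (- 2) * r) \<le> \<bar>a0\<bar> * \<bar>\<integral>t. sbump m r (m + t *\<^sub>R perp n) \<partial>lborel\<bar>"
        using L(1) by (intro mult_left_mono) auto
      ultimately have "\<bar>a0\<bar> * (exp (- 2) * r) \<le> 32 * C1 * (M1 * r) * Ys" unfolding abs_mult by linarith
      then have "\<bar>a0\<bar> * (exp (- 2) * r) \<le> (32 * exp 2 * C1 * M1 * Ys) * (exp (- 2) * r)"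
        by (simp add: exp_minus field_simps)
      then show ?thesis by (rule mult_right_le_imp_le) (use r(1) in simp)
    qed
    \<comment> \<open>Here the factor \<open>t\<close> turns the \<open>a0\<close> term into a first
      moment and the \<open>b0\<close> term into a second moment, at least
      \<open>exp (- 2) * (r ^ 3 / 64)\<close>; the constant 2048 is 32 times 64.\<close>
    have Eb: "\<bar>b0\<bar> * r \<le> 2048 * exp 2 * C1 * M2 * Ys"
    proof -
      have e: "(\<integral>t. (a0 + b0 * t) * (t * sbump m r (m + t *\<^sub>R perp n)) \<partial>lborel) = b0 * (\<integral>t. t\<^sup>2 * sbump m r (m + t *\<^sub>R perp n) \<partial>lborel)"
      proof -
        have "(\<integral>t. (a0 + b0 * t) * (t * sbump m r (m + t *\<^sub>R perp n)) \<partial>lborel)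
          = (\<integral>t. a0 * (t * sbump m r (m + t *\<^sub>R perp n)) + b0 * (t\<^sup>2 * sbump m r (m + t *\<^sub>R perp n)) \<partial>lborel)"
          by (simp add: algebra_simps power2_eq_square)
        then show ?thesis using L(3,5,6) by simp
      qed
      have "\<bar>b0 * (\<integral>t. t\<^sup>2 * sbump m r (m + t *\<^sub>R perp n) \<partial>lborel)\<bar> \<le> 32 * C1 * (M2 * r\<^sup>2) * Ys"
        using key[of "\<lambda>x. (perp n \<bullet> (x - m)) * sbump m r x" "M2 * r\<^sup>2"] M2 r(1) pq(3) so smooth_mult[OF smooth_inner smooth_sbump]
        unfolding mult_dd dn0 linet ab(1) e Ys_def by simp
      moreover have "\<bar>b0\<bar> * (exp (- 2) * (r ^ 3 / 64)) \<le> \<bar>b0\<bar> * \<bar>\<integral>t. t\<^sup>2 * sbump m r (m + t *\<^sub>R perp n) \<partial>lborel\<bar>"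
        using L(2) by (intro mult_left_mono) auto
      ultimately have "\<bar>b0\<bar> * (exp (- 2) * (r ^ 3 / 64)) \<le> 32 * C1 * (M2 * r\<^sup>2) * Ys" unfolding abs_mult by linarith
      then have "(\<bar>b0\<bar> * r) * (exp (- 2) * (r\<^sup>2 / 64)) \<le> (2048 * exp 2 * C1 * M2 * Ys) * (exp (- 2) * (r\<^sup>2 / 64))"
        by (simp add: exp_minus field_simps power2_eq_square power3_eq_cube)
      then show ?thesis by (rule mult_right_le_imp_le) (use r(1) in simp)
    qed
    have dd: "jump 2 n v Kp Km = dir_deriv n (dir_deriv n D)" "jump 3 n v Kp Km = dir_deriv n (dir_deriv n (dir_deriv n D))"
      unfolding D_def jump_def
      by (simp_all add: numeral_2_eq_2 numeral_3_eq_3 dir_deriv_diff smooth_dble sP smooth_dir_deriv)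
    have J2: "(edge_L2_norm e (jump 2 n v Kp Km))\<^sup>2 \<le> h * (C3 * Ys)\<^sup>2"
      unfolding h_def dd
    proof (rule edge_L2_norm_le[OF pq(1)])
      fix x assume "x \<in> e"
      then obtain t where t: "\<bar>t\<bar> \<le> dist p q / 2" "x = m + t *\<^sub>R perp n"
        unfolding pq(1) m_def using edge_param[OF pq(3,4)] by blast
      have "\<bar>a0 + b0 * t\<bar> \<le> \<bar>a0\<bar> + \<bar>b0\<bar> * \<bar>t\<bar>" by (simp add: abs_mult[symmetric])
      also have "\<bar>b0\<bar> * \<bar>t\<bar> \<le> \<bar>b0\<bar> * (h / 2)" using t(1) h(2) by (intro mult_left_mono) auto
      also have "\<bar>b0\<bar> * (h / 2) = g / 2 * (\<bar>b0\<bar> * r)" using r(3) by simp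
      also have "\<dots> \<le> g / 2 * (2048 * exp 2 * C1 * M2 * Ys)" using Eb g1 by (intro mult_left_mono) auto
      finally have "\<bar>a0 + b0 * t\<bar> \<le> 32 * exp 2 * C1 * M1 * Ys + g / 2 * (2048 * exp 2 * C1 * M2 * Ys)"
        using Ea by linarith
      then show "\<bar>dir_deriv n (dir_deriv n D) x\<bar> \<le> C3 * Ys"
        unfolding t(2) ab(1) C3_def by (simp add: algebra_simps)
    qed
    have J3: "\<iota> ^ 4 * (edge_L2_norm e (jump 3 n v Kp Km))\<^sup>2 \<le> h * (C4 * (r * Ys))\<^sup>2"
    proof -
      have "(edge_L2_norm e (jump 3 n v Kp Km))\<^sup>2 \<le> h * \<bar>D3\<bar>\<^sup>2"
        unfolding h_def dd by (rule edge_L2_norm_le[OF pq(1)]) (simp add: ab(2))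
      then have "\<iota> ^ 4 * (edge_L2_norm e (jump 3 n v Kp Km))\<^sup>2 \<le> \<iota> ^ 4 * (h * \<bar>D3\<bar>\<^sup>2)"
        by (intro mult_left_mono) auto
      also have "\<dots> = h * \<bar>\<iota>\<^sup>2 * D3\<bar>\<^sup>2" by (simp add: power_mult_distrib)
      also have "\<dots> \<le> h * (C4 * (r * Ys))\<^sup>2" using E3 h(1) by (intro mult_left_mono power_mono) auto
      finally show ?thesis .
    qed
    define Z where "Z K = h ^ 3 * (osc f K)\<^sup>2 + \<iota> ^ 4 / h ^ 3 * (err 3 w v K)\<^sup>2 + 1 / h * (err 2 w v K)\<^sup>2" for K
    have Z0: "0 \<le> Z K" for K unfolding Z_def using h(1) by (intro add_nonneg_nonneg) auto
    \<comment> \<open>The powers of \<open>h / r = g\<close> are at most the fourth; the fourth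
      comes from the third-order error.\<close>
    have YZ: "h * (Y K)\<^sup>2 \<le> 3 * g ^ 4 * Z K" for K
    proof -
      have "h * (Y K)\<^sup>2 \<le> h * (3 * ((r * osc f K)\<^sup>2 + (\<iota>\<^sup>2 * err 3 w v K / r\<^sup>2)\<^sup>2 + (err 2 w v K / r)\<^sup>2))"
        unfolding Y_def using h(1) square_sum3 by (intro mult_left_mono) auto
      also have "\<dots> = 3 * (h * r\<^sup>2 * (osc f K)\<^sup>2 + h / r ^ 4 * (\<iota> ^ 4 * (err 3 w v K)\<^sup>2) + h / r\<^sup>2 * (err 2 w v K)\<^sup>2)"
        by (simp add: power_mult_distrib power_divide algebra_simps flip: power_mult)
      also have "\<dots> \<le> 3 * (g ^ 4 * h ^ 3 * (osc f K)\<^sup>2 + g ^ 4 / h ^ 3 * (\<iota> ^ 4 * (err 3 w v K)\<^sup>2) + g ^ 4 / h * (err 2 w v K)\<^sup>2)"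
      proof (intro mult_left_mono add_mono mult_right_mono)
        have "h * r\<^sup>2 \<le> h * h\<^sup>2" using r h(1) by (intro mult_left_mono power_mono) auto
        also have "\<dots> = 1 * h ^ 3" by (simp add: power2_eq_square power3_eq_cube)
        also have "\<dots> \<le> g ^ 4 * h ^ 3" using g1 h(1) by (intro mult_right_mono) auto
        finally show "h * r\<^sup>2 \<le> g ^ 4 * h ^ 3" .
        show "h / r ^ 4 \<le> g ^ 4 / h ^ 3"
          using h(1) g1 by (simp add: r_def power_divide field_simps eval_nat_numeral)
        have "h / r\<^sup>2 = g\<^sup>2 / h" using h(1) g1 by (simp add: r_def power_divide field_simps power2_eq_square)
        also have "\<dots> \<le> g ^ 4 / h" using g1 h(1) by (intro divide_right_mono power_increasing) auto
        finally show "h / r\<^sup>2 \<le> g ^ 4 / h" .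
      qed auto
      also have "\<dots> = 3 * g ^ 4 * Z K" by (simp add: Z_def algebra_simps)
      finally show ?thesis .
    qed
    \<comment> \<open>All summands are nonnegative, so the two cells contribute at most the sum over
      the patch.\<close>
    have "(\<Sum>K\<in>{Kp, Km}. Z K) \<le> S"
      unfolding S Z_def[symmetric, unfolded h_def]
    proof (rule sum_mono2)
      show "finite (edge_patch T e)" using T(1) by (simp add: edge_patch_def triangulation_def)
    qed (use Kp Km Z0 in \<open>auto simp: Z_def h_def\<close>)
    then have SZ: "Z Kp + Z Km \<le> S" using ne by simp
    have S0: "0 \<le> S" using SZ Z0[of Kp] Z0[of Km] by linarith
    have hY: "h * Ys\<^sup>2 \<le> 6 * g ^ 4 * S"
    proof -
      have "h * Ys\<^sup>2 \<le> h * (2 * ((Y Kp)\<^sup>2 + (Y Km)\<^sup>2))"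
        unfolding Ys_def using h(1) square_sum2 by (intro mult_left_mono) auto
      also have "\<dots> = 2 * (h * (Y Kp)\<^sup>2 + h * (Y Km)\<^sup>2)" by (simp add: algebra_simps)
      also have "\<dots> \<le> 2 * (3 * g ^ 4 * Z Kp + 3 * g ^ 4 * Z Km)" by (intro mult_left_mono add_mono YZ) auto
      also have "\<dots> = 6 * g ^ 4 * (Z Kp + Z Km)" by (simp add: algebra_simps)
      also have "\<dots> \<le> 6 * g ^ 4 * S" using SZ by (intro mult_left_mono) auto
      finally show ?thesis .
    qed
    have c3: "C3\<^sup>2 * (6 * g ^ 4 * S) \<le> C * S" and c4: "C4\<^sup>2 * (6 * g ^ 4 * S) \<le> C * S"
    proof -
      have "0 \<le> 6 * g ^ 4 * C3\<^sup>2" "0 \<le> 6 * g ^ 4 * C4\<^sup>2" by auto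
      then have "6 * g ^ 4 * C3\<^sup>2 \<le> C" "6 * g ^ 4 * C4\<^sup>2 \<le> C" unfolding C_def distrib_left by linarith+
      then have "6 * g ^ 4 * C3\<^sup>2 * S \<le> C * S" "6 * g ^ 4 * C4\<^sup>2 * S \<le> C * S" using S0 by (auto intro: mult_right_mono)
      then show "C3\<^sup>2 * (6 * g ^ 4 * S) \<le> C * S" "C4\<^sup>2 * (6 * g ^ 4 * S) \<le> C * S" by (simp_all add: mult_ac)
    qed
    have "h * (C3 * Ys)\<^sup>2 = C3\<^sup>2 * (h * Ys\<^sup>2)" by (simp add: power_mult_distrib)
    also have "\<dots> \<le> C3\<^sup>2 * (6 * g ^ 4 * S)" using hY by (intro mult_left_mono) auto
    finally have F2: "(edge_L2_norm e (jump 2 n v Kp Km))\<^sup>2 \<le> C * S" using J2 c3 by linarith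
    have "h * (C4 * (r * Ys))\<^sup>2 = r\<^sup>2 * (C4\<^sup>2 * (h * Ys\<^sup>2))" by (simp add: power_mult_distrib)
    also have "\<dots> \<le> h\<^sup>2 * (C4\<^sup>2 * (6 * g ^ 4 * S))"
    proof (rule mult_mono)
      show "r\<^sup>2 \<le> h\<^sup>2" using r(1,4) by (intro power_mono) auto
      show "C4\<^sup>2 * (h * Ys\<^sup>2) \<le> C4\<^sup>2 * (6 * g ^ 4 * S)" using hY by (intro mult_left_mono) auto
    qed (use h(1) in auto)
    also have "\<dots> \<le> h\<^sup>2 * (C * S)" using c4 by (intro mult_left_mono) auto
    finally have F3: "\<iota> ^ 4 * (edge_L2_norm e (jump 3 n v Kp Km))\<^sup>2 \<le> h\<^sup>2 * (C * S)" using J3 by linarith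
    show "0 \<le> S \<and> 0 < diameter e \<and> (edge_L2_norm e (jump 2 n v Kp Km))\<^sup>2 \<le> C * S \<and>
      \<iota> ^ 4 * (edge_L2_norm e (jump 3 n v Kp Km))\<^sup>2 \<le> C * ((diameter e)\<^sup>2 * S)"
      using F2 F3 h(1) S0 by (simp add: h_def mult_ac)
  qed
qed

theorem lemma5p3:
  fixes \<Omega> :: "(real^2) set" and \<gamma>0 :: real
  assumes "convex_polygon \<Omega>" and "1 \<le> \<gamma>0"
  shows "\<exists>C>0. \<forall>T \<iota> f w vh.
    triangulation_of \<Omega> T \<and> shape_regular \<gamma>0 T \<and> 0 < \<iota> \<and> \<iota> < 1 \<and> f \<in> L2 \<Omega> \<and>
    weak_solution \<Omega> \<iota> f w \<and> vh \<in> hermite_space \<Omega> T \<longrightarrow>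
    (\<forall>K\<in>T.
      L2_norm (interior K) f \<le>
        C * (L2_norm (interior K) (\<lambda>x. f x - proj0 (interior K) f)
             + \<iota>\<^sup>2 / diameter K ^ 3 * sobolev_seminorm (interior K) 3 (\<lambda>x. w x - vh x)
             + 1 / diameter K ^ 2 * sobolev_seminorm (interior K) 2 (\<lambda>x. w x - vh x))) \<and>
    (\<forall>e\<in>interior_edges \<Omega> T. \<forall>Kp\<in>edge_patch T e. \<forall>Km\<in>edge_patch T e. \<forall>n.
      Kp \<noteq> Km \<and> outward_unit_normal Kp e n \<longrightarrow>
      \<iota> ^ 4 * (edge_L2_norm e (jump 3 n vh Kp Km))\<^sup>2 \<le>
        C * (diameter e ^ 5 *
               (\<Sum>K\<in>edge_patch T e. (L2_norm (interior K) (\<lambda>x. f x - proj0 (interior K) f))\<^sup>2)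
             + \<iota> ^ 4 / diameter e *
               (\<Sum>K\<in>edge_patch T e. (sobolev_seminorm (interior K) 3 (\<lambda>x. w x - vh x))\<^sup>2)
             + diameter e *
               (\<Sum>K\<in>edge_patch T e. (sobolev_seminorm (interior K) 2 (\<lambda>x. w x - vh x))\<^sup>2)) \<and>
      (edge_L2_norm e (jump 2 n vh Kp Km))\<^sup>2 \<le>
        C * (diameter e ^ 3 *
               (\<Sum>K\<in>edge_patch T e. (L2_norm (interior K) (\<lambda>x. f x - proj0 (interior K) f))\<^sup>2)
             + \<iota> ^ 4 / diameter e ^ 3 *
               (\<Sum>K\<in>edge_patch T e. (sobolev_seminorm (interior K) 3 (\<lambda>x. w x - vh x))\<^sup>2)
             + 1 / diameter e *
               (\<Sum>K\<in>edge_patch T e. (sobolev_seminorm (interior K) 2 (\<lambda>x. w x - vh x))\<^sup>2)))"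
proof (rule interior_estimate[of \<gamma>0], rule edge_estimate[of \<gamma>0], goal_cases)
  case (1 C1 C2)
  note I = 1(1,2) and E = 1(3,4)
  \<comment> \<open>The sum of two nonnegative constants dominates both, so one constant serves all
    three bounds.\<close>
  define C where "C = C1 + C2"
  have C: "C > 0" "C1 \<le> C" "C2 \<le> C" using I(1) E(1) by (auto simp: C_def)
  have patch: "S = d ^ 3 * (\<Sum>K\<in>P. (osc f K)\<^sup>2) + \<iota> ^ 4 / d ^ 3 * (\<Sum>K\<in>P. (err 3 w v K)\<^sup>2) + 1 / d * (\<Sum>K\<in>P. (err 2 w v K)\<^sup>2)"
    if "S = (\<Sum>K\<in>P. d ^ 3 * (osc f K)\<^sup>2 + \<iota> ^ 4 / d ^ 3 * (err 3 w v K)\<^sup>2 + 1 / d * (err 2 w v K)\<^sup>2)"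
    for S d \<iota> f w v P
    unfolding that by (simp add: sum.distrib sum_distrib_left)
  show ?case
  proof (intro exI[of _ C] conjI C(1) allI impI ballI, goal_cases)
    case (1 T \<iota> f w vh K)
    then have a: "admissible \<gamma>0 \<Omega> T \<iota> f w vh" using assms by (simp add: admissible_def)
    have "diameter K \<ge> 0"
      using cell_facts(4)[OF a 1(2)] triangle_compact_convex(1) compact_imp_bounded diameter_ge_0 by blast
    then show ?case
      by (intro order_trans[OF I(2)[OF a 1(2)]] mult_right_mono C(2) add_nonneg_nonneg mult_nonneg_nonneg seminorm_nonneg) auto
  next
    case (2 T \<iota> f w vh e Kp Km n)
    then have a: "admissible \<gamma>0 \<Omega> T \<iota> f w vh" using assms by (simp add: admissible_def)
    define d where "d = diameter e"
    define S where "S = (\<Sum>K\<in>edge_patch T e. d ^ 3 * (osc f K)\<^sup>2 + \<iota> ^ 4 / d ^ 3 * (err 3 w vh K)\<^sup>2 + 1 / d * (err 2 w vh K)\<^sup>2)"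
    note est = E(2)[OF a 2(3-5) S_def[unfolded d_def]]
    have "C2 * (d\<^sup>2 * S) \<le> C * (d\<^sup>2 * S)" using C(3) est by (intro mult_right_mono) auto
    \<comment> \<open>Multiplying the weights of \<open>S\<close> by the squared edge length
      produces the weights of the third-derivative bound.\<close>
    moreover have "d\<^sup>2 * (\<iota> ^ 4 / d ^ 3) = \<iota> ^ 4 / d" "d\<^sup>2 * (1 / d) = d" "d\<^sup>2 * d ^ 3 = d ^ 5"
      using est unfolding d_def[symmetric] by (simp_all add: field_simps eval_nat_numeral)
    then have "d\<^sup>2 * S = d ^ 5 * (\<Sum>K\<in>edge_patch T e. (osc f K)\<^sup>2)
      + \<iota> ^ 4 / d * (\<Sum>K\<in>edge_patch T e. (err 3 w vh K)\<^sup>2) + d * (\<Sum>K\<in>edge_patch T e. (err 2 w vh K)\<^sup>2)"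
      unfolding patch[OF S_def] distrib_left mult.assoc[symmetric] by simp
    ultimately show ?case using est unfolding d_def[symmetric] by (simp only:) linarith
  next
    case (3 T \<iota> f w vh e Kp Km n)
    then have a: "admissible \<gamma>0 \<Omega> T \<iota> f w vh" using assms by (simp add: admissible_def)
    define S where "S = (\<Sum>K\<in>edge_patch T e. diameter e ^ 3 * (osc f K)\<^sup>2
      + \<iota> ^ 4 / diameter e ^ 3 * (err 3 w vh K)\<^sup>2 + 1 / diameter e * (err 2 w vh K)\<^sup>2)"
    note est = E(2)[OF a 3(3-5) S_def]
    have "C2 * S \<le> C * S" using C(3) est by (intro mult_right_mono) auto
    then show ?case using est unfolding patch[OF S_def, symmetric] by linarith
  qed
qed

end
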